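(* Let $d$ be a positive integer and $n \le 2^{d/4}$. Consider the dynamic \emph{least-bit polynomial evaluation} problem over $GF(2^d)$: a polynomial $P(x) = \sum_{i=0}^n a_i x^i$ of degree at most $n$ over $GF(2^d)$ is initialized with all coefficients $a_i = 0$; an update $(i,b)$ with $i \in \{0,\dots,n\}$ and $b \in GF(2^d)$ sets $a_i \gets a_i + b$ (addition in $GF(2^d)$); a query $y \in GF(2^d)$ must return the least significant bit of (the bit-string representation of) $P(y)$. Then any cell probe data structure for this problem having cell size $w$, worst-case update time $t_u$ and expected average query time $t_q$ must satisfy $$t_q = \Omega\left( \min\left\{ \frac{d\sqrt{\lg n}}{\lg^2(t_u w)},\; \frac{\sqrt{n}}{(t_u w)^{O(1)}} \right\}\right).$$
   Context: Elements of $GF(2^d)$ are represented by bit strings in $\{0,1\}^d$ via an arbitrary fixed bijection (so exactly half of the field elements have least significant bit $0$); the result holds for any such bijection. Cell probe model: the data structure's memory consists of cells of $w$ bits each, and the cost of an operation is the number of memory cells it reads or writes (probes); all computation is free. Worst-case update time $t_u$ means every update probes at most $t_u$ cells; expected average query time $t_q$ means the expected number of cells probed by a query, averaged over all possible queries, is at most $t_q$. Standing assumption: $w = \Omega(\lg n)$. *)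

theory Defs
  imports "HOL-Algebra.Ring" "HOL-Probability.Probability_Mass_Function"
begin

text \<open>
  Cell probe programs. Addresses and cell contents are naturals below \<open>2 ^ w\<close>: as usual in the
  cell probe model, a cell of \<open>w\<close> bits can hold the address of any cell. The continuation of
  \<open>Read\<close> and the arguments of the data structure operations are arbitrary functions, so
  computation between probes is free.
\<close>

type_synonym memory = "nat \<Rightarrow> nat"

datatype 'r prog =
    Return 'r
  | Read nat "nat \<Rightarrow> 'r prog"
  | Write nat nat "'r prog"

primrec valid_prog :: "nat \<Rightarrow> 'r prog \<Rightarrow> bool" where
  "valid_prog w (Return r) \<longleftrightarrow> True"
| "valid_prog w (Read a k) \<longleftrightarrow> a < 2 ^ w \<and> (\<forall>v < 2 ^ w. valid_prog w (k v))"
| "valid_prog w (Write a v p) \<longleftrightarrow> a < 2 ^ w \<and> v < 2 ^ w \<and> valid_prog w p"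

primrec result :: "'r prog \<Rightarrow> memory \<Rightarrow> 'r" where
  "result (Return r) = (\<lambda>m. r)"
| "result (Read a k) = (\<lambda>m. result (k (m a)) m)"
| "result (Write a v p) = (\<lambda>m. result p (m(a := v)))"

primrec final_memory :: "'r prog \<Rightarrow> memory \<Rightarrow> memory" where
  "final_memory (Return r) = (\<lambda>m. m)"
| "final_memory (Read a k) = (\<lambda>m. final_memory (k (m a)) m)"
| "final_memory (Write a v p) = (\<lambda>m. final_memory p (m(a := v)))"

primrec probed_cells :: "'r prog \<Rightarrow> memory \<Rightarrow> nat set" where
  "probed_cells (Return r) = (\<lambda>m. {})"
| "probed_cells (Read a k) = (\<lambda>m. insert a (probed_cells (k (m a)) m))"
| "probed_cells (Write a v p) = (\<lambda>m. insert a (probed_cells p (m(a := v))))"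

text \<open>Repeated probes of one cell count once, which only lowers the cost charged.\<close>

definition probes :: "'r prog \<Rightarrow> memory \<Rightarrow> nat" where
  "probes p m = card (probed_cells p m)"

record 'a data_structure =
  initial_memory :: memory
  update_prog :: "nat \<Rightarrow> 'a \<Rightarrow> unit prog"
  query_prog :: "'a \<Rightarrow> bool prog"

definition memory_after :: "'a data_structure \<Rightarrow> (nat \<times> 'a) list \<Rightarrow> memory" where
  "memory_after D us = fold (\<lambda>(i, b). final_memory (update_prog D i b)) us (initial_memory D)"

definition updates :: "('a, 'm) ring_scheme \<Rightarrow> nat \<Rightarrow> (nat \<times> 'a) set" where
  "updates F n = {0..n} \<times> carrier F"

definition coeffs_after :: "('a, 'm) ring_scheme \<Rightarrow> (nat \<times> 'a) list \<Rightarrow> nat \<Rightarrow> 'a" where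
  "coeffs_after F us = fold (\<lambda>(i, b) a. a(i := a i \<oplus>\<^bsub>F\<^esub> b)) us (\<lambda>i. \<zero>\<^bsub>F\<^esub>)"

definition poly_eval :: "('a, 'm) ring_scheme \<Rightarrow> nat \<Rightarrow> (nat \<Rightarrow> 'a) \<Rightarrow> 'a \<Rightarrow> 'a" where
  "poly_eval F n a y = (\<Oplus>\<^bsub>F\<^esub>i\<in>{0..n}. a i \<otimes>\<^bsub>F\<^esub> y [^]\<^bsub>F\<^esub> i)"

text \<open>Bit strings are written with the most significant bit first.\<close>

definition least_bit :: "('a \<Rightarrow> bool list) \<Rightarrow> 'a \<Rightarrow> bool" where
  "least_bit enc x = last (enc x)"

text \<open>
  The field is a locale-based ring rather than a type so that \<open>d\<close> can be quantified inside a formula,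
  after the constants of an asymptotic bound. Over an infinite type such as \<open>nat\<close> every \<open>GF(2 ^ d)\<close>
  occurs, so constants chosen before \<open>F\<close> are uniform in \<open>d\<close>.
\<close>

definition is_GF2 :: "('a, 'm) ring_scheme \<Rightarrow> nat \<Rightarrow> bool" where
  "is_GF2 F d \<longleftrightarrow> field F \<and> finite (carrier F) \<and> card (carrier F) = 2 ^ d"

definition bit_encoding :: "('a, 'm) ring_scheme \<Rightarrow> nat \<Rightarrow> ('a \<Rightarrow> bool list) \<Rightarrow> bool" where
  "bit_encoding F d enc \<longleftrightarrow> bij_betw enc (carrier F) {bs. length bs = d}"

definition has_cell_size ::
    "('a, 'm) ring_scheme \<Rightarrow> nat \<Rightarrow> nat \<Rightarrow> 'a data_structure \<Rightarrow> bool" where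
  "has_cell_size F n w D \<longleftrightarrow>
     (\<forall>a < 2 ^ w. initial_memory D a < 2 ^ w) \<and>
     (\<forall>(i, b) \<in> updates F n. valid_prog w (update_prog D i b)) \<and>
     (\<forall>y \<in> carrier F. valid_prog w (query_prog D y))"

text \<open>
  Queries may write, but every query is posed directly after a sequence of updates; not demanding
  anything about what happens after a query admits more data structures.
\<close>

definition solves_least_bit_poly_eval ::
    "('a, 'm) ring_scheme \<Rightarrow> ('a \<Rightarrow> bool list) \<Rightarrow> nat \<Rightarrow> 'a data_structure \<Rightarrow> bool" where
  "solves_least_bit_poly_eval F enc n D \<longleftrightarrow>
     (\<forall>us \<in> lists (updates F n). \<forall>y \<in> carrier F.
        result (query_prog D y) (memory_after D us) =
          least_bit enc (poly_eval F n (coeffs_after F us) y))"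

definition worst_case_update_time ::
    "('a, 'm) ring_scheme \<Rightarrow> nat \<Rightarrow> nat \<Rightarrow> 'a data_structure \<Rightarrow> bool" where
  "worst_case_update_time F n t\<^sub>u D \<longleftrightarrow>
     (\<forall>us \<in> lists (updates F n). \<forall>(i, b) \<in> updates F n.
        probes (update_prog D i b) (memory_after D us) \<le> t\<^sub>u)"

text \<open>
  A randomized data structure is a probability distribution over deterministic ones. Discrete
  distributions suffice: with \<open>2 ^ w\<close> cells and finitely many operations there are only finitely
  many observable behaviours. For the same reason all expectations below exist (at most \<open>2 ^ w\<close>
  cells are probed), as soon as \<open>has_cell_size\<close> holds on the support.
\<close>

definition randomized_least_bit_ds ::
    "('a, 'm) ring_scheme \<Rightarrow> ('a \<Rightarrow> bool list) \<Rightarrow> nat \<Rightarrow> nat \<Rightarrow> nat \<Rightarrow>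
     'a data_structure pmf \<Rightarrow> bool" where
  "randomized_least_bit_ds F enc n w t\<^sub>u R \<longleftrightarrow>
     (\<forall>D \<in> set_pmf R. has_cell_size F n w D \<and> solves_least_bit_poly_eval F enc n D \<and>
        worst_case_update_time F n t\<^sub>u D)"

definition expected_average_query_time ::
    "('a, 'm) ring_scheme \<Rightarrow> nat \<Rightarrow> real \<Rightarrow> 'a data_structure pmf \<Rightarrow> bool" where
  "expected_average_query_time F n t\<^sub>q R \<longleftrightarrow>
     (\<forall>us \<in> lists (updates F n).
        (\<Sum>y \<in> carrier F.
           measure_pmf.expectation R (\<lambda>D. real (probes (query_prog D y) (memory_after D us))))
          / real (card (carrier F)) \<le> t\<^sub>q)"

end

theory Submission
  imports Defs "HOL-Computational_Algebra.Polynomial"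
begin

text \<open>
  The proof turns a fast data structure into a one-way communication protocol with a small advantage
  over random guessing, and shows that no such protocol exists.

  The updates come in blocks (epochs) of geometrically decreasing sizes; block \<open>e\<close> adds a random
  polynomial of degree below its size. Some epoch owns only a small share of the cells that an average
  query probes, where a cell belongs to the last epoch that touches it. Fix all other epochs. Alice
  sends Bob the cells touched after the epoch, and those touched in the epoch that lie in a public random
  set of cells. Bob runs the query on the memory from before the epoch, patched by the message. With
  probability \<open>\<epsilon>\<close>, not too small, this is the true run of the query; but if it is not, the
  answer may be biased the wrong way. A low degree polynomial in the number of cells
  of the run that Bob has wrong, equal to 1 at 0 and at most \<open>\<epsilon> / 2\<close> at the other possible values, isolates
  the good case. One of its monomials, the event that a certain small set of cells is wrong, must
  then be correlated with the answer, and Bob sees whether it happens if these cells lie in a second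
  public random set. The square root in the bound comes from the degree of that polynomial, which is
  of the order \<open>sqrt (k * ln (1 / \<epsilon>))\<close> for runs of length \<open>k\<close>.

  On the other hand, the answers to different queries are signs that are independent as long as one
  looks at no more of them than the epoch has updates. The high moments of their weighted sums over all
  queries are therefore those of random signs, so that a message shorter than the epoch gives an
  advantage of at most about the square root of the size of the epoch over the size of the field.
\<close>

section \<open>Low degree approximation of OR\<close>

text \<open>The bound is a balance of exponents. A cell enters a public set with probability p about
  1/q, where \<open>q = t\<^sub>u * w\<close>, so that the public cells of an epoch fit into a
  message shorter than the epoch. With about lg n / lg q epochs, some epoch owns k0, about t * lg q
  / lg n, of the probes of a query. A run then survives with probability p^k0, a loss of
  \<open>\<kappa>\<close>, about k0 * lg q, bits. The polynomial has degree about sqrt (t *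
  \<open>\<kappa>\<close>), and each cell of its monomial costs another factor p. In bits the main
  loss is lg q * sqrt (t * \<open>\<kappa>\<close>), about t * lg^2 q / sqrt (lg n). It must reach
  order d, the advantage that independence excludes, or else about sqrt n / q, where overlong
  messages stop being negligible. Two public sets are needed because the set of cells to be tested
  depends on the message for the first one; a fresh independent set contains it with probability
  exactly p to its size. Passing from the polynomial to one monomial loses a factor
  \<open>l1_norm\<close>, so this norm is controlled together with the degree. It costs only a
  constant number of bits per unit of the degree bound.\<close>

definition l1_norm :: "real poly \<Rightarrow> real" where
  "l1_norm p = (\<Sum>i\<le>degree p. \<bar>coeff p i\<bar>)"

lemma l1_norm_alt: "degree p \<le> n \<Longrightarrow> l1_norm p = (\<Sum>i\<le>n. \<bar>coeff p i\<bar>)"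
  unfolding l1_norm_def
  by (rule sum.mono_neutral_left) (auto simp: coeff_eq_0)

lemma l1_norm_nonneg: "0 \<le> l1_norm p"
  by (simp add: l1_norm_def sum_nonneg)

lemma l1_norm_0 [simp]: "l1_norm 0 = 0"
  by (simp add: l1_norm_def)

lemma l1_norm_pCons [simp]: "l1_norm (pCons a p) = \<bar>a\<bar> + l1_norm p"
proof -
  have "l1_norm (pCons a p) = (\<Sum>i\<le>Suc (degree p). \<bar>coeff (pCons a p) i\<bar>)"
    by (rule l1_norm_alt) (simp add: degree_pCons_le)
  also have "\<dots> = \<bar>a\<bar> + l1_norm p"
    by (simp only: sum.atMost_Suc_shift) (simp add: l1_norm_def)
  finally show ?thesis .
qed

lemma l1_norm_add: "l1_norm (p + q) \<le> l1_norm p + l1_norm q"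
proof -
  let ?n = "max (degree p) (degree q)"
  have "l1_norm (p + q) = (\<Sum>i\<le>?n. \<bar>coeff p i + coeff q i\<bar>)"
    using l1_norm_alt[of "p + q" ?n] by (simp add: degree_add_le_max)
  also have "\<dots> \<le> (\<Sum>i\<le>?n. \<bar>coeff p i\<bar> + \<bar>coeff q i\<bar>)"
    by (intro sum_mono abs_triangle_ineq)
  also have "\<dots> = l1_norm p + l1_norm q"
    by (simp add: sum.distrib l1_norm_alt[of p ?n] l1_norm_alt[of q ?n])
  finally show ?thesis .
qed

lemma l1_norm_smult [simp]: "l1_norm (smult c p) = \<bar>c\<bar> * l1_norm p"
  using l1_norm_alt[of "smult c p" "degree p"]
  by (simp add: abs_mult sum_distrib_left l1_norm_def)

lemma l1_norm_mult: "l1_norm (p * q) \<le> l1_norm p * l1_norm q"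
proof (induction p)
  case (pCons a p)
  have "l1_norm (pCons a p * q) \<le> \<bar>a\<bar> * l1_norm q + l1_norm (p * q)"
    using l1_norm_add[of "smult a q" "pCons 0 (p * q)"] by simp
  with pCons show ?case by (simp add: distrib_right)
qed simp

lemma l1_norm_power: "l1_norm (p ^ n) \<le> l1_norm p ^ n"
proof (induction n)
  case 0
  have "l1_norm [:1:] = 1" by (simp only: l1_norm_pCons) simp
  then show ?case by (simp add: one_pCons)
next
  case (Suc n)
  then show ?case
    using l1_norm_mult[of p "p ^ n"] mult_left_mono[OF Suc l1_norm_nonneg[of p]] by simp
qed

lemma l1_norm_prod: "l1_norm (\<Prod>i\<in>A. p i) \<le> (\<Prod>i\<in>A. l1_norm (p i))"
proof (induction A rule: infinite_finite_induct)
  case (insert x F)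
  then show ?case
    using l1_norm_mult[of "p x" "\<Prod>i\<in>F. p i"]
      mult_left_mono[OF insert.IH l1_norm_nonneg[of "p x"]] by simp
qed (simp_all add: one_pCons)

section \<open>Chebyshev polynomials\<close>

fun cheb :: "'a::comm_ring_1 \<Rightarrow> nat \<Rightarrow> 'a" where
  "cheb x 0 = 1"
| "cheb x (Suc 0) = x"
| "cheb x (Suc (Suc n)) = 2 * x * cheb x (Suc n) - cheb x n"

text \<open>The recursion is stated over any commutative ring, so \<open>cheb\<close> of a
  polynomial is the composed polynomial and its values are \<open>cheb\<close> of a number.\<close>

lemma poly_cheb: "poly (cheb p n) z = cheb (poly p z) n"
  by (induction p n rule: cheb.induct) auto

lemma cheb_cos: "cheb (cos t) n = cos (real n * t)"
proof (induction "cos t :: real" n rule: cheb.induct)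
  case (3 n)
  have "cos (real (Suc (Suc n)) * t) + cos (real n * t)
      = 2 * cos t * cos (real (Suc n) * t)"
    using cos_add[of "real (Suc n) * t" t] cos_diff[of "real (Suc n) * t" t]
    by (simp add: algebra_simps)
  with 3 show ?case by simp
qed auto

lemma abs_cheb_le_1:
  fixes x :: real assumes "\<bar>x\<bar> \<le> 1" shows "\<bar>cheb x n\<bar> \<le> 1"
proof -
  have "x = cos (arccos x)" using assms by (simp add: cos_arccos_abs)
  then show ?thesis using cheb_cos[of "arccos x" n] by (metis abs_cos_le_one)
qed

text \<open>The first bound is the tangent at 1, where the derivative is \<open>n ^ 2\<close>; in
  particular \<open>cheb x n\<close> is already 2 at \<open>x = 1 + 1 / n ^ 2\<close>. The bound on
  increments is what the induction carries along.\<close>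

lemma cheb_growth:
  fixes x :: real assumes "x \<ge> 1"
  shows "cheb x n \<ge> 1 + (x - 1) * real n ^ 2 \<and>
    cheb x (Suc n) - cheb x n \<ge> (x - 1) * (2 * real n + 1)"
proof (induction n)
  case (Suc n)
  have a: "cheb x (Suc n) \<ge> 1 + (x - 1) * real (Suc n) ^ 2"
    using Suc by (simp add: algebra_simps power2_eq_square)
  have "cheb x (Suc n) \<ge> 1" by (rule order_trans[OF _ a]) (use assms in simp)
  then have "2 * (x - 1) * cheb x (Suc n) \<ge> 2 * (x - 1) * 1"
    using assms by (intro mult_left_mono) auto
  then have "cheb x (Suc (Suc n)) - cheb x (Suc n) \<ge> (x - 1) * (2 * real (Suc n) + 1)"
    using Suc by (simp add: algebra_simps)
  with a show ?case by blast
qed simp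

text \<open>Increments satisfy \<open>cheb x (n + 2) - cheb x (n + 1) = (cheb x (n + 1) - cheb x n)
  + 2 * (x - 1) * cheb x (n + 1)\<close>, a sum of terms that grow with \<open>x\<close>; hence
  values and increments are compared together.\<close>

lemma cheb_mono:
  fixes x y :: real assumes "1 \<le> x" "x \<le> y"
  shows "cheb x n \<le> cheb y n \<and> cheb x (Suc n) - cheb x n \<le> cheb y (Suc n) - cheb y n"
proof (induction n)
  case (Suc n)
  have a: "cheb x (Suc n) \<le> cheb y (Suc n)" using Suc by linarith
  have "1 + (x - 1) * real (Suc n) ^ 2 \<le> cheb x (Suc n)" using cheb_growth[OF assms(1)] by blast
  then have "0 \<le> cheb x (Suc n)" using assms
    by (smt (verit) mult_nonneg_nonneg zero_le_power2)
  then have "2 * (x - 1) * cheb x (Suc n) \<le> 2 * (y - 1) * cheb y (Suc n)"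
    using assms a by (intro mult_mono) auto
  then have "cheb x (Suc (Suc n)) - cheb x (Suc n) \<le> cheb y (Suc (Suc n)) - cheb y (Suc n)"
    using Suc by (simp add: algebra_simps)
  with a show ?case by blast
qed (use assms in simp)

text \<open>The norm bound 4 fits the affine substitution in \<open>halving_poly\<close>. The base
  16 is crude, but closes the recursion because 8 * 16 + 1 is at most 16 * 16.\<close>

lemma cheb_degree_l1:
  assumes "degree p \<le> 1" "l1_norm p \<le> 4"
  shows "degree (cheb p n) \<le> n \<and> l1_norm (cheb p n) \<le> 16 ^ n"
  using assms
proof (induction p n rule: cheb.induct)
  case (1 x)
  show ?case by (simp add: one_pCons)
next
  case (2 x)
  have "l1_norm x \<le> 16" using 2 by linarith
  with 2 show ?case by simp
next
  case (3 x n)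
  have IH: "degree x \<le> 1" "l1_norm x \<le> 4" "degree (cheb x (Suc n)) \<le> Suc n"
    "l1_norm (cheb x (Suc n)) \<le> 16 ^ Suc n" "degree (cheb x n) \<le> n" "l1_norm (cheb x n) \<le> 16 ^ n"
    using 3 by blast+
  have eq: "cheb x (Suc (Suc n)) = (x + x) * cheb x (Suc n) + smult (-1) (cheb x n)"
    unfolding cheb.simps(3) mult_2 by simp
  have "degree ((x + x) * cheb x (Suc n)) \<le> 1 + Suc n"
    by (intro order_trans[OF degree_mult_le] add_mono degree_add_le IH)
  then have deg: "degree (cheb x (Suc (Suc n))) \<le> Suc (Suc n)"
    unfolding eq using IH(5) by (intro degree_add_le) (simp_all del: One_nat_def)
  have "l1_norm (x + x) \<le> 8" using l1_norm_add[of x x] IH(2) by linarith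
  then have a: "l1_norm ((x + x) * cheb x (Suc n)) \<le> 8 * 16 ^ Suc n"
    by (intro order_trans[OF l1_norm_mult] mult_mono l1_norm_nonneg IH(4)) auto
  have "l1_norm (cheb x (Suc (Suc n))) \<le> 8 * 16 ^ Suc n + 16 ^ n"
    unfolding eq using l1_norm_add[of "(x + x) * cheb x (Suc n)" "smult (-1) (cheb x n)"] a IH(6)
    by (simp only: l1_norm_smult)
  also have "\<dots> \<le> 16 ^ Suc (Suc n)" by simp
  finally show ?case using deg by blast
qed

text \<open>With \<open>m = 1 / d ^ 2\<close>, the map from \<open>z\<close> to
  \<open>1 + m - 2 * z\<close> sends \<open>[m, 1]\<close> into \<open>[-1, 1]\<close>, where the
  Chebyshev polynomial is at most 1, and sends 0 to \<open>1 + m\<close>, where it is at least 2.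
  Dividing by the value at 0 gives \<open>Q\<close>.\<close>

lemma halving_poly:
  fixes d :: nat
  assumes "d > 0"
  obtains Q :: "real poly" where "degree Q \<le> d" "l1_norm Q \<le> 16 ^ d" "poly Q 0 = 1"
    "\<And>z. 0 \<le> z \<Longrightarrow> z \<le> 1 \<Longrightarrow> \<bar>poly Q z\<bar> \<le> 1"
    "\<And>z. 1 / real d ^ 2 \<le> z \<Longrightarrow> z \<le> 1 \<Longrightarrow> \<bar>poly Q z\<bar> \<le> 1 / 2"
proof -
  define m where "m = 1 / real d ^ 2"
  define L where "L = [:1 + m, -2:]"
  define c where "c = cheb (1 + m) d"
  have m: "0 < m" "m \<le> 1" using assms by (auto simp: m_def divide_simps)
  have c: "c \<ge> 2"
    using cheb_growth[of "1 + m" d] m assms by (simp add: c_def m_def)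
  have L: "degree L \<le> 1" "l1_norm L \<le> 4" using m by (auto simp: L_def)
  define Q where "Q = smult (1 / c) (cheb L d)"
  have Qz: "poly Q z = cheb (1 + m - 2 * z) d / c" for z
    by (simp add: Q_def poly_cheb L_def algebra_simps)
  have 1: "\<bar>cheb (1 + m - 2 * z) d\<bar> \<le> c" if "0 \<le> z" "z \<le> 1" for z
  proof (cases "1 \<le> 1 + m - 2 * z")
    case True
    have "0 \<le> cheb (1 + m - 2 * z) d"
      using cheb_growth[OF True, of d] True
      by (smt (verit) mult_nonneg_nonneg zero_le_power2)
    with cheb_mono[OF True, of "1 + m" d] that show ?thesis by (simp add: c_def)
  next
    case False
    then have "\<bar>cheb (1 + m - 2 * z) d\<bar> \<le> 1"
      using that m by (intro abs_cheb_le_1) auto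
    with c show ?thesis by simp
  qed
  have 2: "\<bar>cheb (1 + m - 2 * z) d\<bar> \<le> 1" if "m \<le> z" "z \<le> 1" for z
    using that m by (intro abs_cheb_le_1) auto
  show ?thesis
  proof (rule that[of Q])
    show "degree Q \<le> d" using cheb_degree_l1[OF L, of d] by (simp add: Q_def)
    have "l1_norm Q \<le> 1 / c * 16 ^ d"
      using cheb_degree_l1[OF L, of d] c by (simp add: Q_def divide_right_mono)
    also have "\<dots> \<le> 1 * 16 ^ d" using c by (intro mult_right_mono) auto
    finally show "l1_norm Q \<le> 16 ^ d" by simp
    show "poly Q 0 = 1" using c by (simp add: Qz) (simp add: c_def)
    show "\<bar>poly Q z\<bar> \<le> 1" if "0 \<le> z" "z \<le> 1" for z
      using 1[OF that] c by (simp add: Qz)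
    show "\<bar>poly Q z\<bar> \<le> 1 / 2" if "1 / real d ^ 2 \<le> z" "z \<le> 1" for z
    proof -
      have "2 * \<bar>cheb (1 + m - 2 * z) d\<bar> \<le> c" using 2[of z] that c by (simp add: m_def)
      then show ?thesis using c by (simp add: Qz field_simps)
    qed
  qed
qed

text \<open>\<open>n ^ n / n!\<close> is one term of the exponential series at \<open>n\<close>,
  hence at most \<open>e ^ n\<close>.\<close>

lemma power_le_fact: "real n ^ n \<le> 4 ^ n * fact n"
proof -
  have "real n ^ n / fact n \<le> exp (real n)"
    using sum_le_suminf[OF summable_exp[of "real n"], of "{n}"]
    by (simp add: exp_def divide_inverse mult.commute)
  also have "exp (real n) = exp 1 ^ n" by (simp add: exp_of_nat_mult[symmetric])
  also have "\<dots> \<le> 4 ^ n" using exp_le by (intro power_mono) auto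
  finally show ?thesis by (simp add: field_simps)
qed

text \<open>Exact roots at \<open>1, \<dots>, \<kappa>\<close> and, on every scale \<open>4 ^ i * \<kappa>\<close>, a Chebyshev factor that absorbs the growth
  of the root part beyond its roots.\<close>

lemma or_approximation:
  fixes I \<kappa> :: nat
  assumes "\<kappa> > 0"
  obtains R :: "real poly" where
    "degree R \<le> 11 * (2 ^ I * \<kappa>)" "l1_norm R \<le> 2 ^ (45 * (2 ^ I * \<kappa>))" "poly R 0 = 1"
    "\<And>m. 1 \<le> m \<Longrightarrow> m \<le> 4 ^ I * \<kappa> \<Longrightarrow> \<bar>poly R (real m / real (4 ^ I * \<kappa>))\<bar> \<le> (1 / 2) ^ \<kappa>"
proof -
  define k where "k = 4 ^ I * \<kappa>"
  define A :: "real poly" where "A = (\<Prod>j\<in>{1..\<kappa>}. [:1, - (real k / real j):])"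
  \<comment> \<open>\<open>Q i\<close> has degree \<open>2 ^ (I - i)\<close>, so it halves from
    \<open>z = 4 ^ i / 4 ^ I\<close> on, that is from \<open>m = 4 ^ i * \<kappa>\<close> on. The
    degrees form a geometric series: all scales together cost only twice the largest.\<close>
  have "\<exists>Q :: nat \<Rightarrow> real poly. \<forall>i. degree (Q i) \<le> 2 ^ (I - i) \<and> l1_norm (Q i) \<le> 16 ^ (2 ^ (I - i)) \<and>
      poly (Q i) 0 = 1 \<and> (\<forall>z. 0 \<le> z \<longrightarrow> z \<le> 1 \<longrightarrow> \<bar>poly (Q i) z\<bar> \<le> 1) \<and>
      (\<forall>z. 1 / real (2 ^ (I - i)) ^ 2 \<le> z \<longrightarrow> z \<le> 1 \<longrightarrow> \<bar>poly (Q i) z\<bar> \<le> 1 / 2)"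
  proof (rule choice, rule allI)
    fix i
    show "\<exists>Q :: real poly. degree Q \<le> 2 ^ (I - i) \<and> l1_norm Q \<le> 16 ^ (2 ^ (I - i)) \<and>
      poly Q 0 = 1 \<and> (\<forall>z. 0 \<le> z \<longrightarrow> z \<le> 1 \<longrightarrow> \<bar>poly Q z\<bar> \<le> 1) \<and>
      (\<forall>z. 1 / real (2 ^ (I - i)) ^ 2 \<le> z \<longrightarrow> z \<le> 1 \<longrightarrow> \<bar>poly Q z\<bar> \<le> 1 / 2)"
      using halving_poly[of "2 ^ (I - i)"] by (metis zero_less_numeral zero_less_power)
  qed
  then obtain Q :: "nat \<Rightarrow> real poly" where
    Qdeg: "\<And>i. degree (Q i) \<le> 2 ^ (I - i)" and Ql1: "\<And>i. l1_norm (Q i) \<le> 16 ^ (2 ^ (I - i))" and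
    Q0: "\<And>i. poly (Q i) 0 = 1" and Q1: "\<And>i z. 0 \<le> z \<Longrightarrow> z \<le> 1 \<Longrightarrow> \<bar>poly (Q i) z\<bar> \<le> 1" and
    Q2: "\<And>i z. 1 / real (2 ^ (I - i)) ^ 2 \<le> z \<Longrightarrow> z \<le> 1 \<Longrightarrow> \<bar>poly (Q i) z\<bar> \<le> 1 / 2"
    by blast
  \<comment> \<open>The exponent 5 is what the scale \<open>i = 0\<close> needs: there the root part
    can be as large as \<open>2 ^ (4 * \<kappa>)\<close>, and a factor
    \<open>(1 / 2) ^ \<kappa>\<close> has to be left over.\<close>
  define R where "R = A * (\<Prod>i\<le>I. Q i ^ (5 * \<kappa>))"
  have k: "k > 0" "\<kappa> \<le> k" using assms by (auto simp: k_def)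
  have geo: "(\<Sum>i\<le>I. 2 ^ (I - i)) \<le> (2::nat) * 2 ^ I"
  proof -
    have "(\<Sum>i\<le>I. 2 ^ (I - i)) = (\<Sum>i\<le>I. (2::nat) ^ i)"
      by (rule sum.reindex_bij_witness[of _ "\<lambda>i. I - i" "\<lambda>i. I - i"]) auto
    also have "\<dots> \<le> 2 * 2 ^ I" by (induction I) auto
    finally show ?thesis .
  qed
  have kapI: "\<kappa> \<le> 2 ^ I * \<kappa>" by simp
  have prod_div: "(\<Prod>j\<in>{1..\<kappa>}. c / real j) = c ^ \<kappa> / fact \<kappa>" for c :: real
    by (simp add: prod_dividef fact_prod)
  have prod_div_le: "(\<Prod>j\<in>{1..\<kappa>}. c / real j) \<le> (4 * c / real \<kappa>) ^ \<kappa>" if "c \<ge> 0" for c :: real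
  proof -
    have "c ^ \<kappa> * real \<kappa> ^ \<kappa> \<le> c ^ \<kappa> * (4 ^ \<kappa> * fact \<kappa>)"
      using that by (intro mult_left_mono power_le_fact) auto
    then show ?thesis unfolding prod_div using assms
      by (simp add: power_divide power_mult_distrib field_simps)
  qed
  have degA: "degree A \<le> \<kappa>"
  proof -
    have "degree A \<le> (\<Sum>j\<in>{1..\<kappa>}. degree [:1, - (real k / real j):])"
      unfolding A_def using degree_prod_sum_le[of "{1..\<kappa>}" "\<lambda>j. [:1, - (real k / real j):]"]
      by (simp add: o_def)
    also have "\<dots> \<le> (\<Sum>j\<in>{1..\<kappa>}. 1)" by (intro sum_mono) auto
    finally show ?thesis by simp
  qed
  have l1A: "l1_norm A \<le> 2 ^ (5 * (2 ^ I * \<kappa>))"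
  proof -
    have "l1_norm A \<le> (\<Prod>j\<in>{1..\<kappa>}. 2 * real k / real j)"
      unfolding A_def
    proof (rule order_trans[OF l1_norm_prod], intro prod_mono conjI l1_norm_nonneg)
      fix j assume "j \<in> {1..\<kappa>}"
      then have "real k / real j \<ge> 1" using k by auto
      then show "l1_norm [:1, - (real k / real j):] \<le> 2 * real k / real j" by simp
    qed
    also have "\<dots> \<le> (4 * (2 * real k) / real \<kappa>) ^ \<kappa>" by (rule prod_div_le) simp
    also have "4 * (2 * real k) / real \<kappa> = 2 ^ (2 * I + 3)"
      using assms by (simp add: k_def power_add power_mult)
    also have "((2::real) ^ (2 * I + 3)) ^ \<kappa> = 2 ^ ((2 * I + 3) * \<kappa>)"
      by (simp only: power_mult)
    also have "\<dots> \<le> 2 ^ (5 * (2 ^ I * \<kappa>))"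
    proof (rule power_increasing)
      have "I < 2 ^ I" by (rule less_exp)
      then have "2 * I + 3 \<le> 5 * 2 ^ I" by linarith
      then show "(2 * I + 3) * \<kappa> \<le> 5 * (2 ^ I * \<kappa>)" 
        using mult_le_mono1[of "2 * I + 3" "5 * 2 ^ I" \<kappa>] by (simp only: mult.assoc)
    qed simp
    finally show ?thesis .
  qed
  show ?thesis
  proof (rule that[of R])
    have "degree (\<Prod>i\<le>I. Q i ^ (5 * \<kappa>)) \<le> (\<Sum>i\<le>I. degree (Q i ^ (5 * \<kappa>)))"
      using degree_prod_sum_le[of "{..I}" "\<lambda>i. Q i ^ (5 * \<kappa>)"] by (simp add: o_def)
    also have "\<dots> \<le> (\<Sum>i\<le>I. 2 ^ (I - i) * (5 * \<kappa>))"
      by (intro sum_mono order_trans[OF degree_power_le] mult_le_mono1 Qdeg)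
    also have "\<dots> = (\<Sum>i\<le>I. 2 ^ (I - i)) * (5 * \<kappa>)" by (simp add: sum_distrib_right)
    also have "\<dots> \<le> 2 * 2 ^ I * (5 * \<kappa>)" by (intro mult_le_mono1 geo)
    finally have dQ: "degree (\<Prod>i\<le>I. Q i ^ (5 * \<kappa>)) \<le> 10 * (2 ^ I * \<kappa>)" by simp
    show "degree R \<le> 11 * (2 ^ I * \<kappa>)"
      unfolding R_def using degree_mult_le[of A "\<Prod>i\<le>I. Q i ^ (5 * \<kappa>)"] dQ degA kapI by linarith
    have "l1_norm (\<Prod>i\<le>I. Q i ^ (5 * \<kappa>)) \<le> (\<Prod>i\<le>I. (16 ^ (2 ^ (I - i))) ^ (5 * \<kappa>))"
      by (intro order_trans[OF l1_norm_prod] prod_mono conjI l1_norm_nonneg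
          order_trans[OF l1_norm_power] power_mono Ql1)
    also have "\<dots> = 16 ^ ((\<Sum>i\<le>I. 2 ^ (I - i)) * (5 * \<kappa>))"
      by (simp only: power_mult[symmetric] power_sum sum_distrib_right)
    also have "\<dots> \<le> 16 ^ (2 * 2 ^ I * (5 * \<kappa>))"
      by (intro power_increasing mult_le_mono1 geo) simp
    also have "\<dots> = (2 ^ 4) ^ (2 * 2 ^ I * (5 * \<kappa>))" by simp
    also have "\<dots> = 2 ^ (4 * (2 * 2 ^ I * (5 * \<kappa>)))" by (simp only: power_mult)
    also have "4 * (2 * 2 ^ I * (5 * \<kappa>)) = 40 * (2 ^ I * \<kappa>)" by simp
    finally have "l1_norm R \<le> 2 ^ (5 * (2 ^ I * \<kappa>)) * 2 ^ (40 * (2 ^ I * \<kappa>))"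
      unfolding R_def by (intro order_trans[OF l1_norm_mult] mult_mono l1A l1_norm_nonneg) auto
    also have "\<dots> = 2 ^ (45 * (2 ^ I * \<kappa>))" by (simp only: power_add[symmetric]) (simp add: algebra_simps)
    finally show "l1_norm R \<le> 2 ^ (45 * (2 ^ I * \<kappa>))" .
    show "poly R 0 = 1" by (simp add: R_def A_def poly_prod Q0)
    fix m assume m: "1 \<le> m" "m \<le> 4 ^ I * \<kappa>"
    define z where "z = real m / real k"
    have z: "0 \<le> z" "z \<le> 1" using m k by (auto simp: z_def simp flip: k_def)
    have Az: "poly A z = (\<Prod>j\<in>{1..\<kappa>}. 1 - real m / real j)"
      using k by (simp add: A_def poly_prod z_def)
    have "\<bar>poly R z\<bar> \<le> (1 / 2) ^ \<kappa>"
    proof (cases "m \<le> \<kappa>")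
      case True
      then have "poly A z = 0" using m by (auto simp: Az intro!: prod_zero bexI[of _ m])
      then show ?thesis by (simp add: R_def)
    next
      case False
      \<comment> \<open>\<open>i = n - 1\<close> is the scale of \<open>m\<close>:
        \<open>4 ^ i * \<kappa> \<le> m < 4 ^ (i + 1) * \<kappa>\<close>. Exactly the factors
        \<open>Q 0\<close> to \<open>Q i\<close> are known to be at most a half here.\<close>
      define n where "n = (LEAST n. m < 4 ^ n * \<kappa>)"
      have ex: "m < 4 ^ Suc I * \<kappa>" using m k(1) by (simp add: k_def)
      have n1: "m < 4 ^ n * \<kappa>" unfolding n_def using ex by (rule LeastI)
      have "n \<noteq> 0" using n1 False by (cases n) auto
      then obtain i where i: "n = Suc i" by (cases n) auto
      have i1: "4 ^ i * \<kappa> \<le> m" using not_less_Least[of i "\<lambda>n. m < 4 ^ n * \<kappa>"] i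
        by (simp add: n_def)
      have "n \<le> Suc I" unfolding n_def using ex by (rule Least_le)
      then have iI: "i \<le> I" using i by simp
      have "\<bar>poly A z\<bar> = (\<Prod>j\<in>{1..\<kappa>}. \<bar>1 - real m / real j\<bar>)" by (simp add: Az abs_prod)
      also have "\<dots> \<le> (\<Prod>j\<in>{1..\<kappa>}. real m / real j)"
        using False by (intro prod_mono) (auto simp: abs_if field_simps)
      also have "\<dots> \<le> (4 * real m / real \<kappa>) ^ \<kappa>" by (rule prod_div_le) simp
      also have "\<dots> \<le> (4 * 4 ^ n) ^ \<kappa>"
      proof (rule power_mono)
        have "real m < 4 ^ n * real \<kappa>" 
          using n1 of_nat_less_iff[where 'a = real, of m "4 ^ n * \<kappa>"] by simp
        then show "4 * real m / real \<kappa> \<le> 4 * 4 ^ n" using assms by (simp add: field_simps)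
      qed simp
      also have "(4 * 4 ^ n :: real) = 2 ^ (2 * i + 4)" by (simp add: i power_add power_mult)
      finally have a: "\<bar>poly A z\<bar> \<le> 2 ^ ((2 * i + 4) * \<kappa>)" by (simp add: power_mult)
      have Qs: "\<bar>poly (Q i') z\<bar> \<le> 1 / 2" if "i' \<le> i" for i'
      proof (rule Q2)
        have "(4::nat) ^ i' * \<kappa> \<le> 4 ^ i * \<kappa>" using that by (intro mult_le_mono1 power_increasing) auto
        then have "4 ^ i' * \<kappa> \<le> m" using i1 by linarith
        then have "4 ^ i' * real \<kappa> \<le> real m" 
          using of_nat_le_iff[where 'a = real, of "4 ^ i' * \<kappa>" m] by simp
        moreover have "(4::real) ^ I = 4 ^ (I - i') * 4 ^ i'" using that iI by (simp flip: power_add)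
        moreover have "(real (2 ^ (I - i')))\<^sup>2 = 4 ^ (I - i')"
          by (simp add: power2_eq_square flip: power_mult_distrib)
        ultimately show "1 / (real (2 ^ (I - i')))\<^sup>2 \<le> z"
          using assms by (simp add: z_def k_def divide_simps)
      qed (rule z)
      have "\<bar>\<Prod>i\<le>I. poly (Q i) z ^ (5 * \<kappa>)\<bar> = (\<Prod>i\<le>I. \<bar>poly (Q i) z\<bar> ^ (5 * \<kappa>))"
        by (simp add: abs_prod power_abs)
      also have "\<dots> \<le> (\<Prod>i'\<le>I. if i' \<le> i then (1 / 2) ^ (5 * \<kappa>) else 1)"
      proof (intro prod_mono conjI)
        fix i' assume "i' \<in> {..I}"
        show "\<bar>poly (Q i') z\<bar> ^ (5 * \<kappa>) \<le> (if i' \<le> i then (1 / 2) ^ (5 * \<kappa>) else 1)"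
          using power_mono[OF Qs abs_ge_zero] power_le_one[OF abs_ge_zero Q1[OF z]] by presburger
      qed simp
      also have "\<dots> = (\<Prod>i'\<in>{..i}. (1 / 2) ^ (5 * \<kappa>))"
        using iI by (intro prod.mono_neutral_cong_right) auto
      also have "\<dots> = (1 / 2) ^ (5 * \<kappa> * (i + 1))"
        by (simp only: prod_constant card_atMost power_mult Suc_eq_plus1)
      finally have b: "\<bar>\<Prod>i\<le>I. poly (Q i) z ^ (5 * \<kappa>)\<bar> \<le> (1 / 2) ^ (5 * \<kappa> * (i + 1))" .
      have "\<bar>poly R z\<bar> \<le> 2 ^ ((2 * i + 4) * \<kappa>) * (1 / 2) ^ (5 * \<kappa> * (i + 1))"
        unfolding R_def poly_mult poly_prod abs_mult poly_power by (intro mult_mono a b) auto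
      also have "5 * \<kappa> * (i + 1) = (2 * i + 4) * \<kappa> + (3 * i + 1) * \<kappa>" by (simp add: algebra_simps)
      also have "(2::real) ^ ((2 * i + 4) * \<kappa>) * (1 / 2) ^ ((2 * i + 4) * \<kappa> + (3 * i + 1) * \<kappa>)
          = (1 / 2) ^ ((3 * i + 1) * \<kappa>)"
        by (simp add: power_add power_divide)
      also have "\<dots> \<le> (1 / 2) ^ \<kappa>" by (rule power_decreasing) auto
      finally show ?thesis .
    qed
    then show "\<bar>poly R (real m / real (4 ^ I * \<kappa>))\<bar> \<le> (1 / 2) ^ \<kappa>" by (simp add: z_def k_def)
  qed
qed

section \<open>Cell probe programs\<close>

lemma finite_probed_cells: "finite (probed_cells p m)"
  by (induction p arbitrary: m) auto

text \<open>A program sees the memory only through the cells on its path, so agreement on the path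
  of one memory already forces the same path on the other. This makes a run on partly wrong memory
  faithful as long as it avoids the wrong cells.\<close>

lemma result_cong_probed_cells:
  assumes "\<And>a. a \<in> probed_cells p m \<Longrightarrow> m a = m' a"
  shows "result p m = result p m' \<and> probed_cells p m = probed_cells p m'"
  using assms
proof (induction p arbitrary: m m')
  case (Read a k)
  have "m a = m' a" using Read.prems by simp
  with Read.IH[of "k (m a)" m m'] Read.prems show ?case by auto
next
  case (Write a v p)
  have "result p (m(a := v)) = result p (m'(a := v)) \<and>
      probed_cells p (m(a := v)) = probed_cells p (m'(a := v))"
  proof (rule Write.IH)
    fix b assume "b \<in> probed_cells p (m(a := v))"
    then show "(m(a := v)) b = (m'(a := v)) b" using Write.prems[of b] by simp
  qed
  then show ?case by simp
qed simp

lemma final_memory_outside: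
  "a \<notin> probed_cells p m \<Longrightarrow> final_memory p m a = m a"
  by (induction p arbitrary: m) auto

definition bounded_memory :: "nat \<Rightarrow> memory \<Rightarrow> bool" where
  "bounded_memory w m \<longleftrightarrow> (\<forall>a < 2 ^ w. m a < 2 ^ w)"

text \<open>Keeps all probes inside a finite universe of \<open>2 ^ w\<close> cells, from which the
  random sets are drawn and in which messages are counted.\<close>

lemma valid_prog_bounded:
  assumes "valid_prog w p" "bounded_memory w m"
  shows "bounded_memory w (final_memory p m) \<and> probed_cells p m \<subseteq> {..<2 ^ w}"
  using assms
proof (induction p arbitrary: m)
  case (Read a k)
  then have "m a < 2 ^ w" by (auto simp: bounded_memory_def)
  with Read show ?case by auto
next
  case (Write a v p)
  then have "bounded_memory w (m(a := v))" by (auto simp: bounded_memory_def)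
  with Write show ?case by auto
qed auto

section \<open>Runs of sequences of updates\<close>

definition run :: "'a data_structure \<Rightarrow> memory \<Rightarrow> (nat \<times> 'a) list \<Rightarrow> memory" where
  "run D m us = fold (\<lambda>(i, b). final_memory (update_prog D i b)) us m"

primrec touched :: "'a data_structure \<Rightarrow> memory \<Rightarrow> (nat \<times> 'a) list \<Rightarrow> nat set" where
  "touched D m [] = {}"
| "touched D m (u # us) =
     probed_cells (update_prog D (fst u) (snd u)) m \<union> touched D (run D m [u]) us"

lemma run_Nil [simp]: "run D m [] = m"
  by (simp add: run_def)

lemma run_append: "run D m (us @ vs) = run D (run D m us) vs"
  by (simp add: run_def)

lemma run_Cons: "run D m (u # us) = run D (run D m [u]) us"
  using run_append[of D m "[u]" us] by simp

lemma run_single: "run D m [u] = final_memory (update_prog D (fst u) (snd u)) m"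
  by (simp add: run_def case_prod_beta)

lemma memory_after_run: "memory_after D us = run D (initial_memory D) us"
  by (simp add: memory_after_def run_def)

lemma touched_append: "touched D m (us @ vs) = touched D m us \<union> touched D (run D m us) vs"
proof (induction us arbitrary: m)
  case (Cons u us)
  then show ?case by (simp add: run_Cons[of D m u us] Un_assoc)
qed simp

lemma run_outside_touched: "a \<notin> touched D m us \<Longrightarrow> run D m us a = m a"
proof (induction us arbitrary: m)
  case (Cons u us)
  then show ?case by (simp add: run_Cons[of D m u us]) (simp add: run_single final_memory_outside)
qed simp

lemma run_bounded:
  assumes "has_cell_size F n w D" "us \<in> lists (updates F n)" "bounded_memory w m"
  shows "bounded_memory w (run D m us) \<and> touched D m us \<subseteq> {..<2 ^ w}"
  using assms(2,3)
proof (induction us arbitrary: m)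
  case (Cons u us)
  have "valid_prog w (update_prog D (fst u) (snd u))"
    using assms(1) Cons.hyps(1) by (auto simp: has_cell_size_def)
  from valid_prog_bounded[OF this Cons.prems] Cons.IH[of "run D m [u]"]
  show ?case by (simp add: run_Cons[of D m u us]) (simp add: run_single)
qed simp

text \<open>The update time is guaranteed only on memories that a sequence of updates can produce,
  hence the start \<open>memory_after D us\<close> instead of an arbitrary memory.\<close>

lemma card_touched:
  assumes "worst_case_update_time F n t\<^sub>u D" "us \<in> lists (updates F n)" "vs \<in> lists (updates F n)"
  shows "card (touched D (memory_after D us) vs) \<le> t\<^sub>u * length vs"
  using assms(3,2)
proof (induction vs arbitrary: us)
  case (Cons v vs)
  have "card (probed_cells (update_prog D (fst v) (snd v)) (memory_after D us)) \<le> t\<^sub>u"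
    using assms(1) Cons.hyps Cons.prems
    by (cases v) (fastforce simp: worst_case_update_time_def probes_def)
  moreover have "card (touched D (memory_after D (us @ [v])) vs) \<le> t\<^sub>u * length vs"
    by (rule Cons.IH) (use Cons in auto)
  moreover have "memory_after D (us @ [v]) = run D (memory_after D us) [v]"
    by (simp add: memory_after_run run_append)
  ultimately show ?case
    using card_Un_le[of "probed_cells (update_prog D (fst v) (snd v)) (memory_after D us)"
        "touched D (run D (memory_after D us) [v]) vs"] by simp
qed simp


section \<open>Random sets of cells\<close>

lemma card_filter_eq_sum:
  "finite X \<Longrightarrow> card {x \<in> X. P x} = (\<Sum>x\<in>X. of_bool (P x))"
  by (simp, rule arg_cong[where f = card], auto)

text \<open>\<open>subset_weight p U S\<close> is the probability that the random subset of \<open>U\<close> containing every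
  element independently with probability \<open>p\<close> is \<open>S\<close>.\<close>

definition subset_weight :: "real \<Rightarrow> 'a set \<Rightarrow> 'a set \<Rightarrow> real" where
  "subset_weight p U S = p ^ card S * (1 - p) ^ card (U - S)"

lemma subset_weight_nonneg: "0 \<le> p \<Longrightarrow> p \<le> 1 \<Longrightarrow> 0 \<le> subset_weight p U S"
  by (simp add: subset_weight_def)

text \<open>Multiplying out the right-hand side gives one term for each subset of \<open>U\<close>.
  Probabilities and exponential moments of the random set are instances for suitable
  \<open>f\<close> and \<open>g\<close>.\<close>

lemma sum_subset_weight_prod:
  assumes "finite U"
  shows "(\<Sum>S\<in>Pow U. subset_weight p U S * (\<Prod>a\<in>S. f a) * (\<Prod>a\<in>U - S. g a))
    = (\<Prod>a\<in>U. p * f a + (1 - p) * g a)"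
  using prod_add[OF assms, of "\<lambda>a. p * f a" "\<lambda>a. (1 - p) * g a"]
  by (simp add: subset_weight_def prod.distrib ac_simps)

lemma sum_subset_weight:
  assumes "finite U" shows "(\<Sum>S\<in>Pow U. subset_weight p U S) = 1"
  using sum_subset_weight_prod[OF assms, of p "\<lambda>_. 1" "\<lambda>_. 1"] by simp

lemma sum_subset_weight_superset:
  assumes "finite U" "Y \<subseteq> U"
  shows "(\<Sum>S\<in>Pow U. subset_weight p U S * of_bool (Y \<subseteq> S)) = p ^ card Y"
proof -
  have "(\<Prod>a\<in>U - S. of_bool (a \<notin> Y)) = (of_bool (Y \<subseteq> S) :: real)" if "S \<subseteq> U" for S
    using that assms by (auto simp: of_bool_def intro!: prod.neutral prod_zero)
  then have "(\<Sum>S\<in>Pow U. subset_weight p U S * of_bool (Y \<subseteq> S))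
      = (\<Prod>a\<in>U. p * 1 + (1 - p) * of_bool (a \<notin> Y))"
    by (subst sum_subset_weight_prod[OF assms(1), symmetric]) (auto intro!: sum.cong)
  also have "\<dots> = (\<Prod>a\<in>U. if a \<in> Y then p else 1)"
    by (intro prod.cong) auto
  also have "\<dots> = (\<Prod>a\<in>Y. p)"
    using assms by (intro prod.mono_neutral_cong_right) auto
  finally show ?thesis by simp
qed

text \<open>An exponential moment. Through Markov's inequality it later bounds how often the public
  cells of an epoch are too many for a short message.\<close>

lemma sum_subset_weight_exp_card:
  assumes "finite U" "C \<subseteq> U"
  shows "(\<Sum>S\<in>Pow U. subset_weight p U S * 2 ^ card (C \<inter> S)) = (1 + p) ^ card C"
proof -
  have "(\<Prod>a\<in>S. if a \<in> C then 2 else 1) = (2 ^ card (C \<inter> S) :: real)" if "S \<subseteq> U" for S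
    using that assms finite_subset[OF that] by (simp add: prod.If_cases Int_commute)
  then have "(\<Sum>S\<in>Pow U. subset_weight p U S * 2 ^ card (C \<inter> S))
      = (\<Prod>a\<in>U. p * (if a \<in> C then 2 else 1) + (1 - p) * 1)"
    by (subst sum_subset_weight_prod[OF assms(1), symmetric]) (auto intro!: sum.cong)
  also have "\<dots> = (\<Prod>a\<in>U. if a \<in> C then 1 + p else 1)"
    by (intro prod.cong) auto
  also have "\<dots> = (\<Prod>a\<in>C. 1 + p)"
    using assms by (intro prod.mono_neutral_cong_right) auto
  finally show ?thesis by simp
qed

text \<open>The idea: \<open>R\<close> of the relative number of mismatches approximates the indicator of \<open>mis \<omega> = {}\<close>, and
  the monomials of \<open>R\<close> are averages of indicators of events \<open>Y \<subseteq> mis \<omega>\<close> with small \<open>Y\<close>.\<close>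

lemma peak_to_average:
  fixes g :: "'o \<Rightarrow> real" and mis :: "'o \<Rightarrow> 'c set" and R :: "real poly"
  assumes fin: "finite \<Theta>" "finite K" and K: "card K \<le> k" "k > 0"
    and mis: "\<And>\<omega>. \<omega> \<in> \<Theta> \<Longrightarrow> mis \<omega> \<subseteq> K"
    and g: "\<And>\<omega>. \<omega> \<in> \<Theta> \<Longrightarrow> \<bar>g \<omega>\<bar> \<le> 1"
    and peak: "\<And>\<omega>. \<omega> \<in> \<Theta> \<Longrightarrow> mis \<omega> = {} \<Longrightarrow> g \<omega> = \<sigma>" "\<bar>\<sigma>\<bar> = 1"
    and mass: "\<epsilon> * real (card \<Theta>) \<le> real (card {\<omega> \<in> \<Theta>. mis \<omega> = {}})"
    and R: "poly R 0 = 1" "\<And>m. 1 \<le> m \<Longrightarrow> m \<le> k \<Longrightarrow> \<bar>poly R (real m / real k)\<bar> \<le> \<epsilon> / 2"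
    and \<epsilon>: "\<epsilon> \<ge> 0"
  obtains Y where "Y \<subseteq> K" "card Y \<le> degree R"
    "\<epsilon> / 2 * real (card \<Theta>) \<le> l1_norm R * \<bar>\<Sum>\<omega>\<in>{\<omega> \<in> \<Theta>. Y \<subseteq> mis \<omega>}. g \<omega>\<bar>"
proof (rule ccontr)
  assume neg: "\<not> thesis"
  define s where "s Y = \<bar>\<Sum>\<omega>\<in>{\<omega> \<in> \<Theta>. Y \<subseteq> mis \<omega>}. g \<omega>\<bar>" for Y
  define \<T> where "\<T> = {Y. Y \<subseteq> K \<and> card Y \<le> degree R}"
  have finT: "finite \<T>" using fin by (simp add: \<T>_def)
  have neT: "{} \<in> \<T>" by (simp add: \<T>_def)
  define \<delta> where "\<delta> = Max (s ` \<T>)"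
  have "\<delta> \<in> s ` \<T>" unfolding \<delta>_def using finT neT by (intro Max_in) auto
  then have lt: "l1_norm R * \<delta> < \<epsilon> / 2 * real (card \<Theta>)"
    using neg that by (force simp: \<T>_def s_def not_le[symmetric])
  have \<delta>: "s Y \<le> \<delta>" if "Y \<subseteq> K" "card Y \<le> degree R" for Y
    unfolding \<delta>_def using finT that by (intro Max_ge) (auto simp: \<T>_def)
  have \<delta>0: "0 \<le> \<delta>" using \<delta>[of "{}"] by (simp add: s_def order_trans[OF abs_ge_zero])
  have finmis: "finite (mis \<omega>)" if "\<omega> \<in> \<Theta>" for \<omega> using mis[OF that] fin finite_subset by blast
  have cardmis: "card (mis \<omega>) \<le> k" if "\<omega> \<in> \<Theta>" for \<omega>
    using card_mono[OF fin(2) mis[OF that]] K by linarith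
  let ?E = "\<Sum>\<omega>\<in>\<Theta>. g \<omega> * poly R (real (card (mis \<omega>)) / real k)"
  let ?\<Theta>0 = "{\<omega> \<in> \<Theta>. mis \<omega> = {}}"
  have moment: "\<bar>\<Sum>\<omega>\<in>\<Theta>. g \<omega> * (real (card (mis \<omega>)) / real k) ^ i\<bar> \<le> \<delta>" if i: "i \<le> degree R" for i
  proof -
    \<comment> \<open>\<open>card (mis \<omega>) ^ i\<close> counts the maps from
      \<open>{..<i}\<close> into \<open>mis \<omega>\<close>. A single map into \<open>K\<close>
      contributes the sum of \<open>g\<close> over the event that its image, a set of at most
      \<open>i\<close> cells, is mismatched.\<close>
    have "(\<Sum>\<omega>\<in>\<Theta>. g \<omega> * real (card (mis \<omega>)) ^ i)
        = (\<Sum>\<omega>\<in>\<Theta>. \<Sum>\<phi>\<in>PiE {..<i} (\<lambda>_. K). if \<phi> ` {..<i} \<subseteq> mis \<omega> then g \<omega> else 0)"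
    proof (rule sum.cong)
      fix \<omega> assume w: "\<omega> \<in> \<Theta>"
      have "{\<phi> \<in> PiE {..<i} (\<lambda>_. K). \<phi> ` {..<i} \<subseteq> mis \<omega>} = PiE {..<i} (\<lambda>_. mis \<omega>)"
        using mis[OF w] by (auto simp: PiE_def Pi_def image_subset_iff)
      then show "g \<omega> * real (card (mis \<omega>)) ^ i
          = (\<Sum>\<phi>\<in>PiE {..<i} (\<lambda>_. K). if \<phi> ` {..<i} \<subseteq> mis \<omega> then g \<omega> else 0)"
        using fin by (simp add: sum.If_cases finite_PiE card_PiE Int_def conj_commute)
    qed simp
    also have "\<dots> = (\<Sum>\<phi>\<in>PiE {..<i} (\<lambda>_. K). \<Sum>\<omega>\<in>{\<omega> \<in> \<Theta>. \<phi> ` {..<i} \<subseteq> mis \<omega>}. g \<omega>)"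
      using fin by (subst sum.swap) (simp add: sum.inter_filter)
    finally have eq: "(\<Sum>\<omega>\<in>\<Theta>. g \<omega> * real (card (mis \<omega>)) ^ i)
        = (\<Sum>\<phi>\<in>PiE {..<i} (\<lambda>_. K). \<Sum>\<omega>\<in>{\<omega> \<in> \<Theta>. \<phi> ` {..<i} \<subseteq> mis \<omega>}. g \<omega>)" .
    have "\<bar>\<Sum>\<omega>\<in>\<Theta>. g \<omega> * real (card (mis \<omega>)) ^ i\<bar> \<le> (\<Sum>\<phi>\<in>PiE {..<i} (\<lambda>_. K). s (\<phi> ` {..<i}))"
      unfolding eq s_def by (rule sum_abs)
    also have "\<dots> \<le> (\<Sum>\<phi>\<in>PiE {..<i} (\<lambda>_. K). \<delta>)"
    proof (intro sum_mono \<delta>)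
      fix \<phi> assume "\<phi> \<in> PiE {..<i} (\<lambda>_. K)"
      then show "\<phi> ` {..<i} \<subseteq> K" by auto
      show "card (\<phi> ` {..<i}) \<le> degree R" using card_image_le[of "{..<i}" \<phi>] i by simp
    qed
    also have "\<dots> = real (card K) ^ i * \<delta>" using fin by (simp add: card_PiE)
    also have "\<dots> \<le> real k ^ i * \<delta>" using K \<delta>0 by (intro mult_right_mono power_mono) auto
    finally have "\<bar>\<Sum>\<omega>\<in>\<Theta>. g \<omega> * real (card (mis \<omega>)) ^ i\<bar> / real k ^ i \<le> \<delta>"
      using K by (simp add: field_simps)
    then show ?thesis
      by (simp add: power_divide sum_divide_distrib[symmetric] abs_divide)
  qed
  have "?E = (\<Sum>i\<le>degree R. coeff R i * (\<Sum>\<omega>\<in>\<Theta>. g \<omega> * (real (card (mis \<omega>)) / real k) ^ i))"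
    unfolding poly_altdef sum_distrib_left by (subst sum.swap) (simp add: ac_simps)
  then have "\<bar>?E\<bar> \<le> (\<Sum>i\<le>degree R. \<bar>coeff R i * (\<Sum>\<omega>\<in>\<Theta>. g \<omega> * (real (card (mis \<omega>)) / real k) ^ i)\<bar>)"
    by (simp add: sum_abs)
  also have "\<dots> \<le> (\<Sum>i\<le>degree R. \<bar>coeff R i\<bar> * \<delta>)"
    unfolding abs_mult by (intro sum_mono mult_left_mono moment) auto
  also have "\<dots> = l1_norm R * \<delta>" by (simp add: l1_norm_def sum_distrib_right)
  finally have upper: "\<bar>?E\<bar> < \<epsilon> / 2 * real (card \<Theta>)" using lt by simp
  \<comment> \<open>On the peak \<open>R\<close> is 1 and \<open>g\<close> is constant, so nothing
    cancels there. Elsewhere \<open>R\<close> is at most \<open>\<epsilon> / 2\<close>, and half of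
    the mass of the peak survives, against the upper bound just shown.\<close>
  have "?E = (\<Sum>\<omega>\<in>?\<Theta>0. g \<omega> * poly R (real (card (mis \<omega>)) / real k))
      + (\<Sum>\<omega>\<in>\<Theta> - ?\<Theta>0. g \<omega> * poly R (real (card (mis \<omega>)) / real k))"
    using fin by (subst sum.subset_diff[of ?\<Theta>0]) auto
  also have "(\<Sum>\<omega>\<in>?\<Theta>0. g \<omega> * poly R (real (card (mis \<omega>)) / real k)) = (\<Sum>\<omega>\<in>?\<Theta>0. \<sigma>)"
    by (rule sum.cong) (auto simp: peak R)
  finally have E: "?E = real (card ?\<Theta>0) * \<sigma>
      + (\<Sum>\<omega>\<in>\<Theta> - ?\<Theta>0. g \<omega> * poly R (real (card (mis \<omega>)) / real k))" by simp
  have "\<bar>\<Sum>\<omega>\<in>\<Theta> - ?\<Theta>0. g \<omega> * poly R (real (card (mis \<omega>)) / real k)\<bar> \<le> (\<Sum>\<omega>\<in>\<Theta> - ?\<Theta>0. 1 * (\<epsilon> / 2))"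
  proof (rule order_trans[OF sum_abs], rule sum_mono)
    fix \<omega> assume w: "\<omega> \<in> \<Theta> - ?\<Theta>0"
    then have "1 \<le> card (mis \<omega>)" using finmis by (simp add: Suc_le_eq card_gt_0_iff)
    then show "\<bar>g \<omega> * poly R (real (card (mis \<omega>)) / real k)\<bar> \<le> 1 * (\<epsilon> / 2)"
      unfolding abs_mult using w cardmis by (intro mult_mono g R) auto
  qed
  also have "\<dots> \<le> \<epsilon> / 2 * real (card \<Theta>)"
    using \<epsilon> card_mono[OF fin(1), of "\<Theta> - ?\<Theta>0"]
    by (simp add: mult.commute mult_left_mono)
  finally have "\<bar>?E\<bar> \<ge> real (card ?\<Theta>0) - \<epsilon> / 2 * real (card \<Theta>)"
    unfolding E using peak(2) by (auto simp: abs_if split: if_splits)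
  with upper mass show False by simp
qed

section \<open>Weak one-way simulation\<close>

definition sign :: "bool \<Rightarrow> real" where
  "sign b = (if b then 1 else -1)"

lemma abs_sign [simp]: "\<bar>sign b\<bar> = 1"
  by (simp add: sign_def)

text \<open>A partial map, because the domain is part of the information: the receiver also learns
  which cells are covered.\<close>

definition contents :: "memory \<Rightarrow> nat set \<Rightarrow> nat \<rightharpoonup> nat" where
  "contents m X = (\<lambda>a. if a \<in> X then Some (m a) else None)"

text \<open>The situation of one epoch: \<open>M \<omega>\<close> is the final memory, \<open>C \<omega>\<close> and \<open>A \<omega>\<close> are the cells probed
  during and after the epoch, and \<open>key \<omega>\<close> stands for the updates of all other epochs.\<close>

locale epoch_simulation =
  fixes \<Omega> :: "'o set" and M :: "'o \<Rightarrow> memory" and A C :: "'o \<Rightarrow> nat set"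
    and key :: "'o \<Rightarrow> 'k" and M0 :: "'k \<Rightarrow> memory" and w :: nat
    and Q :: "'q set" and prog :: "'q \<Rightarrow> bool prog"
  assumes finite_\<Omega>: "finite \<Omega>" and finite_Q: "finite Q"
    and A: "\<And>\<omega>. \<omega> \<in> \<Omega> \<Longrightarrow> A \<omega> \<subseteq> {..<2 ^ w}" and C: "\<And>\<omega>. \<omega> \<in> \<Omega> \<Longrightarrow> C \<omega> \<subseteq> {..<2 ^ w}"
    and unchanged: "\<And>\<omega> a. \<omega> \<in> \<Omega> \<Longrightarrow> a \<notin> A \<omega> \<union> C \<omega> \<Longrightarrow> M \<omega> a = M0 (key \<omega>) a"
    and bounded_M: "\<And>\<omega>. \<omega> \<in> \<Omega> \<Longrightarrow> bounded_memory w (M \<omega>)"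
    and bounded_M0: "\<And>\<omega>. \<omega> \<in> \<Omega> \<Longrightarrow> bounded_memory w (M0 (key \<omega>))"
    and valid: "\<And>y. y \<in> Q \<Longrightarrow> valid_prog w (prog y)"
begin

abbreviation U :: "nat set" where "U \<equiv> {..<2 ^ w}"

text \<open>Giving away \<open>key\<close>, that is all other epochs, is free: the upper bound on
  the advantage is applied for each value of \<open>key\<close> separately.\<close>

definition message :: "nat set \<Rightarrow> 'o \<Rightarrow> 'k \<times> (nat \<rightharpoonup> nat) \<times> (nat \<rightharpoonup> nat)" where
  "message S \<omega> = (key \<omega>, contents (M \<omega>) (A \<omega>), contents (M \<omega>) (S \<inter> C \<omega>))"

text \<open>The memory as the receiver of the message believes it to be.\<close>

definition patched :: "'k \<times> (nat \<rightharpoonup> nat) \<times> (nat \<rightharpoonup> nat) \<Rightarrow> memory" where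
  "patched \<mu> a = (case fst (snd \<mu>) a of Some v \<Rightarrow> v | None \<Rightarrow>
     (case snd (snd \<mu>) a of Some v \<Rightarrow> v | None \<Rightarrow> M0 (fst \<mu>) a))"

definition answer :: "'q \<Rightarrow> 'o \<Rightarrow> real" where
  "answer y \<omega> = sign (result (prog y) (M \<omega>))"

lemma patched_message:
  "patched (message S \<omega>) a = (if a \<in> A \<omega> \<union> (S \<inter> C \<omega>) then M \<omega> a else M0 (key \<omega>) a)"
  by (auto simp: patched_def message_def contents_def)

lemma patched_correct:
  assumes "\<omega> \<in> \<Omega>" "a \<notin> C \<omega> - A \<omega> \<or> a \<in> S"
  shows "patched (message S \<omega>) a = M \<omega> a"
  using assms unchanged[of \<omega> a] by (auto simp: patched_message)

text \<open>One message for the union of both public sets is sent; by this lemma it also determines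
  everything that depends on the message for the first set alone.\<close>

lemma message_mono:
  assumes "message (S \<union> S') \<omega> = message (S \<union> S') \<omega>'"
  shows "message S \<omega> = message S \<omega>'"
proof -
  have "contents (M \<omega>) (S \<inter> C \<omega>) a = contents (M \<omega>') (S \<inter> C \<omega>') a" for a
  proof -
    have "contents (M \<omega>) ((S \<union> S') \<inter> C \<omega>) a = contents (M \<omega>') ((S \<union> S') \<inter> C \<omega>') a"
      using assms by (simp add: message_def)
    then show ?thesis by (cases "a \<in> S") (auto simp: contents_def split: if_splits)
  qed
  then show ?thesis using assms by (auto simp: message_def)
qed

lemma bounded_patched: "\<omega> \<in> \<Omega> \<Longrightarrow> bounded_memory w (patched (message S \<omega>))"
  using bounded_M[of \<omega>] bounded_M0[of \<omega>] by (auto simp: bounded_memory_def patched_message)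

lemma probed_subset: "y \<in> Q \<Longrightarrow> bounded_memory w m \<Longrightarrow> probed_cells (prog y) m \<subseteq> U"
  using valid_prog_bounded[OF valid] by blast

definition path :: "'q \<Rightarrow> 'k \<times> (nat \<rightharpoonup> nat) \<times> (nat \<rightharpoonup> nat) \<Rightarrow> nat set" where
  "path y \<mu> = probed_cells (prog y) (patched \<mu>)"

definition mismatches :: "'q \<Rightarrow> 'k \<times> (nat \<rightharpoonup> nat) \<times> (nat \<rightharpoonup> nat) \<Rightarrow> 'o \<Rightarrow> nat set" where
  "mismatches y \<mu> \<omega> = {a \<in> path y \<mu>. M \<omega> a \<noteq> patched \<mu> a}"

definition simulated :: "nat \<Rightarrow> 'q \<Rightarrow> nat set \<Rightarrow> 'o set" where
  "simulated k y S = {\<omega> \<in> \<Omega>. card (probed_cells (prog y) (M \<omega>)) \<le> k \<and>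
     probed_cells (prog y) (M \<omega>) \<inter> (C \<omega> - A \<omega>) \<subseteq> S}"

lemma simulated_path:
  assumes "\<omega> \<in> simulated k y S"
  shows "card (path y (message S \<omega>)) \<le> k" "mismatches y (message S \<omega>) \<omega> = {}"
proof -
  have eq: "M \<omega> a = patched (message S \<omega>) a" if "a \<in> probed_cells (prog y) (M \<omega>)" for a
    using assms that by (intro patched_correct[symmetric]) (auto simp: simulated_def)
  have "path y (message S \<omega>) = probed_cells (prog y) (M \<omega>)"
    using result_cong_probed_cells[of "prog y" "M \<omega>", OF eq] by (simp add: path_def)
  then show "card (path y (message S \<omega>)) \<le> k" "mismatches y (message S \<omega>) \<omega> = {}"
    using assms eq by (auto simp: simulated_def mismatches_def)
qed

text \<open>Provides the constant sign on the peak: without mismatches the receiver's run is the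
  true one, and that run depends only on the message.\<close>

lemma answer_no_mismatch:
  assumes "mismatches y \<mu> \<omega> = {}"
  shows "answer y \<omega> = sign (result (prog y) (patched \<mu>))"
proof -
  have "patched \<mu> a = M \<omega> a" if "a \<in> probed_cells (prog y) (patched \<mu>)" for a
    using assms that by (auto simp: mismatches_def path_def)
  then show ?thesis
    using result_cong_probed_cells[of "prog y" "patched \<mu>" "M \<omega>"] by (simp add: answer_def)
qed

text \<open>Inside one message class the path is fixed, and \<open>peak_to_average\<close> yields a
  set \<open>Y\<close> whose mismatch correlates with the answer, with sign \<open>\<sigma>\<close>.
  The left-hand side is a difference so that it is not positive, hence trivially bounded, in classes
  with too few simulated runs, and so that it adds up over classes.\<close>

lemma class_peak:
  fixes p \<epsilon> :: real and k r I \<kappa> :: nat and S :: "nat set"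
  defines "c \<equiv> p ^ r * (\<epsilon> / 2) / 2 ^ (45 * (2 ^ I * \<kappa>))"
  assumes p: "0 < p" "p \<le> 1" and \<epsilon>: "0 < \<epsilon>" and \<kappa>: "\<kappa> > 0" "(1 / 2) ^ \<kappa> \<le> \<epsilon> / 2"
    and k: "k \<le> 4 ^ I * \<kappa>" and r: "min k (11 * (2 ^ I * \<kappa>)) \<le> r" and y: "y \<in> Q"
  defines "\<Theta> \<mu> \<equiv> {\<omega> \<in> \<Omega>. message S \<omega> = \<mu>}"
  shows "\<exists>Y \<sigma>. Y \<subseteq> U \<and> \<bar>\<sigma>\<bar> \<le> 1 \<and> Y \<subseteq> path y \<mu> \<and>
    c * (real (card (simulated k y S \<inter> \<Theta> \<mu>)) - \<epsilon> * real (card (\<Theta> \<mu>)))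
      \<le> p ^ card Y * (\<sigma> * (\<Sum>\<omega>\<in>{\<omega> \<in> \<Theta> \<mu>. Y \<subseteq> mismatches y \<mu> \<omega>}. answer y \<omega>))"
proof -
  have fin: "finite (\<Theta> \<mu>)" using finite_\<Omega> by (simp add: \<Theta>_def)
  have c: "c \<ge> 0" using p \<epsilon> by (simp add: c_def)
  show ?thesis
  proof (cases "\<Theta> \<mu> \<noteq> {} \<and> \<epsilon> * real (card (\<Theta> \<mu>)) \<le> real (card (simulated k y S \<inter> \<Theta> \<mu>))")
    case False
    then have "real (card (simulated k y S \<inter> \<Theta> \<mu>)) - \<epsilon> * real (card (\<Theta> \<mu>)) \<le> 0" by auto
    then have "c * (real (card (simulated k y S \<inter> \<Theta> \<mu>)) - \<epsilon> * real (card (\<Theta> \<mu>))) \<le> 0"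
      using c by (simp add: mult_nonneg_nonpos)
    then show ?thesis by (intro exI[of _ "{}"] exI[of _ 0]) simp
  next
    case True
    then have "0 < \<epsilon> * real (card (\<Theta> \<mu>))" using \<epsilon> fin by (simp add: card_gt_0_iff)
    then have "simulated k y S \<inter> \<Theta> \<mu> \<noteq> {}" using True by (auto simp: less_le_trans)
    then obtain \<omega>0 where \<omega>0: "\<omega>0 \<in> simulated k y S" "\<omega>0 \<in> \<Omega>" "message S \<omega>0 = \<mu>"
      by (auto simp: \<Theta>_def)
    \<comment> \<open>The path depends on the message alone, so one simulated run bounds its length
      for the whole class.\<close>
    have cardK: "card (path y \<mu>) \<le> k" using simulated_path(1)[OF \<omega>0(1)] \<omega>0 by simp
    have KU: "path y \<mu> \<subseteq> U"
      using probed_subset[OF y bounded_patched[OF \<omega>0(2)], of S] \<omega>0 by (simp add: path_def)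
    obtain R :: "real poly" where R: "degree R \<le> 11 * (2 ^ I * \<kappa>)"
      "l1_norm R \<le> 2 ^ (45 * (2 ^ I * \<kappa>))" "poly R 0 = 1"
      "\<And>m. 1 \<le> m \<Longrightarrow> m \<le> 4 ^ I * \<kappa> \<Longrightarrow> \<bar>poly R (real m / real (4 ^ I * \<kappa>))\<bar> \<le> (1 / 2) ^ \<kappa>"
      by (rule or_approximation[OF \<kappa>(1), of I]) blast
    have sim: "simulated k y S \<inter> \<Theta> \<mu> \<subseteq> {\<omega> \<in> \<Theta> \<mu>. mismatches y \<mu> \<omega> = {}}"
      using simulated_path(2)[of _ k y S] by (auto simp: \<Theta>_def)
    obtain Y where Y: "Y \<subseteq> path y \<mu>" "card Y \<le> degree R"
      "\<epsilon> / 2 * real (card (\<Theta> \<mu>)) \<le> l1_norm R *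
         \<bar>\<Sum>\<omega>\<in>{\<omega> \<in> \<Theta> \<mu>. Y \<subseteq> mismatches y \<mu> \<omega>}. answer y \<omega>\<bar>"
    proof (rule peak_to_average[of "\<Theta> \<mu>" "path y \<mu>" "4 ^ I * \<kappa>" "mismatches y \<mu>" "answer y"
          "sign (result (prog y) (patched \<mu>))" \<epsilon> R])
      show "finite (path y \<mu>)" using KU finite_subset by blast
      show "card (path y \<mu>) \<le> 4 ^ I * \<kappa>" using cardK k by linarith
      show "\<epsilon> * real (card (\<Theta> \<mu>)) \<le> real (card {\<omega> \<in> \<Theta> \<mu>. mismatches y \<mu> \<omega> = {}})"
        using True card_mono[OF _ sim] fin by (smt (verit) finite_Collect_conjI finite_subset mem_Collect_eq of_nat_mono subsetI)
      show "\<bar>poly R (real m / real (4 ^ I * \<kappa>))\<bar> \<le> \<epsilon> / 2" if "1 \<le> m" "m \<le> 4 ^ I * \<kappa>" for m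
        using R(4)[OF that] \<kappa>(2) by linarith
    qed (use fin \<kappa> R \<epsilon> answer_no_mismatch in \<open>auto simp: mismatches_def answer_def\<close>)
    let ?s = "\<Sum>\<omega>\<in>{\<omega> \<in> \<Theta> \<mu>. Y \<subseteq> mismatches y \<mu> \<omega>}. answer y \<omega>"
    have "finite (path y \<mu>)" using KU finite_subset by blast
    then have "card Y \<le> card (path y \<mu>)" using Y(1) by (rule card_mono)
    then have "card Y \<le> r" using cardK Y(2) R(1) r by linarith
    then have pY: "p ^ r \<le> p ^ card Y" using p by (intro power_decreasing) auto
    have "\<epsilon> / 2 * real (card (\<Theta> \<mu>)) \<le> 2 ^ (45 * (2 ^ I * \<kappa>)) * \<bar>?s\<bar>"
      using Y(3) mult_right_mono[OF R(2), of "\<bar>?s\<bar>"] by simp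
    then have "(\<epsilon> / 2) * real (card (\<Theta> \<mu>)) / 2 ^ (45 * (2 ^ I * \<kappa>)) \<le> \<bar>?s\<bar>"
      by (simp add: field_simps)
    then have "p ^ r * ((\<epsilon> / 2) * real (card (\<Theta> \<mu>)) / 2 ^ (45 * (2 ^ I * \<kappa>))) \<le> p ^ card Y * \<bar>?s\<bar>"
      using p pY \<epsilon> by (intro mult_mono) auto
    then have "c * real (card (\<Theta> \<mu>)) \<le> p ^ card Y * \<bar>?s\<bar>" by (simp add: c_def)
    moreover have "real (card (simulated k y S \<inter> \<Theta> \<mu>)) - \<epsilon> * real (card (\<Theta> \<mu>)) \<le> real (card (\<Theta> \<mu>))"
    proof -
      have "card (simulated k y S \<inter> \<Theta> \<mu>) \<le> card (\<Theta> \<mu>)" using fin by (intro card_mono) auto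
      moreover have "0 \<le> \<epsilon> * real (card (\<Theta> \<mu>))" using \<epsilon> by simp
      ultimately show ?thesis by linarith
    qed
    ultimately have "c * (real (card (simulated k y S \<inter> \<Theta> \<mu>)) - \<epsilon> * real (card (\<Theta> \<mu>)))
        \<le> p ^ card Y * \<bar>?s\<bar>"
      using mult_left_mono[OF _ c] by (meson order_trans)
    moreover have "\<bar>?s\<bar> = sgn ?s * ?s" by (simp add: abs_sgn mult.commute)
    ultimately show ?thesis
      using Y(1) KU by (intro exI[of _ Y] exI[of _ "sgn ?s"]) (auto simp: abs_sgn_eq)
  qed
qed

text \<open>The receiver guesses \<open>\<sigma>\<close> if the set \<open>Y\<close> of the class
  lies in \<open>S'\<close> and all its cells are wrong, and abstains (value 0) otherwise. Averaging
  over \<open>S'\<close> weighs the correlation of the class by \<open>p ^ card Y\<close>.\<close>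

theorem weak_simulation:
  fixes p :: real and k r I \<kappa> k0 :: nat
  assumes p: "0 < p" "p \<le> 1" and \<kappa>: "\<kappa> > 0" "(1 / 2) ^ \<kappa> \<le> p ^ k0 / 8"
    and k: "k \<le> 4 ^ I * \<kappa>" and r: "min k (11 * (2 ^ I * \<kappa>)) \<le> r"
    and good: "real (card Q) * real (card \<Omega>) / 2 \<le> (\<Sum>y\<in>Q. real (card {\<omega> \<in> \<Omega>.
      card (probed_cells (prog y) (M \<omega>)) \<le> k \<and>
      card (probed_cells (prog y) (M \<omega>) \<inter> (C \<omega> - A \<omega>)) \<le> k0}))"
  obtains \<phi> :: "'q \<Rightarrow> nat set \<Rightarrow> nat set \<Rightarrow> 'o \<Rightarrow> real" where
    "\<And>y S S' \<omega>. \<bar>\<phi> y S S' \<omega>\<bar> \<le> 1"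
    "\<And>y S S' \<omega> \<omega>'. y \<in> Q \<Longrightarrow> \<omega> \<in> \<Omega> \<Longrightarrow> \<omega>' \<in> \<Omega> \<Longrightarrow> message (S \<union> S') \<omega> = message (S \<union> S') \<omega>' \<Longrightarrow>
       \<phi> y S S' \<omega> = \<phi> y S S' \<omega>'"
    "p ^ r * (p ^ k0) ^ 2 / 32 / 2 ^ (45 * (2 ^ I * \<kappa>)) * (real (card Q) * real (card \<Omega>))
      \<le> (\<Sum>S\<in>Pow U. \<Sum>S'\<in>Pow U. subset_weight p U S * subset_weight p U S' *
           (\<Sum>y\<in>Q. \<Sum>\<omega>\<in>\<Omega>. \<phi> y S S' \<omega> * answer y \<omega>))"
proof -
  \<comment> \<open>Half of the pairs of query and outcome are good, and each survives the choice of
    \<open>S\<close> with probability at least \<open>p ^ k0\<close>. Subtracting the share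
    \<open>\<epsilon>\<close>, half of the resulting \<open>p ^ k0 / 2\<close>, leaves an excess of
    \<open>\<epsilon>\<close> again.\<close>
  define \<epsilon> where "\<epsilon> = p ^ k0 / 4"
  define c where "c = p ^ r * (\<epsilon> / 2) / 2 ^ (45 * (2 ^ I * \<kappa>))"
  define \<Theta> where "\<Theta> S \<mu> = {\<omega> \<in> \<Omega>. message S \<omega> = \<mu>}" for S \<mu>
  have \<epsilon>: "0 < \<epsilon>" "(1 / 2) ^ \<kappa> \<le> \<epsilon> / 2" using p \<kappa> by (auto simp: \<epsilon>_def)
  have c: "c \<ge> 0" using p \<epsilon> by (simp add: c_def)
  have finU: "finite U" by simp
  define visible where "visible y S \<mu> Y \<sigma> \<longleftrightarrow> Y \<subseteq> U \<and> \<bar>\<sigma>\<bar> \<le> 1 \<and> Y \<subseteq> path y \<mu> \<and>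
    c * (real (card (simulated k y S \<inter> \<Theta> S \<mu>)) - \<epsilon> * real (card (\<Theta> S \<mu>)))
      \<le> p ^ card Y * (\<sigma> * (\<Sum>\<omega>\<in>{\<omega> \<in> \<Theta> S \<mu>. Y \<subseteq> mismatches y \<mu> \<omega>}. answer y \<omega>))"
    for y S \<mu> and Y :: "nat set" and \<sigma> :: real
  have "\<exists>Y \<sigma>. visible y S \<mu> Y \<sigma>" if "y \<in> Q" for y S \<mu>
    unfolding visible_def c_def \<Theta>_def by (rule class_peak[OF p \<epsilon>(1) \<kappa>(1) \<epsilon>(2) k r that])
  then obtain Y \<sigma> where vis: "\<And>y S \<mu>. y \<in> Q \<Longrightarrow> visible y S \<mu> (Y y S \<mu>) (\<sigma> y S \<mu>)"
    by metis
  note Y\<sigma> = vis[unfolded visible_def]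
  define \<phi> where "\<phi> y S S' \<omega> = (if y \<in> Q \<and> Y y S (message S \<omega>) \<subseteq> S' \<and>
      Y y S (message S \<omega>) \<subseteq> mismatches y (message S \<omega>) \<omega> then \<sigma> y S (message S \<omega>) else 0)"
    for y S S' \<omega>
  have per_query: "c * (real (card (simulated k y S)) - \<epsilon> * real (card \<Omega>))
      \<le> (\<Sum>S'\<in>Pow U. subset_weight p U S' * (\<Sum>\<omega>\<in>\<Omega>. \<phi> y S S' \<omega> * answer y \<omega>))"
    if y: "y \<in> Q" for y S
  proof -
    let ?h = "\<lambda>\<mu> \<omega>. if Y y S \<mu> \<subseteq> mismatches y \<mu> \<omega> then \<sigma> y S \<mu> * answer y \<omega> else 0"
    have "(\<Sum>S'\<in>Pow U. subset_weight p U S' * (\<Sum>\<omega>\<in>\<Omega>. \<phi> y S S' \<omega> * answer y \<omega>))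
        = (\<Sum>\<omega>\<in>\<Omega>. \<Sum>S'\<in>Pow U. subset_weight p U S' * of_bool (Y y S (message S \<omega>) \<subseteq> S') * ?h (message S \<omega>) \<omega>)"
      unfolding sum_distrib_left
      by (subst sum.swap) (intro sum.cong refl, auto simp: \<phi>_def y)
    also have "\<dots> = (\<Sum>\<omega>\<in>\<Omega>. p ^ card (Y y S (message S \<omega>)) * ?h (message S \<omega>) \<omega>)"
      unfolding sum_distrib_right[symmetric]
      using Y\<sigma>[OF y] by (intro sum.cong refl) (subst sum_subset_weight_superset[OF finU], auto)
    also have "\<dots> = (\<Sum>\<mu>\<in>message S ` \<Omega>. \<Sum>\<omega>\<in>\<Theta> S \<mu>. p ^ card (Y y S (message S \<omega>)) * ?h (message S \<omega>) \<omega>)"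
      unfolding \<Theta>_def by (rule sum.image_gen[OF finite_\<Omega>])
    also have "\<dots> = (\<Sum>\<mu>\<in>message S ` \<Omega>. p ^ card (Y y S \<mu>) * (\<sigma> y S \<mu> *
          (\<Sum>\<omega>\<in>{\<omega> \<in> \<Theta> S \<mu>. Y y S \<mu> \<subseteq> mismatches y \<mu> \<omega>}. answer y \<omega>)))"
    proof (rule sum.cong[OF refl])
      fix \<mu>
      have "(\<Sum>\<omega>\<in>\<Theta> S \<mu>. p ^ card (Y y S (message S \<omega>)) * ?h (message S \<omega>) \<omega>)
          = p ^ card (Y y S \<mu>) * (\<Sum>\<omega>\<in>\<Theta> S \<mu>. ?h \<mu> \<omega>)"
        unfolding sum_distrib_left by (rule sum.cong) (auto simp: \<Theta>_def)
      also have "(\<Sum>\<omega>\<in>\<Theta> S \<mu>. ?h \<mu> \<omega>)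
          = \<sigma> y S \<mu> * (\<Sum>\<omega>\<in>{\<omega> \<in> \<Theta> S \<mu>. Y y S \<mu> \<subseteq> mismatches y \<mu> \<omega>}. answer y \<omega>)"
        unfolding sum_distrib_left using finite_\<Omega>
        by (subst sum.inter_filter[symmetric]) (auto simp: \<Theta>_def)
      finally show "(\<Sum>\<omega>\<in>\<Theta> S \<mu>. p ^ card (Y y S (message S \<omega>)) * ?h (message S \<omega>) \<omega>)
          = p ^ card (Y y S \<mu>) * (\<sigma> y S \<mu> *
          (\<Sum>\<omega>\<in>{\<omega> \<in> \<Theta> S \<mu>. Y y S \<mu> \<subseteq> mismatches y \<mu> \<omega>}. answer y \<omega>))" .
    qed
    also have "\<dots> \<ge> (\<Sum>\<mu>\<in>message S ` \<Omega>.
        c * (real (card (simulated k y S \<inter> \<Theta> S \<mu>)) - \<epsilon> * real (card (\<Theta> S \<mu>))))"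
      using Y\<sigma>[OF y] by (intro sum_mono) blast
    also have "(\<Sum>\<mu>\<in>message S ` \<Omega>. c * (real (card (simulated k y S \<inter> \<Theta> S \<mu>)) - \<epsilon> * real (card (\<Theta> S \<mu>))))
        = c * ((\<Sum>\<mu>\<in>message S ` \<Omega>. real (card (simulated k y S \<inter> \<Theta> S \<mu>)))
           - \<epsilon> * (\<Sum>\<mu>\<in>message S ` \<Omega>. real (card (\<Theta> S \<mu>))))"
      by (simp add: sum_distrib_left sum_subtractf right_diff_distrib)
    also have "(\<Sum>\<mu>\<in>message S ` \<Omega>. real (card (\<Theta> S \<mu>))) = real (card \<Omega>)"
      using sum.image_gen[OF finite_\<Omega>, of "\<lambda>_. 1::real" "message S"] by (simp add: \<Theta>_def)
    also have "(\<Sum>\<mu>\<in>message S ` \<Omega>. real (card (simulated k y S \<inter> \<Theta> S \<mu>))) = real (card (simulated k y S))"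
    proof -
      have "card (simulated k y S \<inter> \<Theta> S \<mu>) = (\<Sum>\<omega>\<in>\<Theta> S \<mu>. of_bool (\<omega> \<in> simulated k y S))" for \<mu>
        using finite_\<Omega> by (simp add: \<Theta>_def Int_commute)
      then have "(\<Sum>\<mu>\<in>message S ` \<Omega>. real (card (simulated k y S \<inter> \<Theta> S \<mu>)))
          = (\<Sum>\<mu>\<in>message S ` \<Omega>. \<Sum>\<omega>\<in>\<Theta> S \<mu>. of_bool (\<omega> \<in> simulated k y S))"
        by simp
      also have "\<dots> = (\<Sum>\<omega>\<in>\<Omega>. of_bool (\<omega> \<in> simulated k y S))"
        unfolding \<Theta>_def by (rule sum.image_gen[OF finite_\<Omega>, symmetric])
      also have "\<dots> = real (card (simulated k y S))"
      proof -
        have "\<Omega> \<inter> simulated k y S = simulated k y S" by (auto simp: simulated_def)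
        then show ?thesis using finite_\<Omega> by simp
      qed
      finally show ?thesis .
    qed
    finally show ?thesis .
  qed
  have sim_mass: "p ^ k0 * real (card {\<omega> \<in> \<Omega>. card (probed_cells (prog y) (M \<omega>)) \<le> k \<and>
        card (probed_cells (prog y) (M \<omega>) \<inter> (C \<omega> - A \<omega>)) \<le> k0})
      \<le> (\<Sum>S\<in>Pow U. subset_weight p U S * real (card (simulated k y S)))"
    (is "p ^ k0 * real (card ?G) \<le> _") if y: "y \<in> Q" for y
  proof -
    let ?Z = "\<lambda>\<omega>. probed_cells (prog y) (M \<omega>) \<inter> (C \<omega> - A \<omega>)"
    have "card (simulated k y S) = (\<Sum>\<omega>\<in>\<Omega>. of_bool (card (probed_cells (prog y) (M \<omega>)) \<le> k) * of_bool (?Z \<omega> \<subseteq> S))" for S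
      unfolding simulated_def card_filter_eq_sum[OF finite_\<Omega>] by (simp only: of_bool_conj)
    then have "(\<Sum>S\<in>Pow U. subset_weight p U S * real (card (simulated k y S)))
        = (\<Sum>S\<in>Pow U. \<Sum>\<omega>\<in>\<Omega>. of_bool (card (probed_cells (prog y) (M \<omega>)) \<le> k) * (subset_weight p U S * of_bool (?Z \<omega> \<subseteq> S)))"
      by (simp add: sum_distrib_left ac_simps)
    also have "\<dots> = (\<Sum>\<omega>\<in>\<Omega>. of_bool (card (probed_cells (prog y) (M \<omega>)) \<le> k) * p ^ card (?Z \<omega>))"
    proof (subst sum.swap, rule sum.cong[OF refl])
      fix \<omega> assume "\<omega> \<in> \<Omega>"
      then have "?Z \<omega> \<subseteq> U" using probed_subset[OF y bounded_M] by blast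
      then show "(\<Sum>S\<in>Pow U. of_bool (card (probed_cells (prog y) (M \<omega>)) \<le> k) * (subset_weight p U S * of_bool (?Z \<omega> \<subseteq> S)))
          = of_bool (card (probed_cells (prog y) (M \<omega>)) \<le> k) * p ^ card (?Z \<omega>)"
        unfolding sum_distrib_left[symmetric] by (subst sum_subset_weight_superset[OF finU]) auto
    qed
    also have "\<dots> \<ge> (\<Sum>\<omega>\<in>\<Omega>. p ^ k0 * of_bool (\<omega> \<in> ?G))"
      using p by (intro sum_mono) (auto intro!: power_decreasing)
    also have "(\<Sum>\<omega>\<in>\<Omega>. p ^ k0 * of_bool (\<omega> \<in> ?G)) = p ^ k0 * real (card ?G)"
      using finite_\<Omega> by (simp add: sum_distrib_left[symmetric] Int_def)
    finally show ?thesis .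
  qed
  show ?thesis
  proof (rule that[of \<phi>])
    show "\<bar>\<phi> y S S' \<omega>\<bar> \<le> 1" for y S S' \<omega> using Y\<sigma> by (auto simp: \<phi>_def)
  next
    fix y S S' \<omega> \<omega>' assume y: "y \<in> Q" and w: "\<omega> \<in> \<Omega>" "\<omega>' \<in> \<Omega>"
      and eq: "message (S \<union> S') \<omega> = message (S \<union> S') \<omega>'"
    have eq0: "message S \<omega> = message S \<omega>'" by (rule message_mono[OF eq])
    \<comment> \<open>The true contents of all cells of \<open>S'\<close> are known: those from the
      epoch or later are in the message, the others have kept their contents from before the
      epoch.\<close>
    have "M \<omega> a = M \<omega>' a" if "a \<in> S'" for a
      using patched_correct[OF w(1), of a "S \<union> S'"] patched_correct[OF w(2), of a "S \<union> S'"] that eq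
      by simp
    then show "\<phi> y S S' \<omega> = \<phi> y S S' \<omega>'"
      unfolding \<phi>_def eq0 by (auto simp: mismatches_def subset_iff)
  next
    have "c * \<epsilon> * (real (card Q) * real (card \<Omega>))
        = c * (p ^ k0 * (real (card Q) * real (card \<Omega>) / 2) - \<epsilon> * real (card \<Omega>) * real (card Q))"
      by (simp add: \<epsilon>_def algebra_simps)
    also have "\<dots> \<le> c * (p ^ k0 * (\<Sum>y\<in>Q. real (card {\<omega> \<in> \<Omega>.
        card (probed_cells (prog y) (M \<omega>)) \<le> k \<and>
        card (probed_cells (prog y) (M \<omega>) \<inter> (C \<omega> - A \<omega>)) \<le> k0})) - \<epsilon> * real (card \<Omega>) * real (card Q))"
      using c p good by (intro mult_left_mono diff_right_mono) auto
    also have "\<dots> \<le> c * ((\<Sum>y\<in>Q. \<Sum>S\<in>Pow U. subset_weight p U S * real (card (simulated k y S)))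
        - \<epsilon> * real (card \<Omega>) * real (card Q))"
      unfolding sum_distrib_left using c sim_mass
      by (intro mult_left_mono diff_right_mono sum_mono) auto
    also have "\<dots> = (\<Sum>y\<in>Q. \<Sum>S\<in>Pow U. subset_weight p U S * (c * (real (card (simulated k y S)) - \<epsilon> * real (card \<Omega>))))"
    proof -
      have "(\<Sum>S\<in>Pow U. subset_weight p U S * (c * (real (card (simulated k y S)) - \<epsilon> * real (card \<Omega>))))
          = c * (\<Sum>S\<in>Pow U. subset_weight p U S * real (card (simulated k y S)))
            - c * \<epsilon> * real (card \<Omega>) * (\<Sum>S\<in>Pow U. subset_weight p U S)" for y
        by (simp add: sum_distrib_left sum_subtractf algebra_simps)
      then show ?thesis
        unfolding sum_subset_weight[OF finU]
        by (simp add: sum_subtractf right_diff_distrib flip: sum_distrib_left)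
    qed
    also have "\<dots> \<le> (\<Sum>y\<in>Q. \<Sum>S\<in>Pow U. subset_weight p U S *
        (\<Sum>S'\<in>Pow U. subset_weight p U S' * (\<Sum>\<omega>\<in>\<Omega>. \<phi> y S S' \<omega> * answer y \<omega>)))"
      using p by (intro sum_mono mult_left_mono per_query subset_weight_nonneg) auto
    also have "\<dots> = (\<Sum>S\<in>Pow U. \<Sum>y\<in>Q. \<Sum>S'\<in>Pow U. subset_weight p U S * subset_weight p U S' *
          (\<Sum>\<omega>\<in>\<Omega>. \<phi> y S S' \<omega> * answer y \<omega>))"
      by (subst sum.swap) (simp add: sum_distrib_left ac_simps)
    also have "\<dots> = (\<Sum>S\<in>Pow U. \<Sum>S'\<in>Pow U. subset_weight p U S * subset_weight p U S' *
           (\<Sum>y\<in>Q. \<Sum>\<omega>\<in>\<Omega>. \<phi> y S S' \<omega> * answer y \<omega>))"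
    proof (rule sum.cong[OF refl])
      fix S
      show "(\<Sum>y\<in>Q. \<Sum>S'\<in>Pow U. subset_weight p U S * subset_weight p U S' * (\<Sum>\<omega>\<in>\<Omega>. \<phi> y S S' \<omega> * answer y \<omega>))
         = (\<Sum>S'\<in>Pow U. subset_weight p U S * subset_weight p U S' * (\<Sum>y\<in>Q. \<Sum>\<omega>\<in>\<Omega>. \<phi> y S S' \<omega> * answer y \<omega>))"
        by (subst sum.swap) (simp add: sum_distrib_left)
    qed
    also have "c * \<epsilon> = p ^ r * (p ^ k0) ^ 2 / 32 / 2 ^ (45 * (2 ^ I * \<kappa>))"
      by (simp add: c_def \<epsilon>_def power2_eq_square)
    finally show "p ^ r * (p ^ k0) ^ 2 / 32 / 2 ^ (45 * (2 ^ I * \<kappa>)) * (real (card Q) * real (card \<Omega>))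
      \<le> (\<Sum>S\<in>Pow U. \<Sum>S'\<in>Pow U. subset_weight p U S * subset_weight p U S' *
           (\<Sum>y\<in>Q. \<Sum>\<omega>\<in>\<Omega>. \<phi> y S S' \<omega> * answer y \<omega>))" .
  qed
qed

end

section \<open>Moments of signs with limited independence\<close>

text \<open>Signs square to 1, so only the indices hit an odd number of times survive.\<close>

lemma prod_signs:
  fixes h :: "'q \<Rightarrow> real" and n :: nat
  assumes "finite Q" "\<phi> \<in> PiE {..<n} (\<lambda>_. Q)" "\<And>y. y \<in> Q \<Longrightarrow> \<bar>h y\<bar> = 1"
  shows "(\<Prod>t<n. h (\<phi> t)) = (\<Prod>y\<in>{y \<in> Q. odd (card {t \<in> {..<n}. \<phi> t = y})}. h y)"
proof -
  have "(\<Prod>t<n. h (\<phi> t)) = (\<Prod>y\<in>Q. \<Prod>t\<in>{t \<in> {..<n}. \<phi> t = y}. h (\<phi> t))"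
    using assms by (intro prod.group[symmetric]) auto
  also have "\<dots> = (\<Prod>y\<in>Q. if odd (card {t \<in> {..<n}. \<phi> t = y}) then h y else 1)"
  proof (rule prod.cong[OF refl])
    fix y assume y: "y \<in> Q"
    let ?c = "card {t \<in> {..<n}. \<phi> t = y}"
    have "(\<Prod>t\<in>{t \<in> {..<n}. \<phi> t = y}. h (\<phi> t)) = (\<Prod>t\<in>{t \<in> {..<n}. \<phi> t = y}. h y)"
      by (rule prod.cong) auto
    also have "\<dots> = h y ^ ?c" by simp
    also have "h y = 1 \<or> h y = -1" using assms(3)[OF y] by linarith
    then have "h y ^ ?c = (if odd ?c then h y else 1)" by auto
    finally show "(\<Prod>t\<in>{t \<in> {..<n}. \<phi> t = y}. h (\<phi> t)) = (if odd ?c then h y else 1)" .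
  qed
  also have "\<dots> = (\<Prod>y\<in>{y \<in> Q. odd (card {t \<in> {..<n}. \<phi> t = y})}. h y)"
    using assms(1) by (intro prod.inter_filter[symmetric])
  finally show ?thesis .
qed

text \<open>The moments up to order \<open>n\<close> of a signed sum only depend on the \<open>n\<close>-wise independence of the signs.\<close>

lemma moment_expansion:
  fixes g :: "'q \<Rightarrow> 'o \<Rightarrow> real" and e :: "'q \<Rightarrow> real"
  assumes fin: "finite Q" "finite \<Omega>" and g: "\<And>y \<omega>. y \<in> Q \<Longrightarrow> \<omega> \<in> \<Omega> \<Longrightarrow> \<bar>g y \<omega>\<bar> = 1"
    and vanish: "\<And>T. T \<subseteq> Q \<Longrightarrow> T \<noteq> {} \<Longrightarrow> card T \<le> n \<Longrightarrow> (\<Sum>\<omega>\<in>\<Omega>. \<Prod>y\<in>T. g y \<omega>) = 0"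
  shows "(\<Sum>\<omega>\<in>\<Omega>. (\<Sum>y\<in>Q. e y * g y \<omega>) ^ n) = real (card \<Omega>) *
    (\<Sum>\<phi>\<in>{\<phi> \<in> PiE {..<n} (\<lambda>_. Q). \<forall>y\<in>Q. even (card {t \<in> {..<n}. \<phi> t = y})}. \<Prod>t<n. e (\<phi> t))"
proof -
  let ?P = "PiE {..<n} (\<lambda>_. Q)"
  let ?E = "{\<phi> \<in> ?P. \<forall>y\<in>Q. even (card {t \<in> {..<n}. \<phi> t = y})}"
  have finP: "finite ?P" using fin by (simp add: finite_PiE)
  \<comment> \<open>Expand the power over all maps from \<open>{..<n}\<close> to \<open>Q\<close>.
    After cancelling squares, at most \<open>n\<close> different signs remain in each product, so
    its sum vanishes unless none remains.\<close>
  have "(\<Sum>\<omega>\<in>\<Omega>. (\<Sum>y\<in>Q. e y * g y \<omega>) ^ n)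
      = (\<Sum>\<omega>\<in>\<Omega>. \<Sum>\<phi>\<in>?P. \<Prod>t<n. e (\<phi> t) * g (\<phi> t) \<omega>)"
    using fin prod_sum_PiE[of "{..<n}" "\<lambda>_. Q" "\<lambda>_ y. e y * g y _"] by (intro sum.cong refl) simp
  also have "\<dots> = (\<Sum>\<phi>\<in>?P. (\<Prod>t<n. e (\<phi> t)) * (\<Sum>\<omega>\<in>\<Omega>. \<Prod>t<n. g (\<phi> t) \<omega>))"
    by (subst sum.swap) (simp add: prod.distrib sum_distrib_left)
  also have "\<dots> = (\<Sum>\<phi>\<in>?P. if \<forall>y\<in>Q. even (card {t \<in> {..<n}. \<phi> t = y})
      then (\<Prod>t<n. e (\<phi> t)) * real (card \<Omega>) else 0)"
  proof (rule sum.cong[OF refl])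
    fix \<phi> assume \<phi>: "\<phi> \<in> ?P"
    let ?T = "{y \<in> Q. odd (card {t \<in> {..<n}. \<phi> t = y})}"
    have "?T \<subseteq> \<phi> ` {..<n}"
    proof
      fix y assume y: "y \<in> ?T"
      show "y \<in> \<phi> ` {..<n}"
      proof (rule ccontr)
        assume "y \<notin> \<phi> ` {..<n}"
        then have "{t \<in> {..<n}. \<phi> t = y} = {}" by auto
        then have "even (card {t \<in> {..<n}. \<phi> t = y})" by (simp only: card.empty even_zero)
        with y show False by blast
      qed
    qed
    then have "card ?T \<le> n"
      using card_mono[of "\<phi> ` {..<n}" ?T] card_image_le[of "{..<n}" \<phi>] by simp
    moreover have "(\<Sum>\<omega>\<in>\<Omega>. \<Prod>t<n. g (\<phi> t) \<omega>) = (\<Sum>\<omega>\<in>\<Omega>. \<Prod>y\<in>?T. g y \<omega>)"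
      using g by (intro sum.cong refl prod_signs[OF fin(1) \<phi>]) auto
    moreover have "(\<forall>y\<in>Q. even (card {t \<in> {..<n}. \<phi> t = y})) \<longleftrightarrow> ?T = {}" by auto
    moreover have "(\<Sum>\<omega>\<in>\<Omega>. \<Prod>y\<in>?T. g y \<omega>) = (if ?T = {} then real (card \<Omega>) else 0)" if "card ?T \<le> n"
    proof (cases "?T = {}")
      case True
      then show ?thesis by (simp only: prod.empty) simp
    next
      case False
      then show ?thesis using vanish[of ?T] that by (simp only: if_False) blast
    qed
    ultimately show "(\<Prod>t<n. e (\<phi> t)) * (\<Sum>\<omega>\<in>\<Omega>. \<Prod>t<n. g (\<phi> t) \<omega>)
        = (if \<forall>y\<in>Q. even (card {t \<in> {..<n}. \<phi> t = y}) then (\<Prod>t<n. e (\<phi> t)) * real (card \<Omega>) else 0)"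
      by (simp only: if_distrib[of "\<lambda>x. _ * x"] mult_zero_right)
  qed
  also have "\<dots> = (\<Sum>\<phi>\<in>?E. (\<Prod>t<n. e (\<phi> t)) * real (card \<Omega>))"
    by (rule sum.inter_filter[OF finP, symmetric])
  finally show ?thesis by (simp add: sum_distrib_left mult.commute)
qed

text \<open>The power series are compared term by term, by
  \<open>2 ^ n * n! \<le> (2 * n)!\<close>.\<close>

lemma cosh_le_exp_square: "cosh (t::real) \<le> exp (t\<^sup>2 / 2)"
proof -
  have "(\<lambda>n. (\<lambda>n. if even n then t ^ n /\<^sub>R fact n else 0) (2 * n)) sums cosh t"
    using cosh_converges[of t] by (subst sums_mono_reindex) (auto simp: strict_mono_def elim!: evenE)
  then have 1: "(\<lambda>n. t ^ (2 * n) /\<^sub>R fact (2 * n)) sums cosh t" by simp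
  have 2: "(\<lambda>n. (t\<^sup>2 / 2) ^ n /\<^sub>R fact n) sums exp (t\<^sup>2 / 2)" by (rule exp_converges)
  have f: "(2::real) ^ n * fact n \<le> fact (2 * n)" for n
  proof (induction n)
    case (Suc n)
    have "(2::real) ^ Suc n * fact (Suc n) = (2 * real n + 2) * (2 ^ n * fact n)" by (simp add: algebra_simps)
    also have "\<dots> \<le> (2 * real n + 2) * ((2 * real n + 1) * fact (2 * n))"
    proof (rule mult_left_mono)
      have "1 * fact (2 * n) \<le> (2 * real n + 1) * fact (2 * n)" by (intro mult_right_mono) auto
      with Suc show "2 ^ n * fact n \<le> (2 * real n + 1) * fact (2 * n)" by linarith
    qed simp
    also have "\<dots> = fact (2 * Suc n)" by (simp add: algebra_simps)
    finally show ?case .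
  qed simp
  show ?thesis
  proof (rule sums_le[OF _ 1 2])
    fix n
    have pw: "(t\<^sup>2 / 2) ^ n = t ^ (2 * n) / 2 ^ n" by (simp only: power_divide power_mult)
    have "t ^ (2 * n) / fact (2 * n) \<le> t ^ (2 * n) / (2 ^ n * fact n)"
      using f by (intro divide_left_mono) auto
    then show "t ^ (2 * n) /\<^sub>R fact (2 * n) \<le> (t\<^sup>2 / 2) ^ n /\<^sub>R fact n"
      unfolding pw real_scaleR_def by (simp add: field_simps)
  qed
qed

text \<open>The even power is bounded by exponentials, whose sums over independent signs factor into
  powers of \<open>cosh\<close>.\<close>

lemma rademacher_moment:
  assumes "finite Q" "Q \<noteq> {}" "j > 0"
  shows "(\<Sum>\<rho>\<in>PiE Q (\<lambda>_. {1, -1}). (\<Sum>y\<in>Q. \<rho> y) ^ (2 * j))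
    \<le> 2 ^ card Q * (12 * real j * real (card Q)) ^ j"
proof -
  let ?P = "PiE Q (\<lambda>_. {1, -1 :: real})"
  define N where "N = real (card Q)"
  \<comment> \<open>This scaling minimizes \<open>exp (N * t ^ 2 / 2) / t ^ (2 * j)\<close>; the
    exponential becomes \<open>exp j\<close>.\<close>
  define t where "t = sqrt (2 * real j / N)"
  have N: "N > 0" using assms by (simp add: N_def card_gt_0_iff)
  have t: "t > 0" "t\<^sup>2 = 2 * real j / N" using assms N by (auto simp: t_def)
  have expsum: "(\<Sum>\<rho>\<in>?P. exp (s * (\<Sum>y\<in>Q. \<rho> y))) = (2 * cosh s) ^ card Q" for s :: real
  proof -
    have "(\<Sum>\<rho>\<in>?P. exp (s * (\<Sum>y\<in>Q. \<rho> y))) = (\<Sum>\<rho>\<in>?P. \<Prod>y\<in>Q. exp (s * \<rho> y))"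
      using assms by (simp add: sum_distrib_left exp_sum)
    also have "\<dots> = (\<Prod>y\<in>Q. \<Sum>x\<in>{1, -1}. exp (s * x))"
      using assms by (intro prod_sum_PiE[symmetric]) auto
    also have "(\<Sum>x\<in>{1, -1}. exp (s * x)) = 2 * cosh s" by (simp add: cosh_def field_simps)
    also have "(\<Prod>y\<in>Q. 2 * cosh s) = (2 * cosh s) ^ card Q" by simp
    finally show ?thesis .
  qed
  have pw: "x ^ (2 * j) \<le> fact (2 * j) * (exp x + exp (- x))" for x :: real
  proof -
    have "\<bar>x\<bar> ^ (2 * j) / fact (2 * j) \<le> exp \<bar>x\<bar>"
      using sum_le_suminf[OF summable_exp[of "\<bar>x\<bar>"], of "{2 * j}"]
      by (simp add: exp_def divide_inverse mult.commute)
    also have "exp \<bar>x\<bar> \<le> exp x + exp (- x)" by (cases "x \<ge> 0") auto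
    finally show ?thesis by (simp add: power_even_abs field_simps)
  qed
  have "t ^ (2 * j) * (\<Sum>\<rho>\<in>?P. (\<Sum>y\<in>Q. \<rho> y) ^ (2 * j)) = (\<Sum>\<rho>\<in>?P. (t * (\<Sum>y\<in>Q. \<rho> y)) ^ (2 * j))"
    by (simp only: power_mult_distrib sum_distrib_left[of "t ^ (2 * j)"])
  also have "\<dots> \<le> (\<Sum>\<rho>\<in>?P. fact (2 * j) * (exp (t * (\<Sum>y\<in>Q. \<rho> y)) + exp (- t * (\<Sum>y\<in>Q. \<rho> y))))"
    using pw by (intro sum_mono) simp
  also have "\<dots> = fact (2 * j) * (2 * (2 * cosh t) ^ card Q)"
    using expsum[of t] expsum[of "- t"] by (simp add: sum_distrib_left[symmetric] sum.distrib)
  also have "\<dots> \<le> real (2 * j) ^ (2 * j) * (2 * (2 * exp (t\<^sup>2 / 2)) ^ card Q)"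
  proof (intro mult_mono power_mono mult_left_mono)
    show "fact (2 * j) \<le> real (2 * j) ^ (2 * j)"
      using fact_le_power[where 'a = real and n = "2 * j"] by (simp only: of_nat_power)
  qed (use cosh_le_exp_square[of t] cosh_real_pos[of t] in \<open>auto simp: less_imp_le\<close>)
  also have "(2 * exp (t\<^sup>2 / 2)) ^ card Q = 2 ^ card Q * exp (real j)"
    using N t by (simp add: power_mult_distrib exp_of_nat_mult[symmetric] N_def)
  finally have "t ^ (2 * j) * (\<Sum>\<rho>\<in>?P. (\<Sum>y\<in>Q. \<rho> y) ^ (2 * j))
      \<le> real (2 * j) ^ (2 * j) * (2 * (2 ^ card Q * exp (real j)))" .
  also have "\<dots> \<le> real (2 * j) ^ (2 * j) * (2 ^ j * (2 ^ card Q * 3 ^ j))"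
  proof (intro mult_left_mono mult_mono)
    show "(2::real) \<le> 2 ^ j" using assms(3) by (cases j) auto
    have "exp (real j) = exp 1 ^ j" by (simp add: exp_of_nat_mult[symmetric])
    also have "\<dots> \<le> 3 ^ j" using exp_le by (intro power_mono) auto
    finally show "exp (real j) \<le> 3 ^ j" .
  qed auto
  also have "\<dots> = t ^ (2 * j) * (2 ^ card Q * (12 * real j * N) ^ j)"
  proof -
    have "real (2 * j) ^ (2 * j) = ((2 * real j)\<^sup>2) ^ j"
      by (simp only: power_mult of_nat_mult of_nat_numeral)
    moreover have "2 ^ j * 3 ^ j = (6::real) ^ j" by (simp flip: power_mult_distrib)
    ultimately have "real (2 * j) ^ (2 * j) * (2 ^ j * 3 ^ j) = ((2 * real j)\<^sup>2 * 6) ^ j"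
      by (simp only: power_mult_distrib)
    also have "(2 * real j)\<^sup>2 * 6 = t\<^sup>2 * (12 * real j * N)"
      using N by (simp add: t(2)) (simp add: power2_eq_square)
    also have "(t\<^sup>2 * (12 * real j * N)) ^ j = t ^ (2 * j) * (12 * real j * N) ^ j"
      by (simp only: power_mult_distrib power_mult)
    finally have eq: "real (2 * j) ^ (2 * j) * (2 ^ j * 3 ^ j) = t ^ (2 * j) * (12 * real j * N) ^ j" .
    have "real (2 * j) ^ (2 * j) * (2 ^ j * (2 ^ card Q * 3 ^ j))
        = 2 ^ card Q * (real (2 * j) ^ (2 * j) * (2 ^ j * 3 ^ j))" by (simp only: ac_simps)
    also have "\<dots> = t ^ (2 * j) * (2 ^ card Q * (12 * real j * N) ^ j)"
      unfolding eq by (simp only: ac_simps)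
    finally show ?thesis .
  qed
  finally show ?thesis using t(1) by (simp add: N_def)
qed

text \<open>The expansion leaves only maps that hit every index an even number of times. Their
  number has nothing to do with the given signs, so it can be read off from fully independent ones;
  \<open>moment_expansion\<close> is used for both.\<close>

lemma limited_independence_moment:
  fixes g :: "'q \<Rightarrow> 'o \<Rightarrow> real" and e :: "'q \<Rightarrow> real"
  assumes fin: "finite Q" "Q \<noteq> {}" "finite \<Omega>" and j: "j > 0"
    and g: "\<And>y \<omega>. y \<in> Q \<Longrightarrow> \<omega> \<in> \<Omega> \<Longrightarrow> \<bar>g y \<omega>\<bar> = 1"
    and vanish: "\<And>T. T \<subseteq> Q \<Longrightarrow> T \<noteq> {} \<Longrightarrow> card T \<le> 2 * j \<Longrightarrow> (\<Sum>\<omega>\<in>\<Omega>. \<Prod>y\<in>T. g y \<omega>) = 0"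
    and e: "\<And>y. y \<in> Q \<Longrightarrow> \<bar>e y\<bar> \<le> 1"
  shows "(\<Sum>\<omega>\<in>\<Omega>. (\<Sum>y\<in>Q. e y * g y \<omega>) ^ (2 * j)) \<le> real (card \<Omega>) * (12 * real j * real (card Q)) ^ j"
proof -
  let ?P = "PiE Q (\<lambda>_. {1, -1 :: real})"
  let ?E = "{\<phi> \<in> PiE {..<2 * j} (\<lambda>_. Q). \<forall>y\<in>Q. even (card {t \<in> {..<2 * j}. \<phi> t = y})}"
  have finP: "finite ?P" using fin by (simp add: finite_PiE)
  have cardP: "card ?P = 2 ^ card Q" using fin by (simp add: card_PiE numeral_2_eq_2)
  have "(\<Sum>\<rho>\<in>?P. \<Prod>y\<in>T. \<rho> y) = 0" if "T \<subseteq> Q" "T \<noteq> {}" for T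
  proof -
    have "(\<Sum>\<rho>\<in>?P. \<Prod>y\<in>T. \<rho> y) = (\<Sum>\<rho>\<in>?P. \<Prod>y\<in>Q. if y \<in> T then \<rho> y else 1)"
      using that fin by (intro sum.cong refl prod.mono_neutral_cong_left) auto
    also have "\<dots> = (\<Prod>y\<in>Q. \<Sum>x\<in>{1, -1 :: real}. if y \<in> T then x else 1)"
      using fin by (intro prod_sum_PiE[symmetric]) auto
    also have "\<dots> = 0" using that fin by (intro prod_zero) auto
    finally show ?thesis .
  qed
  then have "(\<Sum>\<rho>\<in>?P. (\<Sum>y\<in>Q. 1 * \<rho> y) ^ (2 * j)) = real (card ?P) * (\<Sum>\<phi>\<in>?E. \<Prod>t<2 * j. 1)"
    by (intro moment_expansion[OF fin(1) finP]) (auto simp: PiE_iff)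
  then have "2 ^ card Q * real (card ?E) = (\<Sum>\<rho>\<in>?P. (\<Sum>y\<in>Q. \<rho> y) ^ (2 * j))"
    by (simp add: cardP)
  also have "\<dots> \<le> 2 ^ card Q * (12 * real j * real (card Q)) ^ j"
    by (rule rademacher_moment[OF fin(1,2) j])
  finally have E: "real (card ?E) \<le> (12 * real j * real (card Q)) ^ j" by simp
  have "(\<Sum>\<omega>\<in>\<Omega>. (\<Sum>y\<in>Q. e y * g y \<omega>) ^ (2 * j)) = real (card \<Omega>) * (\<Sum>\<phi>\<in>?E. \<Prod>t<2 * j. e (\<phi> t))"
    by (intro moment_expansion[OF fin(1,3)] g vanish)
  also have "\<dots> \<le> real (card \<Omega>) * (\<Sum>\<phi>\<in>?E. 1)"
  proof (intro mult_left_mono sum_mono)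
    fix \<phi> assume \<phi>: "\<phi> \<in> ?E"
    have "\<bar>\<Prod>t<2 * j. e (\<phi> t)\<bar> \<le> 1"
      unfolding abs_prod by (rule prod_le_1) (use \<phi> e in auto)
    then show "(\<Prod>t<2 * j. e (\<phi> t)) \<le> 1" by linarith
  qed simp
  also have "\<dots> \<le> real (card \<Omega>) * (12 * real j * real (card Q)) ^ j"
    using E by (intro mult_left_mono) auto
  finally show ?thesis .
qed

text \<open>A union bound over messages on the level of moments: \<open>4 ^ j\<close> messages
  increase the moment of order \<open>2 * j\<close> by a factor \<open>4 ^ j\<close>, hence the
  typical size of the sum by a factor 2 only. Accordingly \<open>48 = 4 * 12\<close> in the
  bound.\<close>

lemma strategy_upper_bound:
  fixes g :: "'q \<Rightarrow> 'o \<Rightarrow> real" and e :: "'m \<Rightarrow> 'q \<Rightarrow> real" and \<mu> :: "'o \<Rightarrow> 'm"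
  assumes fin: "finite Q" "Q \<noteq> {}" "finite \<Omega>" and j: "j > 0"
    and g: "\<And>y \<omega>. y \<in> Q \<Longrightarrow> \<omega> \<in> \<Omega> \<Longrightarrow> \<bar>g y \<omega>\<bar> = 1"
    and vanish: "\<And>T. T \<subseteq> Q \<Longrightarrow> T \<noteq> {} \<Longrightarrow> card T \<le> 2 * j \<Longrightarrow> (\<Sum>\<omega>\<in>\<Omega>. \<Prod>y\<in>T. g y \<omega>) = 0"
    and e: "\<And>m y. y \<in> Q \<Longrightarrow> \<bar>e m y\<bar> \<le> 1"
    and msgs: "finite B" "real (card B) \<le> 4 ^ j" "\<Omega>' \<subseteq> \<Omega>" "\<mu> ` \<Omega>' \<subseteq> B"
  shows "(\<Sum>\<omega>\<in>\<Omega>'. \<Sum>y\<in>Q. e (\<mu> \<omega>) y * g y \<omega>)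
    \<le> real (card \<Omega>) * (2 * sqrt (48 * real j * real (card Q)))"
proof -
  define L where "L = sqrt (48 * real j * real (card Q))"
  define X where "X m \<omega> = (\<Sum>y\<in>Q. e m y * g y \<omega>)" for m \<omega>
  have L: "L > 0" "L\<^sup>2 = 48 * real j * real (card Q)"
    using fin j by (auto simp: L_def card_gt_0_iff)
  have fin': "finite \<Omega>'" using msgs fin finite_subset by blast
  \<comment> \<open>This linear form of \<open>z \<le> 1 + z ^ (2 * j)\<close> with
    \<open>z = x / L\<close> passes from the moment to the first power.\<close>
  have pw: "x \<le> L + L / L ^ (2 * j) * x ^ (2 * j)" for x
  proof -
    define z where "z = x / L"
    have "z \<le> 1 + z ^ (2 * j)"
    proof (cases "z \<le> 1")
      case True
      have "0 \<le> z ^ (2 * j)" by (simp add: zero_le_even_power)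
      with True show ?thesis by linarith
    next
      case False
      then have "z ^ 1 \<le> z ^ (2 * j)" using j by (intro power_increasing) auto
      then show ?thesis by simp
    qed
    then have "L * z \<le> L * (1 + z ^ (2 * j))" using L by (intro mult_left_mono) auto
    then show ?thesis using L by (simp add: z_def power_divide algebra_simps)
  qed
  have "(\<Sum>\<omega>\<in>\<Omega>'. X (\<mu> \<omega>) \<omega>) \<le> (\<Sum>\<omega>\<in>\<Omega>'. L + L / L ^ (2 * j) * X (\<mu> \<omega>) \<omega> ^ (2 * j))"
    by (intro sum_mono pw)
  also have "\<dots> = real (card \<Omega>') * L + L / L ^ (2 * j) * (\<Sum>\<omega>\<in>\<Omega>'. X (\<mu> \<omega>) \<omega> ^ (2 * j))"
    by (simp add: sum.distrib sum_distrib_left)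
  also have "\<dots> \<le> real (card \<Omega>) * L + L / L ^ (2 * j) * (real (card \<Omega>) * L ^ (2 * j))"
  proof (intro add_mono mult_left_mono mult_right_mono)
    show "real (card \<Omega>') \<le> real (card \<Omega>)" using card_mono[OF fin(3) msgs(3)] by simp
    have "(\<Sum>\<omega>\<in>\<Omega>'. X (\<mu> \<omega>) \<omega> ^ (2 * j)) = (\<Sum>m\<in>B. \<Sum>\<omega>\<in>{\<omega> \<in> \<Omega>'. \<mu> \<omega> = m}. X (\<mu> \<omega>) \<omega> ^ (2 * j))"
      by (rule sum.group[OF fin' msgs(1,4), symmetric])
    also have "\<dots> = (\<Sum>m\<in>B. \<Sum>\<omega>\<in>{\<omega> \<in> \<Omega>'. \<mu> \<omega> = m}. X m \<omega> ^ (2 * j))"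
      by (intro sum.cong) auto
    \<comment> \<open>Even powers are nonnegative, so the outcomes of each message may be enlarged
      to all of \<open>\<Omega>\<close>, where the independence holds.\<close>
    also have "\<dots> \<le> (\<Sum>m\<in>B. \<Sum>\<omega>\<in>\<Omega>. X m \<omega> ^ (2 * j))"
      using msgs fin by (intro sum_mono sum_mono2) (auto simp: zero_le_even_power)
    also have "\<dots> \<le> (\<Sum>m\<in>B. real (card \<Omega>) * (12 * real j * real (card Q)) ^ j)"
      unfolding X_def by (intro sum_mono limited_independence_moment[OF fin j] g vanish e)
    also have "\<dots> = real (card B) * (real (card \<Omega>) * (12 * real j * real (card Q)) ^ j)" by simp
    also have "\<dots> \<le> 4 ^ j * (real (card \<Omega>) * (12 * real j * real (card Q)) ^ j)"
      using msgs(2) by (intro mult_right_mono) auto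
    also have "\<dots> = real (card \<Omega>) * (L\<^sup>2) ^ j"
    proof -
      have "L\<^sup>2 = 4 * (12 * real j * real (card Q))" by (simp add: L(2))
      then have "(L\<^sup>2) ^ j = 4 ^ j * (12 * real j * real (card Q)) ^ j"
        by (simp only: power_mult_distrib)
      then show ?thesis by (simp only: ac_simps)
    qed
    finally show "(\<Sum>\<omega>\<in>\<Omega>'. X (\<mu> \<omega>) \<omega> ^ (2 * j)) \<le> real (card \<Omega>) * L ^ (2 * j)" by (simp add: power_mult)
  qed (use L in auto)
  also have "\<dots> = real (card \<Omega>) * (2 * L)" using L(1) by simp
  finally show ?thesis by (simp add: X_def L_def)
qed

section \<open>Counting messages\<close>

lemma card_partial_maps:
  "finite {f :: nat \<rightharpoonup> nat. dom f \<subseteq> {..<N} \<and> ran f \<subseteq> {..<N} \<and> card (dom f) \<le> s} \<and>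
   card {f :: nat \<rightharpoonup> nat. dom f \<subseteq> {..<N} \<and> ran f \<subseteq> {..<N} \<and> card (dom f) \<le> s} \<le> (N * N + 1) ^ s"
proof -
  let ?X = "{f :: nat \<rightharpoonup> nat. dom f \<subseteq> {..<N} \<and> ran f \<subseteq> {..<N} \<and> card (dom f) \<le> s}"
  let ?L = "{xs. set xs \<subseteq> insert None (Some ` ({..<N} \<times> {..<N})) \<and> length xs = s}"
  let ?d = "\<lambda>xs. map_of (map the (filter (\<lambda>x. x \<noteq> None) xs)) :: nat \<rightharpoonup> nat"
  have finL: "finite ?L" by (rule finite_lists_length_eq) simp
  have cardL: "card ?L = (N * N + 1) ^ s"
    by (subst card_lists_length_eq) (auto simp: card_image card_insert_if)
  have "?X \<subseteq> ?d ` ?L"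
  proof
    fix f assume f: "f \<in> ?X"
    then have fd: "finite (dom f)" by (auto intro: finite_subset)
    define ks where "ks = sorted_list_of_set (dom f)"
    have ks: "set ks = dom f" "distinct ks" "length ks = card (dom f)" using fd by (auto simp: ks_def)
    \<comment> \<open>A map is coded by exactly \<open>s\<close> optional pairs, with
      \<open>None\<close> as padding; this accounts for the \<open>+ 1\<close> in the count.\<close>
    define xs where "xs = map (\<lambda>k. Some (k, the (f k))) ks @ replicate (s - length ks) None"
    have len: "length xs = s" using f ks by (simp add: xs_def)
    have "map the (filter (\<lambda>x. x \<noteq> None) xs) = map (\<lambda>k. (k, the (f k))) ks"
      by (simp add: xs_def filter_map o_def)
    then have "?d xs = map_of (map (\<lambda>k. (k, the (f k))) ks)" by simp
    also have "\<dots> = (\<lambda>k. if k \<in> dom f then Some (the (f k)) else None)"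
      by (auto simp: map_of_map_keys ks fun_eq_iff restrict_map_def map_of_map_restrict)
    also have "\<dots> = f" by (auto simp: fun_eq_iff dom_def)
    finally have "?d xs = f" .
    moreover have "set xs \<subseteq> insert None (Some ` ({..<N} \<times> {..<N}))"
    proof -
      have "k < N \<and> the (f k) < N" if "k \<in> dom f" for k
      proof -
        from that obtain v where v: "f k = Some v" by auto
        then have "v \<in> ran f" by (auto simp: ran_def)
        then show ?thesis using f that v by auto
      qed
      then show ?thesis using ks by (auto simp: xs_def)
    qed
    ultimately show "f \<in> ?d ` ?L" using len by force
  qed
  with finL cardL show ?thesis
    using card_mono[of "?d ` ?L" ?X] card_image_le[OF finL, of ?d] finite_subset[of ?X "?d ` ?L"]
    by (auto intro: order_trans)
qed

context epoch_simulation
begin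

lemma message_range:
  assumes "\<omega> \<in> \<Omega>" "X \<subseteq> U" "card X \<le> s"
  shows "contents (M \<omega>) X \<in> {f. dom f \<subseteq> U \<and> ran f \<subseteq> U \<and> card (dom f) \<le> s}"
proof -
  have "dom (contents (M \<omega>) X) = X" by (auto simp: contents_def split: if_splits)
  moreover have "ran (contents (M \<omega>) X) \<subseteq> U"
    using bounded_M[OF assms(1)] assms(2)
    by (auto simp: contents_def ran_def bounded_memory_def split: if_splits)
  ultimately show ?thesis using assms by simp
qed

text \<open>If both transmitted sets have at most \<open>s\<close> cells, there are at most
  \<open>4 ^ (4 * w * s)\<close> messages for each \<open>key\<close>, few enough for
  \<open>strategy_upper_bound\<close>. Outcomes with a longer message are charged the trivial
  advantage 1 per query.\<close>

lemma simulation_upper: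
  assumes Q: "Q \<noteq> {}" and j: "j > 0"
    and vanish: "\<And>k T. T \<subseteq> Q \<Longrightarrow> T \<noteq> {} \<Longrightarrow> card T \<le> 2 * j \<Longrightarrow>
      (\<Sum>\<omega>\<in>{\<omega> \<in> \<Omega>. key \<omega> = k}. \<Prod>y\<in>T. answer y \<omega>) = 0"
    and cardA: "\<And>\<omega>. \<omega> \<in> \<Omega> \<Longrightarrow> card (A \<omega>) \<le> s" and s: "4 * w * s \<le> j" "w > 0"
    and \<phi>: "\<And>y \<omega>. \<bar>\<phi> y \<omega>\<bar> \<le> 1"
      "\<And>y \<omega> \<omega>'. y \<in> Q \<Longrightarrow> \<omega> \<in> \<Omega> \<Longrightarrow> \<omega>' \<in> \<Omega> \<Longrightarrow> message S \<omega> = message S \<omega>' \<Longrightarrow> \<phi> y \<omega> = \<phi> y \<omega>'"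
  shows "(\<Sum>y\<in>Q. \<Sum>\<omega>\<in>\<Omega>. \<phi> y \<omega> * answer y \<omega>) \<le> real (card \<Omega>) * (2 * sqrt (48 * real j * real (card Q)))
    + real (card Q) * real (card {\<omega> \<in> \<Omega>. card (S \<inter> C \<omega>) > s})"
proof -
  define short where "short = {\<omega> \<in> \<Omega>. card (S \<inter> C \<omega>) \<le> s}"
  define long where "long = {\<omega> \<in> \<Omega>. card (S \<inter> C \<omega>) > s}"
  define W where "W = {f. dom f \<subseteq> U \<and> ran f \<subseteq> U \<and> card (dom f) \<le> s}"
  \<comment> \<open>\<open>\<phi>\<close> is a function of the outcome that is constant on message
    classes; a representative turns it into a function of the message.\<close>
  define rep where "rep m = (SOME \<omega>. \<omega> \<in> \<Omega> \<and> message S \<omega> = m)" for m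
  have W: "finite W" "card W \<le> (2 ^ w * 2 ^ w + 1) ^ s"
    unfolding W_def using card_partial_maps[of "2 ^ w" s] by blast+
  have rep: "rep (message S \<omega>) \<in> \<Omega>" "message S (rep (message S \<omega>)) = message S \<omega>" if "\<omega> \<in> \<Omega>" for \<omega>
    using someI[of "\<lambda>\<omega>'. \<omega>' \<in> \<Omega> \<and> message S \<omega>' = message S \<omega>" \<omega>] that by (auto simp: rep_def)
  have fs: "finite short" using finite_\<Omega> by (simp add: short_def)
  have "(2 ^ w * 2 ^ w + 1 :: nat) \<le> 4 ^ (2 * w)"
  proof -
    have "(2::nat) ^ w * 2 ^ w = 4 ^ w" by (simp flip: power_mult_distrib)
    moreover have "(1::nat) \<le> 4 ^ w" by simp
    moreover have "4 * (4::nat) ^ w \<le> 4 ^ w * 4 ^ w" using s(2) self_le_power[of "4::nat" w] by (intro mult_le_mono1) auto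
    moreover have "(4::nat) ^ w * 4 ^ w = 4 ^ (2 * w)" by (simp add: mult_2 power_add)
    ultimately show ?thesis by linarith
  qed
  then have "card W \<le> (4 ^ (2 * w)) ^ s" using W(2) by (meson order_trans power_mono zero_le)
  then have "card W * card W \<le> (4 ^ (2 * w)) ^ s * (4 ^ (2 * w)) ^ s" by (rule mult_le_mono) fact
  also have "\<dots> = 4 ^ (4 * w * s)" by (simp flip: power_mult power_add)
  also have "\<dots> \<le> 4 ^ j" using s by (intro power_increasing) auto
  finally have cardWW: "card W * card W \<le> 4 ^ j" .
  have fiber: "(\<Sum>\<omega>\<in>{\<omega> \<in> short. key \<omega> = k}. \<Sum>y\<in>Q. \<phi> y \<omega> * answer y \<omega>)
      \<le> real (card {\<omega> \<in> \<Omega>. key \<omega> = k}) * (2 * sqrt (48 * real j * real (card Q)))" for k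
  proof -
    let ?B = "{k} \<times> W \<times> W"
    have "(\<Sum>\<omega>\<in>{\<omega> \<in> short. key \<omega> = k}. \<Sum>y\<in>Q. \<phi> y \<omega> * answer y \<omega>)
        = (\<Sum>\<omega>\<in>{\<omega> \<in> short. key \<omega> = k}. \<Sum>y\<in>Q. \<phi> y (rep (message S \<omega>)) * answer y \<omega>)"
    proof (intro sum.cong refl)
      fix \<omega> y assume "\<omega> \<in> {\<omega> \<in> short. key \<omega> = k}" and y: "y \<in> Q"
      then have "\<omega> \<in> \<Omega>" by (simp add: short_def)
      then show "\<phi> y \<omega> * answer y \<omega> = \<phi> y (rep (message S \<omega>)) * answer y \<omega>"
        using \<phi>(2)[OF y rep(1) _ rep(2)] by simp
    qed
    also have "\<dots> \<le> real (card {\<omega> \<in> \<Omega>. key \<omega> = k}) * (2 * sqrt (48 * real j * real (card Q)))"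
    proof (rule strategy_upper_bound[where B = ?B and e = "\<lambda>m y. \<phi> y (rep m)"])
      show "finite ?B" using W by simp
      show "real (card ?B) \<le> 4 ^ j"
        using cardWW by (simp add: card_cartesian_product flip: of_nat_mult)
      show "message S ` {\<omega> \<in> short. key \<omega> = k} \<subseteq> ?B"
      proof
        fix m assume "m \<in> message S ` {\<omega> \<in> short. key \<omega> = k}"
        then obtain \<omega> where \<omega>: "\<omega> \<in> \<Omega>" "card (S \<inter> C \<omega>) \<le> s" "key \<omega> = k" "m = message S \<omega>"
          by (auto simp: short_def)
        then show "m \<in> ?B"
          using message_range[OF \<omega>(1), of "A \<omega>" s] message_range[OF \<omega>(1), of "S \<inter> C \<omega>" s] A[OF \<omega>(1)] C[OF \<omega>(1)] cardA[OF \<omega>(1)]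
          by (auto simp: message_def W_def)
      qed
    qed (use Q j vanish \<phi> finite_Q finite_\<Omega> in \<open>auto simp: short_def answer_def\<close>)
    finally show ?thesis .
  qed
  have "(\<Sum>y\<in>Q. \<Sum>\<omega>\<in>\<Omega>. \<phi> y \<omega> * answer y \<omega>) = (\<Sum>\<omega>\<in>\<Omega>. \<Sum>y\<in>Q. \<phi> y \<omega> * answer y \<omega>)"
    by (rule sum.swap)
  also have "\<dots> = (\<Sum>\<omega>\<in>short. \<Sum>y\<in>Q. \<phi> y \<omega> * answer y \<omega>) + (\<Sum>\<omega>\<in>long. \<Sum>y\<in>Q. \<phi> y \<omega> * answer y \<omega>)"
  proof -
    have "\<Omega> = short \<union> long" "short \<inter> long = {}" by (auto simp: short_def long_def)
    moreover have "finite long" using finite_\<Omega> by (simp add: long_def)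
    ultimately show ?thesis using fs by (simp only: sum.union_disjoint)
  qed
  also have "(\<Sum>\<omega>\<in>short. \<Sum>y\<in>Q. \<phi> y \<omega> * answer y \<omega>)
      = (\<Sum>k\<in>key ` \<Omega>. \<Sum>\<omega>\<in>{\<omega> \<in> short. key \<omega> = k}. \<Sum>y\<in>Q. \<phi> y \<omega> * answer y \<omega>)"
    using fs finite_\<Omega> by (intro sum.group[symmetric]) (auto simp: short_def)
  also have "\<dots> \<le> (\<Sum>k\<in>key ` \<Omega>. real (card {\<omega> \<in> \<Omega>. key \<omega> = k}) * (2 * sqrt (48 * real j * real (card Q))))"
    by (intro sum_mono fiber)
  also have "\<dots> = real (card \<Omega>) * (2 * sqrt (48 * real j * real (card Q)))"
    using sum.image_gen[OF finite_\<Omega>, of "\<lambda>_. 1::real" key] by (simp flip: sum_distrib_right)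
  also have "(\<Sum>\<omega>\<in>long. \<Sum>y\<in>Q. \<phi> y \<omega> * answer y \<omega>) \<le> (\<Sum>\<omega>\<in>long. \<Sum>y\<in>Q. 1)"
  proof (intro sum_mono)
    fix \<omega> y
    have "\<bar>\<phi> y \<omega> * answer y \<omega>\<bar> \<le> 1" using \<phi>(1) by (simp add: abs_mult answer_def)
    then show "\<phi> y \<omega> * answer y \<omega> \<le> 1" by linarith
  qed
  finally show ?thesis by (simp add: long_def mult.commute)
qed

text \<open>The lower and the upper bound on the advantage, averaged over both public sets. The
  public cells of the epoch are at most those in \<open>S\<close> plus those in \<open>S'\<close>,
  so in Markov's inequality the exponential moment factors; the two factors give the exponent
  \<open>2 * c\<close>.\<close>

theorem simulation_bound:
  fixes p :: real and k r I \<kappa> k0 j s c :: nat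
  assumes p: "0 < p" "p \<le> 1" and \<kappa>: "\<kappa> > 0" "(1 / 2) ^ \<kappa> \<le> p ^ k0 / 8"
    and k: "k \<le> 4 ^ I * \<kappa>" and r: "min k (11 * (2 ^ I * \<kappa>)) \<le> r"
    and good: "real (card Q) * real (card \<Omega>) / 2 \<le> (\<Sum>y\<in>Q. real (card {\<omega> \<in> \<Omega>.
      card (probed_cells (prog y) (M \<omega>)) \<le> k \<and>
      card (probed_cells (prog y) (M \<omega>) \<inter> (C \<omega> - A \<omega>)) \<le> k0}))"
    and Q: "Q \<noteq> {}" and \<Omega>: "\<Omega> \<noteq> {}" and j: "j > 0"
    and vanish: "\<And>k T. T \<subseteq> Q \<Longrightarrow> T \<noteq> {} \<Longrightarrow> card T \<le> 2 * j \<Longrightarrow>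
      (\<Sum>\<omega>\<in>{\<omega> \<in> \<Omega>. key \<omega> = k}. \<Prod>y\<in>T. answer y \<omega>) = 0"
    and cardA: "\<And>\<omega>. \<omega> \<in> \<Omega> \<Longrightarrow> card (A \<omega>) \<le> s" and s: "4 * w * s \<le> j" "w > 0"
    and cardC: "\<And>\<omega>. \<omega> \<in> \<Omega> \<Longrightarrow> card (C \<omega>) \<le> c"
  shows "p ^ r * (p ^ k0) ^ 2 / 32 / 2 ^ (45 * (2 ^ I * \<kappa>))
    \<le> 2 * sqrt (48 * real j / real (card Q)) + (1 + p) ^ (2 * c) / 2 ^ s"
proof -
  define q where "q = real (card Q)"
  define N where "N = real (card \<Omega>)"
  have qN: "q > 0" "N > 0" using Q \<Omega> finite_Q finite_\<Omega> by (auto simp: q_def N_def card_gt_0_iff)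
  obtain \<phi> :: "'q \<Rightarrow> nat set \<Rightarrow> nat set \<Rightarrow> 'o \<Rightarrow> real" where \<phi>:
    "\<And>y S S' \<omega>. \<bar>\<phi> y S S' \<omega>\<bar> \<le> 1"
    "\<And>y S S' \<omega> \<omega>'. y \<in> Q \<Longrightarrow> \<omega> \<in> \<Omega> \<Longrightarrow> \<omega>' \<in> \<Omega> \<Longrightarrow> message (S \<union> S') \<omega> = message (S \<union> S') \<omega>' \<Longrightarrow>
       \<phi> y S S' \<omega> = \<phi> y S S' \<omega>'"
    "p ^ r * (p ^ k0) ^ 2 / 32 / 2 ^ (45 * (2 ^ I * \<kappa>)) * (real (card Q) * real (card \<Omega>))
      \<le> (\<Sum>S\<in>Pow U. \<Sum>S'\<in>Pow U. subset_weight p U S * subset_weight p U S' *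
           (\<Sum>y\<in>Q. \<Sum>\<omega>\<in>\<Omega>. \<phi> y S S' \<omega> * answer y \<omega>))"
    by (rule weak_simulation[OF p \<kappa> k r good]) blast
  have wt: "0 \<le> subset_weight p U S" for S using p by (intro subset_weight_nonneg) auto
  have finU: "finite U" by simp
  let ?b = "N * (2 * sqrt (48 * real j * q))"
  have bound: "(\<Sum>y\<in>Q. \<Sum>\<omega>\<in>\<Omega>. \<phi> y S S' \<omega> * answer y \<omega>)
      \<le> ?b + q * (\<Sum>\<omega>\<in>\<Omega>. 2 ^ card (C \<omega> \<inter> S) * 2 ^ card (C \<omega> \<inter> S') / 2 ^ s)" for S S'
  proof -
    have "(\<Sum>y\<in>Q. \<Sum>\<omega>\<in>\<Omega>. \<phi> y S S' \<omega> * answer y \<omega>)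
        \<le> ?b + q * real (card {\<omega> \<in> \<Omega>. card ((S \<union> S') \<inter> C \<omega>) > s})"
      unfolding q_def N_def
      by (rule simulation_upper[OF Q j vanish cardA s, where S = "S \<union> S'" and \<phi> = "\<lambda>y. \<phi> y S S'"])
        (assumption | rule \<phi>(1) \<phi>(2))+
    also have "real (card {\<omega> \<in> \<Omega>. card ((S \<union> S') \<inter> C \<omega>) > s})
        = (\<Sum>\<omega>\<in>\<Omega>. of_bool (card ((S \<union> S') \<inter> C \<omega>) > s))"
      unfolding card_filter_eq_sum[OF finite_\<Omega>] by simp
    also have "\<dots> \<le> (\<Sum>\<omega>\<in>\<Omega>. 2 ^ card (C \<omega> \<inter> S) * 2 ^ card (C \<omega> \<inter> S') / 2 ^ s)"
    proof (rule sum_mono)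
      fix \<omega> assume "\<omega> \<in> \<Omega>"
      have "card ((S \<union> S') \<inter> C \<omega>) \<le> card (C \<omega> \<inter> S) + card (C \<omega> \<inter> S')"
        using card_Un_le[of "C \<omega> \<inter> S" "C \<omega> \<inter> S'"] by (simp add: Int_Un_distrib Int_commute)
      then have "(2::real) ^ s \<le> 2 ^ card (C \<omega> \<inter> S) * 2 ^ card (C \<omega> \<inter> S')" if "card ((S \<union> S') \<inter> C \<omega>) > s"
        using that by (subst power_add[symmetric], intro power_increasing) auto
      then show "of_bool (card ((S \<union> S') \<inter> C \<omega>) > s) \<le> (2 ^ card (C \<omega> \<inter> S) * 2 ^ card (C \<omega> \<inter> S') / 2 ^ s :: real)"
        by auto
    qed
    finally show ?thesis using qN by (simp add: mult_left_mono)
  qed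
  have "p ^ r * (p ^ k0) ^ 2 / 32 / 2 ^ (45 * (2 ^ I * \<kappa>)) * (q * N)
      \<le> (\<Sum>S\<in>Pow U. \<Sum>S'\<in>Pow U. subset_weight p U S * subset_weight p U S' *
           (?b + q * (\<Sum>\<omega>\<in>\<Omega>. 2 ^ card (C \<omega> \<inter> S) * 2 ^ card (C \<omega> \<inter> S') / 2 ^ s)))"
    unfolding q_def[symmetric] N_def[symmetric]
    by (rule order_trans[OF \<phi>(3)[folded q_def N_def]]) (intro sum_mono mult_left_mono bound mult_nonneg_nonneg wt)
  also have "\<dots> = (\<Sum>S\<in>Pow U. \<Sum>S'\<in>Pow U. subset_weight p U S * subset_weight p U S' * ?b)
      + (\<Sum>S\<in>Pow U. \<Sum>S'\<in>Pow U. subset_weight p U S * subset_weight p U S' *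
           (q * (\<Sum>\<omega>\<in>\<Omega>. 2 ^ card (C \<omega> \<inter> S) * 2 ^ card (C \<omega> \<inter> S') / 2 ^ s)))"
    by (simp only: distrib_left sum.distrib)
  also have "(\<Sum>S\<in>Pow U. \<Sum>S'\<in>Pow U. subset_weight p U S * subset_weight p U S' * ?b) = ?b"
    unfolding sum_distrib_right[symmetric] sum_distrib_left[symmetric] sum_subset_weight[OF finU] by simp
  also have "(\<Sum>S\<in>Pow U. \<Sum>S'\<in>Pow U. subset_weight p U S * subset_weight p U S' *
           (q * (\<Sum>\<omega>\<in>\<Omega>. 2 ^ card (C \<omega> \<inter> S) * 2 ^ card (C \<omega> \<inter> S') / 2 ^ s)))
      = (\<Sum>S\<in>Pow U. \<Sum>S'\<in>Pow U. \<Sum>\<omega>\<in>\<Omega>. q / 2 ^ s * ((subset_weight p U S * 2 ^ card (C \<omega> \<inter> S)) *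
           (subset_weight p U S' * 2 ^ card (C \<omega> \<inter> S'))))"
    by (simp add: sum_distrib_left ac_simps)
  also have "\<dots> = (\<Sum>\<omega>\<in>\<Omega>. \<Sum>S\<in>Pow U. \<Sum>S'\<in>Pow U. q / 2 ^ s * ((subset_weight p U S * 2 ^ card (C \<omega> \<inter> S)) *
           (subset_weight p U S' * 2 ^ card (C \<omega> \<inter> S'))))"
    by (subst sum.swap[of _ _ "Pow U"], subst sum.swap[of _ \<Omega>]) (rule refl)
  also have "\<dots> = (\<Sum>\<omega>\<in>\<Omega>. q / 2 ^ s * ((1 + p) ^ card (C \<omega>) * (1 + p) ^ card (C \<omega>)))"
    unfolding sum_distrib_left[symmetric] sum_distrib_right[symmetric]
    by (intro arg_cong2[where f = times] sum.cong refl sum_subset_weight_exp_card[OF finU] C)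
  also have "\<dots> \<le> (\<Sum>\<omega>\<in>\<Omega>. q / 2 ^ s * (1 + p) ^ (2 * c))"
    unfolding power_add[symmetric] using p qN cardC
    by (intro sum_mono mult_left_mono power_increasing) (auto simp: mult_2 add_mono)
  finally have "p ^ r * (p ^ k0) ^ 2 / 32 / 2 ^ (45 * (2 ^ I * \<kappa>)) * (q * N)
      \<le> ?b + N * (q / 2 ^ s * (1 + p) ^ (2 * c))" by (simp add: N_def)
  moreover have "?b = 2 * sqrt (48 * real j / q) * (q * N)"
  proof -
    have "sqrt (48 * real j * q) = sqrt (48 * real j / q * q\<^sup>2)"
      using qN by (simp add: power2_eq_square)
    also have "\<dots> = sqrt (48 * real j / q) * q" using qN by (simp only: real_sqrt_mult) simp
    finally show ?thesis by simp
  qed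
  moreover have "N * (q / 2 ^ s * (1 + p) ^ (2 * c)) = (1 + p) ^ (2 * c) / 2 ^ s * (q * N)"
    by simp
  ultimately have "p ^ r * (p ^ k0) ^ 2 / 32 / 2 ^ (45 * (2 ^ I * \<kappa>)) * (q * N)
      \<le> (2 * sqrt (48 * real j / q) + (1 + p) ^ (2 * c) / 2 ^ s) * (q * N)"
    by (simp only: distrib_right)
  then show ?thesis using qN by (simp only: q_def[symmetric]) (simp only: mult_le_cancel_right_pos mult_pos_pos)
qed

end

section \<open>Polynomial updates\<close>

context field
begin

lemma poly_eval_0 [simp]: "a 0 \<in> carrier R \<Longrightarrow> poly_eval R 0 a y = a 0"
  by (simp add: poly_eval_def)

lemma poly_eval_Suc:
  assumes "\<And>i. a i \<in> carrier R" "y \<in> carrier R"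
  shows "poly_eval R (Suc n) a y = poly_eval R n a y \<oplus> a (Suc n) \<otimes> y [^] Suc n"
proof -
  have "{0..Suc n} = insert (Suc n) {0..n}" by auto
  then show ?thesis
    using assms by (simp add: poly_eval_def a_comm del: nat_pow_Suc)
qed

lemma poly_eval_closed [simp]:
  "(\<And>i. a i \<in> carrier R) \<Longrightarrow> y \<in> carrier R \<Longrightarrow> poly_eval R n a y \<in> carrier R"
  by (auto simp: poly_eval_def intro!: finsum_closed)

lemma ring_identities:
  assumes "p \<in> carrier R" "s \<in> carrier R" "c \<in> carrier R" "a \<in> carrier R" "q \<in> carrier R"
    "z \<in> carrier R" "x \<in> carrier R" "y \<in> carrier R" "t \<in> carrier R"
  shows "p \<oplus> c \<otimes> s \<oplus> (a \<oplus> c \<otimes> q) \<otimes> z = p \<oplus> a \<otimes> z \<oplus> c \<otimes> (s \<oplus> q \<otimes> z)"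
    "(p \<oplus> (q \<ominus> x \<otimes> t) \<otimes> z) \<oplus> t \<otimes> (z \<otimes> y) = (p \<oplus> q \<otimes> z) \<oplus> (y \<ominus> x) \<otimes> (t \<otimes> z)"
    "(a \<oplus> c \<otimes> q) \<oplus> (\<ominus> c) \<otimes> q = a"
    "(y \<oplus> c \<otimes> x \<ominus> y) \<otimes> t = c \<otimes> (x \<otimes> t)"
    "(\<zero> \<ominus> x \<otimes> q) \<oplus> q \<otimes> (\<one> \<otimes> y) = (y \<ominus> x) \<otimes> q"
    "x \<oplus> (z \<ominus> x) = z"
  using assms by algebra+

lemma poly_eval_linear:
  assumes "\<And>i. a i \<in> carrier R" "\<And>i. q i \<in> carrier R" "c \<in> carrier R" "y \<in> carrier R"
  shows "poly_eval R n (\<lambda>i. a i \<oplus> c \<otimes> q i) y = poly_eval R n a y \<oplus> c \<otimes> poly_eval R n q y"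
proof (induction n)
  case 0
  then show ?case using assms by simp
next
  case (Suc n)
  have "poly_eval R n a y \<in> carrier R" "poly_eval R n q y \<in> carrier R"
    "a (Suc n) \<in> carrier R" "q (Suc n) \<in> carrier R" "y [^] Suc n \<in> carrier R"
    using assms by auto
  from ring_identities(1)[OF this(1,2) assms(3) this(3,4,5) assms(3,3,3)] Suc assms show ?case
    by (simp only: poly_eval_Suc a_closed m_closed)
qed

text \<open>\<open>q'\<close> consists of the coefficients up to \<open>n\<close> of
  \<open>q\<close> times the linear factor with root \<open>x\<close>. The extra term is the one
  leading coefficient cut off, which is zero if \<open>q\<close> has degree below
  \<open>n\<close>.\<close>

lemma poly_eval_mult_linear:
  assumes q: "\<And>i. q i \<in> carrier R" and xy: "x \<in> carrier R" "y \<in> carrier R"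
  defines "q' \<equiv> \<lambda>i. (case i of 0 \<Rightarrow> \<zero> | Suc j \<Rightarrow> q j) \<ominus> x \<otimes> q i"
  shows "poly_eval R n q' y \<oplus> q n \<otimes> y [^] Suc n = (y \<ominus> x) \<otimes> poly_eval R n q y"
proof (induction n)
  case 0
  have "q' 0 = \<zero> \<ominus> x \<otimes> q 0" "q' 0 \<in> carrier R" using q xy by (simp_all add: q'_def)
  then show ?case
    using ring_identities(5)[OF q q q q q q xy q] q
    by (simp only: poly_eval_0 nat_pow_Suc nat_pow_0)
next
  case (Suc n)
  have q': "q' i \<in> carrier R" for i using q xy by (simp add: q'_def split: nat.split)
  have cl: "poly_eval R n q' y \<in> carrier R" "poly_eval R n q y \<in> carrier R"
    "q n \<in> carrier R" "q (Suc n) \<in> carrier R" "y [^] Suc n \<in> carrier R"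
    using q q' xy by auto
  have "poly_eval R (Suc n) q' y \<oplus> q (Suc n) \<otimes> y [^] Suc (Suc n)
      = (poly_eval R n q' y \<oplus> (q n \<ominus> x \<otimes> q (Suc n)) \<otimes> y [^] Suc n) \<oplus> q (Suc n) \<otimes> (y [^] Suc n \<otimes> y)"
    using q q' xy by (subst poly_eval_Suc) (auto simp: q'_def)
  also have "\<dots> = (poly_eval R n q' y \<oplus> q n \<otimes> y [^] Suc n) \<oplus> (y \<ominus> x) \<otimes> (q (Suc n) \<otimes> y [^] Suc n)"
    by (rule ring_identities(2)[OF cl(1,1,1,1,3,5) xy cl(4)])
  also have "\<dots> = (y \<ominus> x) \<otimes> poly_eval R n q y \<oplus> (y \<ominus> x) \<otimes> (q (Suc n) \<otimes> y [^] Suc n)"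
    by (simp only: Suc)
  also have "\<dots> = (y \<ominus> x) \<otimes> poly_eval R (Suc n) q y"
    using cl xy q by (simp only: poly_eval_Suc r_distr m_closed minus_closed)
  finally show ?case .
qed

text \<open>The product of the linear factors of the points of \<open>T\<close>. Both directions of
  the equivalence matter: adding a multiple of it keeps the values on \<open>T\<close> and really
  changes the value at any other point.\<close>

lemma vanishing_polynomial:
  assumes "finite T" "T \<subseteq> carrier R" "card T \<le> n"
  shows "\<exists>q. (\<forall>i. q i \<in> carrier R) \<and> (\<forall>i > card T. q i = \<zero>) \<and>
    (\<forall>y \<in> carrier R. poly_eval R n q y = \<zero> \<longleftrightarrow> y \<in> T)"
  using assms
proof (induction T rule: finite_induct)
  case empty
  have "poly_eval R n (\<lambda>i. if i = 0 then \<one> else \<zero>) y = \<one>" if "y \<in> carrier R" for y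
  proof (induction n)
    case (Suc n)
    with that show ?case by (subst poly_eval_Suc) (auto simp del: nat_pow_Suc)
  qed simp
  then show ?case by (intro exI[of _ "\<lambda>i. if i = 0 then \<one> else \<zero>"]) auto
next
  case (insert x T)
  then have T: "card T < n" "x \<in> carrier R" by auto
  have "\<exists>q. (\<forall>i. q i \<in> carrier R) \<and> (\<forall>i > card T. q i = \<zero>) \<and>
    (\<forall>y \<in> carrier R. poly_eval R n q y = \<zero> \<longleftrightarrow> y \<in> T)"
    by (rule insert.IH) (use insert.prems T in auto)
  then obtain q where q: "\<And>i. q i \<in> carrier R" "\<And>i. i > card T \<Longrightarrow> q i = \<zero>"
    "\<And>y. y \<in> carrier R \<Longrightarrow> poly_eval R n q y = \<zero> \<longleftrightarrow> y \<in> T" by blast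
  define q' where "q' = (\<lambda>i. (case i of 0 \<Rightarrow> \<zero> | Suc j \<Rightarrow> q j) \<ominus> x \<otimes> q i)"
  have q': "q' i \<in> carrier R" for i using q T by (simp add: q'_def split: nat.split)
  have "q' i = \<zero>" if "i > card (insert x T)" for i
    using that insert.hyps T q(2)[of i] q(2)[of "i - 1"]
    by (cases i) (auto simp: q'_def a_minus_def)
  moreover have "poly_eval R n q' y = \<zero> \<longleftrightarrow> y \<in> insert x T" if y: "y \<in> carrier R" for y
  proof -
    have "poly_eval R n q' y = (y \<ominus> x) \<otimes> poly_eval R n q y"
      using poly_eval_mult_linear[of q x y n] q q' T y by (simp add: q'_def)
    moreover have "y \<ominus> x = \<zero> \<longleftrightarrow> y = x"
      using ring_identities(6)[OF y y y y y y T(2) y y] y T by (auto simp: minus_eq r_neg)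
    ultimately show ?thesis using integral_iff[of "y \<ominus> x" "poly_eval R n q y"] q y T by auto
  qed
  ultimately show ?case using q' by blast
qed

lemma bij_affine:
  assumes "v \<in> carrier R" "e \<in> carrier R" "e \<noteq> \<zero>"
  shows "bij_betw (\<lambda>c. v \<oplus> c \<otimes> e) (carrier R) (carrier R)"
proof (rule bij_betwI[where g = "\<lambda>z. (z \<ominus> v) \<otimes> inv e"])
  have e: "inv e \<in> carrier R" "e \<otimes> inv e = \<one>" "inv e \<otimes> e = \<one>"
    using assms by (auto simp: field_Units)
  show "(\<lambda>c. v \<oplus> c \<otimes> e) \<in> carrier R \<rightarrow> carrier R" using assms by auto
  show "(\<lambda>z. (z \<ominus> v) \<otimes> inv e) \<in> carrier R \<rightarrow> carrier R" using assms e by auto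
  show "(v \<oplus> c \<otimes> e \<ominus> v) \<otimes> inv e = c" if c: "c \<in> carrier R" for c
  proof -
    have "(v \<oplus> c \<otimes> e \<ominus> v) \<otimes> inv e = c \<otimes> (e \<otimes> inv e)"
      by (rule ring_identities(4)[OF assms(1,1) c assms(1,1,1) assms(2,1) e(1)])
    then show ?thesis using c e by simp
  qed
  show "v \<oplus> (z \<ominus> v) \<otimes> inv e \<otimes> e = z" if z: "z \<in> carrier R" for z
  proof -
    have "v \<oplus> (z \<ominus> v) \<otimes> inv e \<otimes> e = v \<oplus> (z \<ominus> v) \<otimes> (inv e \<otimes> e)" using assms e(1) z by (simp add: m_assoc)
    also have "\<dots> = z" using ring_identities(6)[OF z z z z z z assms(1) z z] assms z e by simp
    finally show ?thesis .
  qed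
qed

end

lemma sum_sign_last: "d > 0 \<Longrightarrow> (\<Sum>bs\<in>{bs :: bool list. length bs = d}. sign (last bs)) = 0"
proof -
  assume d: "d > 0"
  let ?S = "\<Sum>bs\<in>{bs :: bool list. length bs = d}. sign (last bs)"
  have "?S = (\<Sum>bs\<in>{bs :: bool list. length bs = d}. - sign (last bs))"
    by (rule sum.reindex_bij_witness[of _ "\<lambda>bs. butlast bs @ [\<not> last bs]" "\<lambda>bs. butlast bs @ [\<not> last bs]"])
      (use d in \<open>auto simp: sign_def append_butlast_last_id\<close>)
  then show "?S = 0" by (simp add: sum_negf)
qed

lemma sum_sign_least_bit:
  assumes "bit_encoding F d enc" "d > 0"
  shows "(\<Sum>x\<in>carrier F. sign (least_bit enc x)) = 0"
  using sum.reindex_bij_betw[of enc "carrier F" "{bs. length bs = d}" "\<lambda>bs. sign (last bs)"]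
    sum_sign_last[OF assms(2)] assms(1)
  by (simp add: bit_encoding_def least_bit_def)

section \<open>Blocks of updates and the independence of the answers\<close>

definition add_update :: "('a, 'm) ring_scheme \<Rightarrow> nat \<times> 'a \<Rightarrow> (nat \<Rightarrow> 'a) \<Rightarrow> nat \<Rightarrow> 'a" where
  "add_update F u a = a(fst u := a (fst u) \<oplus>\<^bsub>F\<^esub> snd u)"

lemma coeffs_after_fold: "coeffs_after F us = fold (add_update F) us (\<lambda>i. \<zero>\<^bsub>F\<^esub>)"
proof -
  have "(\<lambda>(i, b) a. a(i := a i \<oplus>\<^bsub>F\<^esub> b)) = add_update F"
    by (auto simp: fun_eq_iff add_update_def)
  then show ?thesis by (simp add: coeffs_after_def)
qed

definition block :: "nat \<Rightarrow> (nat \<Rightarrow> 'a) \<Rightarrow> (nat \<times> 'a) list" where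
  "block m b = map (\<lambda>j. (j, b j)) [0..<m]"

lemma length_block [simp]: "length (block m b) = m"
  by (simp add: block_def)

context ring
begin

lemma fold_add_update_closed:
  assumes "\<And>i. a i \<in> carrier R" "snd ` set us \<subseteq> carrier R"
  shows "fold (add_update R) us a i \<in> carrier R"
  using assms
proof (induction us arbitrary: a)
  case (Cons u us)
  have "fold (add_update R) us (add_update R u a) i \<in> carrier R"
    by (rule Cons.IH) (use Cons.prems in \<open>auto simp: add_update_def\<close>)
  then show ?case by simp
qed simp

lemma fold_add_update_add:
  assumes "\<And>i. a i \<in> carrier R" "\<And>i. b i \<in> carrier R" "snd ` set us \<subseteq> carrier R"
  shows "fold (add_update R) us (\<lambda>i. a i \<oplus> b i) = (\<lambda>i. fold (add_update R) us a i \<oplus> b i)"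
  using assms
proof (induction us arbitrary: a)
  case (Cons u us)
  have "add_update R u (\<lambda>i. a i \<oplus> b i) = (\<lambda>i. add_update R u a i \<oplus> b i)"
    using Cons.prems by (auto simp: add_update_def fun_eq_iff a_ac)
  moreover have "fold (add_update R) us (\<lambda>i. add_update R u a i \<oplus> b i)
      = (\<lambda>i. fold (add_update R) us (add_update R u a) i \<oplus> b i)"
    by (rule Cons.IH) (use Cons.prems in \<open>auto simp: add_update_def\<close>)
  ultimately show ?case by simp
qed simp

lemma fold_add_update_block:
  assumes "\<And>i. a i \<in> carrier R" "\<And>i. i < m \<Longrightarrow> b i \<in> carrier R"
  shows "fold (add_update R) (block m b) a = (\<lambda>i. a i \<oplus> (if i < m then b i else \<zero>))"
  using assms
proof (induction m)
  case (Suc m)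
  then show ?case by (auto simp: block_def add_update_def fun_eq_iff)
qed (simp add: block_def)

text \<open>Updates are additions, so a shift of one block passes unchanged through all later
  updates.\<close>

lemma coeffs_after_shift_block:
  assumes "snd ` set xs \<subseteq> carrier R" "snd ` set ys \<subseteq> carrier R"
    "\<And>i. i < m \<Longrightarrow> b i \<in> carrier R" "\<And>i. q i \<in> carrier R" "\<And>i. i \<ge> m \<Longrightarrow> q i = \<zero>"
    "\<And>i. i < m \<Longrightarrow> b' i = b i \<oplus> q i"
  shows "coeffs_after R (xs @ block m b' @ ys) = (\<lambda>i. coeffs_after R (xs @ block m b @ ys) i \<oplus> q i)"
proof -
  define a where "a = fold (add_update R) xs (\<lambda>i. \<zero>)"
  have a: "a i \<in> carrier R" for i unfolding a_def by (rule fold_add_update_closed) (use assms in auto)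
  have b': "b' i \<in> carrier R" if "i < m" for i using assms that by auto
  have "fold (add_update R) (block m b') a = (\<lambda>i. fold (add_update R) (block m b) a i \<oplus> q i)"
    using a assms by (auto simp: fold_add_update_block[OF a b'] fold_add_update_block[OF a assms(3)] fun_eq_iff a_ac)
  then show ?thesis
    unfolding coeffs_after_fold fold_append o_apply a_def[symmetric]
    using a assms by (simp only:) (rule fold_add_update_add, auto simp: fold_add_update_block)
qed

lemma coeffs_after_closed: "snd ` set us \<subseteq> carrier R \<Longrightarrow> coeffs_after R us i \<in> carrier R"
  unfolding coeffs_after_fold by (rule fold_add_update_closed) auto

end

text \<open>The hard distribution: blocks of random updates, in order of decreasing block index, where block
  \<open>e\<close> adds a random polynomial of degree less than \<open>sz e\<close>.\<close>

definition block_space :: "('a, 'm) ring_scheme \<Rightarrow> nat \<Rightarrow> (nat \<Rightarrow> nat) \<Rightarrow> (nat \<Rightarrow> nat \<Rightarrow> 'a) set" where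
  "block_space F m sz = PiE {..<m} (\<lambda>e. PiE {..<sz e} (\<lambda>_. carrier F))"

definition blocks :: "(nat \<Rightarrow> nat) \<Rightarrow> nat \<Rightarrow> nat \<Rightarrow> (nat \<Rightarrow> nat \<Rightarrow> 'a) \<Rightarrow> (nat \<times> 'a) list" where
  "blocks sz lo hi \<theta> = concat (map (\<lambda>e. block (sz e) (\<theta> e)) (rev [lo..<hi]))"

lemma blocks_split:
  assumes "lo \<le> e" "e < hi"
  shows "blocks sz lo hi \<theta> = blocks sz (Suc e) hi \<theta> @ block (sz e) (\<theta> e) @ blocks sz lo e \<theta>"
proof -
  have "[lo..<hi] = [lo..<e] @ e # [Suc e..<hi]"
    using assms upt_add_eq_append[of lo e "hi - e"] by (simp add: upt_conv_Cons)
  then show ?thesis by (simp add: blocks_def)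
qed

lemma blocks_cong: "(\<And>e. lo \<le> e \<Longrightarrow> e < hi \<Longrightarrow> \<theta> e = \<theta>' e) \<Longrightarrow> blocks sz lo hi \<theta> = blocks sz lo hi \<theta>'"
  unfolding blocks_def by (intro arg_cong[where f = concat] map_cong) auto

lemma length_blocks: "length (blocks sz lo hi \<theta>) = (\<Sum>e\<in>{lo..<hi}. sz e)"
  by (induction hi) (auto simp: blocks_def sum_list_rev)

lemma blocks_in_updates:
  assumes "\<theta> \<in> block_space F m sz" "hi \<le> m" "\<And>e. e < m \<Longrightarrow> sz e \<le> Suc n"
  shows "blocks sz lo hi \<theta> \<in> lists (updates F n)"
proof -
  have "u \<in> updates F n" if "u \<in> set (blocks sz lo hi \<theta>)" for u
  proof -
    from that obtain e j where u: "u = (j, \<theta> e j)" "e < hi" "j < sz e"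
      by (auto simp: blocks_def block_def)
    then have "j \<le> n" "\<theta> e j \<in> carrier F"
      using assms(1,2) assms(3)[of e] by (auto simp: block_space_def PiE_iff)
    with u show ?thesis by (simp add: updates_def)
  qed
  then show ?thesis by auto
qed

lemma updates_snd: "us \<in> lists (updates F n) \<Longrightarrow> snd ` set us \<subseteq> carrier F"
  by (auto simp: updates_def)

text \<open>Single out \<open>y0\<close> in \<open>T\<close> and add to block \<open>e\<close> a
  multiple \<open>c\<close> of a polynomial vanishing on the other points of \<open>T\<close> but
  not at \<open>y0\<close>. This permutes the outcomes with the given other blocks, keeps all other
  answers, and as \<open>c\<close> varies moves the value at \<open>y0\<close> through the whole
  field, where the signs cancel.\<close>

lemma block_signs_independent:
  fixes F :: "('a, 'm) ring_scheme"
  assumes F: "field F" "finite (carrier F)" and enc: "bit_encoding F d enc" "d > 0"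
    and e: "e < m" and sz: "\<And>e. e < m \<Longrightarrow> sz e \<le> Suc n"
    and T: "T \<subseteq> carrier F" "T \<noteq> {}" "card T \<le> sz e"
  shows "(\<Sum>\<theta>\<in>{\<theta> \<in> block_space F m sz. \<theta>(e := undefined) = k}.
    \<Prod>y\<in>T. sign (least_bit enc (poly_eval F n (coeffs_after F (blocks sz 0 m \<theta>)) y))) = 0"
proof -
  interpret field F by (rule F(1))
  let ?\<Omega> = "{\<theta> \<in> block_space F m sz. \<theta>(e := undefined) = k}"
  define P where "P \<theta> y = poly_eval F n (coeffs_after F (blocks sz 0 m \<theta>)) y" for \<theta> y
  define g where "g \<theta> y = sign (least_bit enc (P \<theta> y))" for \<theta> y
  from T obtain y0 where y0: "y0 \<in> T" by blast
  have finT: "finite T" using T F finite_subset by blast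
  \<comment> \<open>Without \<open>y0\<close> the degree is below \<open>sz e\<close>, so the
    polynomial fits into block \<open>e\<close>, and at most \<open>n\<close>, so evaluation does
    not cut it off.\<close>
  then have cT: "card (T - {y0}) < sz e" "card (T - {y0}) \<le> n"
    using T(3) y0 sz[OF e] card_Diff1_less[OF finT y0] by linarith+
  obtain q where q: "\<And>i. q i \<in> carrier F" "\<And>i. i > card (T - {y0}) \<Longrightarrow> q i = \<zero>\<^bsub>F\<^esub>"
    "\<And>y. y \<in> carrier F \<Longrightarrow> poly_eval F n q y = \<zero>\<^bsub>F\<^esub> \<longleftrightarrow> y \<in> T - {y0}"
    using vanishing_polynomial[OF finite_Diff[OF finT] _ cT(2)] T(1) by blast
  define sh where "sh c \<theta> = \<theta>(e := \<lambda>j. if j < sz e then \<theta> e j \<oplus>\<^bsub>F\<^esub> c \<otimes>\<^bsub>F\<^esub> q j else undefined)" for c \<theta>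
  have in_space: "\<theta> e j \<in> carrier F" if "\<theta> \<in> block_space F m sz" "j < sz e" for \<theta> j
    using that e by (auto simp: block_space_def PiE_iff)
  have sh_in: "sh c \<theta> \<in> ?\<Omega>" if "\<theta> \<in> ?\<Omega>" "c \<in> carrier F" for c \<theta>
    using that e q(1) in_space[of \<theta>]
    by (auto simp: sh_def block_space_def PiE_iff extensional_def fun_upd_def)
  have sh_inv: "sh (\<ominus>\<^bsub>F\<^esub> c) (sh c \<theta>) = \<theta>" if \<theta>: "\<theta> \<in> ?\<Omega>" and c: "c \<in> carrier F" for c \<theta>
  proof -
    have "\<theta> e j = undefined" if "\<not> j < sz e" for j
      using \<theta> e that by (auto simp: block_space_def PiE_iff extensional_def)
    moreover have "(\<theta> e j \<oplus>\<^bsub>F\<^esub> c \<otimes>\<^bsub>F\<^esub> q j) \<oplus>\<^bsub>F\<^esub> (\<ominus>\<^bsub>F\<^esub> c) \<otimes>\<^bsub>F\<^esub> q j = \<theta> e j" if "j < sz e" for j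
    proof -
      have "\<theta> e j \<in> carrier F" "q j \<in> carrier F" using in_space \<theta> that q by auto
      then show ?thesis by (intro ring_identities(3)[OF c c c _ _ c c c c])
    qed
    ultimately show ?thesis by (auto simp: sh_def fun_eq_iff)
  qed
  have P_sh: "P (sh c \<theta>) y = P \<theta> y \<oplus>\<^bsub>F\<^esub> c \<otimes>\<^bsub>F\<^esub> poly_eval F n q y"
    if \<theta>: "\<theta> \<in> ?\<Omega>" and c: "c \<in> carrier F" and y: "y \<in> carrier F" for c \<theta> y
  proof -
    have \<theta>s: "\<theta> \<in> block_space F m sz" using \<theta> by simp
    note up = updates_snd[OF blocks_in_updates[OF \<theta>s _ sz]]
    have split: "blocks sz 0 m \<theta>' = blocks sz (Suc e) m \<theta> @ block (sz e) (\<theta>' e) @ blocks sz 0 e \<theta>"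
      if "\<And>e'. e' \<noteq> e \<Longrightarrow> \<theta>' e' = \<theta> e'" for \<theta>'
      using blocks_split[of 0 e m sz \<theta>'] e
        blocks_cong[of "Suc e" m \<theta>' \<theta> sz] blocks_cong[of 0 e \<theta>' \<theta> sz] that by simp
    have "coeffs_after F (blocks sz 0 m (sh c \<theta>)) = (\<lambda>i. coeffs_after F (blocks sz 0 m \<theta>) i \<oplus>\<^bsub>F\<^esub> c \<otimes>\<^bsub>F\<^esub> q i)"
      unfolding split[of \<theta>, OF refl] split[of "sh c \<theta>", unfolded sh_def, simplified, folded sh_def]
    proof (rule coeffs_after_shift_block)
      show "snd ` set (blocks sz (Suc e) m \<theta>) \<subseteq> carrier F" by (rule up) auto
      show "snd ` set (blocks sz 0 e \<theta>) \<subseteq> carrier F" by (rule up) (use e in auto)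
    qed (use in_space[OF \<theta>s] q c cT in \<open>auto simp: sh_def\<close>)
    moreover have "coeffs_after F (blocks sz 0 m \<theta>) i \<in> carrier F" for i
      by (rule coeffs_after_closed, rule up) auto
    ultimately show ?thesis
      unfolding P_def using q(1) c y by (simp add: poly_eval_linear)
  qed
  have P_closed: "P \<theta> y \<in> carrier F" if "\<theta> \<in> ?\<Omega>" "y \<in> carrier F" for \<theta> y
  proof -
    have "\<theta> \<in> block_space F m sz" using that by simp
    then show ?thesis
      unfolding P_def
      by (intro poly_eval_closed coeffs_after_closed that updates_snd[OF blocks_in_updates[OF _ _ sz]]) auto
  qed
  have shifted: "(\<Sum>\<theta>\<in>?\<Omega>. \<Prod>y\<in>T. g \<theta> y) = (\<Sum>\<theta>\<in>?\<Omega>. \<Prod>y\<in>T. g (sh c \<theta>) y)" if c: "c \<in> carrier F" for c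
  proof (rule sum.reindex_bij_witness[of _ "sh c" "sh (\<ominus>\<^bsub>F\<^esub> c)"])
    fix \<theta> assume \<theta>: "\<theta> \<in> ?\<Omega>"
    show "sh c (sh (\<ominus>\<^bsub>F\<^esub> c) \<theta>) = \<theta>" using sh_inv[OF \<theta>, of "\<ominus>\<^bsub>F\<^esub> c"] c by simp
    then show "(\<Prod>y\<in>T. g (sh c (sh (\<ominus>\<^bsub>F\<^esub> c) \<theta>)) y) = (\<Prod>y\<in>T. g \<theta> y)" by simp
    show "sh (\<ominus>\<^bsub>F\<^esub> c) \<theta> \<in> ?\<Omega>" using sh_in[OF \<theta>] c by simp
    show "sh (\<ominus>\<^bsub>F\<^esub> c) (sh c \<theta>) = \<theta>" by (rule sh_inv[OF \<theta> c])
    show "sh c \<theta> \<in> ?\<Omega>" by (rule sh_in[OF \<theta> c])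
  qed
  have "real (card (carrier F)) * (\<Sum>\<theta>\<in>?\<Omega>. \<Prod>y\<in>T. g \<theta> y) = (\<Sum>c\<in>carrier F. \<Sum>\<theta>\<in>?\<Omega>. \<Prod>y\<in>T. g \<theta> y)" by simp
  also have "\<dots> = (\<Sum>c\<in>carrier F. \<Sum>\<theta>\<in>?\<Omega>. \<Prod>y\<in>T. g (sh c \<theta>) y)"
    by (intro sum.cong refl shifted)
  also have "\<dots> = (\<Sum>\<theta>\<in>?\<Omega>. \<Sum>c\<in>carrier F. \<Prod>y\<in>T. g (sh c \<theta>) y)"
    by (rule sum.swap)
  also have "\<dots> = (\<Sum>\<theta>\<in>?\<Omega>. 0)"
  proof (rule sum.cong[OF refl])
    fix \<theta> assume \<theta>: "\<theta> \<in> ?\<Omega>"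
    have y0c: "y0 \<in> carrier F" using y0 T by auto
    have "(\<Prod>y\<in>T. g (sh c \<theta>) y) = sign (least_bit enc (P \<theta> y0 \<oplus>\<^bsub>F\<^esub> c \<otimes>\<^bsub>F\<^esub> poly_eval F n q y0)) * (\<Prod>y\<in>T - {y0}. g \<theta> y)"
      if c: "c \<in> carrier F" for c
    proof -
      have "g (sh c \<theta>) y = g \<theta> y" if "y \<in> T - {y0}" for y
      proof -
        have "y \<in> carrier F" "poly_eval F n q y = \<zero>\<^bsub>F\<^esub>" using that T q(3) by auto
        then show ?thesis using P_sh[OF \<theta> c] P_closed[OF \<theta>] c by (simp add: g_def)
      qed
      then have "(\<Prod>y\<in>T - {y0}. g (sh c \<theta>) y) = (\<Prod>y\<in>T - {y0}. g \<theta> y)" by (rule prod.cong[OF refl])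
      then show ?thesis
        using prod.remove[OF finT y0, of "g (sh c \<theta>)"] P_sh[OF \<theta> c y0c] by (simp add: g_def)
    qed
    then have "(\<Sum>c\<in>carrier F. \<Prod>y\<in>T. g (sh c \<theta>) y)
        = (\<Sum>c\<in>carrier F. sign (least_bit enc (P \<theta> y0 \<oplus>\<^bsub>F\<^esub> c \<otimes>\<^bsub>F\<^esub> poly_eval F n q y0))) * (\<Prod>y\<in>T - {y0}. g \<theta> y)"
      by (simp add: sum_distrib_right)
    also have "(\<Sum>c\<in>carrier F. sign (least_bit enc (P \<theta> y0 \<oplus>\<^bsub>F\<^esub> c \<otimes>\<^bsub>F\<^esub> poly_eval F n q y0)))
        = (\<Sum>x\<in>carrier F. sign (least_bit enc x))"
      using q(3)[OF y0c] y0c q(1) P_closed[OF \<theta> y0c]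
      by (intro sum.reindex_bij_betw bij_affine) auto
    also have "\<dots> = 0" by (rule sum_sign_least_bit[OF enc])
    finally show "(\<Sum>c\<in>carrier F. \<Prod>y\<in>T. g (sh c \<theta>) y) = 0" by simp
  qed
  finally have "(\<Sum>\<theta>\<in>?\<Omega>. \<Prod>y\<in>T. g \<theta> y) = 0"
    using F(2) by (auto simp: card_eq_0_iff)
  then show ?thesis by (simp add: g_def P_def)
qed

section \<open>The communication bound for a deterministic data structure\<close>

lemma run_bounded_initial:
  assumes "has_cell_size F n w D" "us \<in> lists (updates F n)"
  shows "bounded_memory w (memory_after D us)"
proof -
  have "bounded_memory w (initial_memory D)"
    using assms(1) by (simp add: has_cell_size_def bounded_memory_def)
  then show ?thesis using run_bounded[OF assms] by (simp add: memory_after_run)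
qed

lemma probes_le:
  assumes "has_cell_size F n w D" "us \<in> lists (updates F n)" "y \<in> carrier F"
  shows "probed_cells (query_prog D y) (memory_after D us) \<subseteq> {..<2 ^ w}"
    "probes (query_prog D y) (memory_after D us) \<le> 2 ^ w"
proof -
  have "valid_prog w (query_prog D y)" using assms by (simp add: has_cell_size_def)
  then show *: "probed_cells (query_prog D y) (memory_after D us) \<subseteq> {..<2 ^ w}"
    using valid_prog_bounded run_bounded_initial[OF assms(1,2)] by blast
  show "probes (query_prog D y) (memory_after D us) \<le> 2 ^ w"
    using card_mono[OF _ *] by (simp add: probes_def)
qed

lemma no_probe_constant: "probed_cells p m = {} \<Longrightarrow> result p m = result p m'"
  using result_cong_probed_cells[of p m m'] by blast

context field
begin

lemma poly_eval_const:
  assumes "b \<in> carrier R" "y \<in> carrier R"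
  shows "poly_eval R n (\<lambda>i. if i = 0 then b else \<zero>) y = b"
proof (induction n)
  case 0
  then show ?case using assms by simp
next
  case (Suc n)
  with assms show ?case by (subst poly_eval_Suc) (auto simp del: nat_pow_Suc)
qed

end

text \<open>Without a probe the answer would be the same for all constant polynomials, but the least
  bit is balanced. Together with small constants, the resulting bound of 1 on the query time settles
  the degenerate ranges of the parameters.\<close>

lemma query_probes_pos:
  assumes F: "field F" "finite (carrier F)" and enc: "bit_encoding F d enc" "d > 0"
    and D: "solves_least_bit_poly_eval F enc n D" and y: "y \<in> carrier F"
    and us: "us \<in> lists (updates F n)"
  shows "probes (query_prog D y) (memory_after D us) \<ge> 1"
proof (rule ccontr)
  interpret field F by (rule F(1))
  assume "\<not> ?thesis"
  then have "probed_cells (query_prog D y) (memory_after D us) = {}"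
    using finite_probed_cells[of "query_prog D y" "memory_after D us"] by (auto simp: probes_def Suc_le_eq card_gt_0_iff)
  then have const: "result (query_prog D y) m = result (query_prog D y) (memory_after D us)" for m
    by (metis no_probe_constant)
  define v where "v = result (query_prog D y) (memory_after D us)"
  have "least_bit enc b = v" if b: "b \<in> carrier F" for b
  proof -
    have "coeffs_after F [(0, b)] = (\<lambda>i. if i = 0 then b else \<zero>\<^bsub>F\<^esub>)"
      using b by (auto simp: coeffs_after_def fun_eq_iff)
    moreover have "[(0, b)] \<in> lists (updates F n)" using b by (simp add: updates_def)
    ultimately show ?thesis
      using D y b poly_eval_const[OF b y] const[of "memory_after D [(0, b)]"]
      unfolding solves_least_bit_poly_eval_def v_def by metis
  qed
  then have "(\<Sum>x\<in>carrier F. sign (least_bit enc x)) = real (card (carrier F)) * sign v" by simp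
  then have "real (card (carrier F)) * sign v = 0" using sum_sign_least_bit[OF enc] by simp
  then show False using F(2) by (auto simp: sign_def card_eq_0_iff split: if_splits)
qed

text \<open>The sets \<open>C e - A e\<close> of cells last touched in epoch \<open>e\<close> are
  disjoint, so some epoch gets at most the average share, \<open>t / m\<close>, of the probes. The
  communication bounds are applied to that epoch.\<close>

lemma deterministic_bound:
  fixes F :: "('a, 'b) ring_scheme" and D :: "'a data_structure" and t p :: real
  assumes F: "field F" "finite (carrier F)" and enc: "bit_encoding F d enc" "d > 0"
    and D: "has_cell_size F n w D" "solves_least_bit_poly_eval F enc n D"
      "worst_case_update_time F n t\<^sub>u D"
    and q: "q = t\<^sub>u * w" "q > 0" and m: "m > 0" and B: "B > 0" "B * (16 * q) ^ m \<le> Suc n"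
  defines "sz \<equiv> \<lambda>e. B * (16 * q) ^ Suc e"
  assumes t: "t > 0" "(\<Sum>y\<in>carrier F. \<Sum>\<theta>\<in>block_space F m sz.
      real (probes (query_prog D y) (memory_after D (blocks sz 0 m \<theta>))))
        \<le> t * (real (card (carrier F)) * real (card (block_space F m sz)))"
    and p: "0 < p" "p \<le> 1" and \<kappa>: "\<kappa> > 0" "(1 / 2) ^ \<kappa> \<le> p ^ k0 / 8"
    and k: "k \<le> 4 ^ I * \<kappa>" and r: "min k (11 * (2 ^ I * \<kappa>)) \<le> r"
    and k_t: "4 * t \<le> real k + 1" "4 * t / real m \<le> real k0 + 1"
  shows "\<exists>e < m. p ^ r * (p ^ k0) ^ 2 / 32 / 2 ^ (45 * (2 ^ I * \<kappa>))
    \<le> 2 * sqrt (24 * real (sz e) / real (card (carrier F)))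
      + (1 + p) ^ (2 * (t\<^sub>u * sz e)) / 2 ^ (2 * (t\<^sub>u * (B * (16 * q) ^ e)))"
proof -
  interpret field F by (rule F(1))
  define \<beta> where "\<beta> = 16 * q"
  define \<Omega> where "\<Omega> = block_space F m sz"
  define M where "M \<theta> = memory_after D (blocks sz 0 m \<theta>)" for \<theta>
  define pre where "pre e \<theta> = memory_after D (blocks sz (Suc e) m \<theta>)" for e \<theta>
  define C where "C e \<theta> = touched D (pre e \<theta>) (block (sz e) (\<theta> e))" for e \<theta>
  define A where "A e \<theta> = touched D (run D (pre e \<theta>) (block (sz e) (\<theta> e))) (blocks sz 0 e \<theta>)" for e \<theta>
  define K where "K y \<theta> = probed_cells (query_prog D y) (M \<theta>)" for y \<theta>
  define Z where "Z = real (card (carrier F)) * real (card \<Omega>)"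
  have sz: "sz e \<le> Suc n" if "e < m" for e
  proof -
    have "\<beta> ^ Suc e \<le> \<beta> ^ m" using that q by (intro power_increasing) (auto simp: \<beta>_def)
    then have "B * \<beta> ^ Suc e \<le> B * \<beta> ^ m" by simp
    also have "\<dots> \<le> Suc n" using B(2) by (simp only: \<beta>_def)
    finally show ?thesis by (simp only: sz_def \<beta>_def)
  qed
  have fin\<Omega>: "finite \<Omega>" using F(2) by (auto simp: \<Omega>_def block_space_def intro!: finite_PiE)
  have ne\<Omega>: "\<Omega> \<noteq> {}" using zero_closed by (auto simp: \<Omega>_def block_space_def PiE_eq_empty_iff)
  have neF: "carrier F \<noteq> {}" using zero_closed by blast
  have Z: "Z > 0" using fin\<Omega> ne\<Omega> F(2) neF by (simp add: Z_def card_gt_0_iff)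
  have finK: "finite (K y \<theta>)" for y \<theta> by (simp add: K_def finite_probed_cells)
  have lists: "blocks sz lo hi \<theta> \<in> lists (updates F n)" if "\<theta> \<in> \<Omega>" "hi \<le> m" for lo hi \<theta>
    using blocks_in_updates[OF _ that(2) sz] that(1) by (simp add: \<Omega>_def)
  have split: "blocks sz lo hi \<theta> = blocks sz (Suc e) hi \<theta> @ block (sz e) (\<theta> e) @ blocks sz lo e \<theta>"
    if "lo \<le> e" "e < hi" for lo e hi \<theta> by (rule blocks_split[OF that])
  have blk: "block (sz e) (\<theta> e) \<in> lists (updates F n)" if "\<theta> \<in> \<Omega>" "e < m" for e \<theta>
    using lists[OF that(1), of m 0] split[of 0 e m \<theta>] that(2) by auto
  have post: "memory_after D (blocks sz (Suc e) m \<theta> @ block (sz e) (\<theta> e)) = run D (pre e \<theta>) (block (sz e) (\<theta> e))" for e \<theta>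
    by (simp add: pre_def memory_after_run run_append)
  have M_eq: "M \<theta> = run D (pre e \<theta>) (block (sz e) (\<theta> e) @ blocks sz 0 e \<theta>)" if "e < m" for e \<theta>
    using split[of 0 e m \<theta>] that by (simp add: M_def pre_def memory_after_run run_append)
  \<comment> \<open>Blocks run in order of decreasing index, so a smaller index means a later
    epoch.\<close>
  have CA: "C e' \<theta> \<subseteq> A e \<theta>" if "e' < e" "e < m" for e e' \<theta>
  proof -
    have "pre e' \<theta> = run D (run D (pre e \<theta>) (block (sz e) (\<theta> e))) (blocks sz (Suc e') e \<theta>)"
      using split[of "Suc e'" e m \<theta>] that by (simp add: pre_def memory_after_run run_append)
    then show ?thesis
      using split[of 0 e' e \<theta>] that by (auto simp: A_def C_def touched_append)
  qed
  have disj: "(C e' \<theta> - A e' \<theta>) \<inter> (C e \<theta> - A e \<theta>) = {}" if "e < m" "e' < m" "e \<noteq> e'" for e e' \<theta>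
    using CA[of e e' \<theta>] CA[of e' e \<theta>] that by (cases "e < e'") auto
  have sumK: "(\<Sum>e<m. real (card (K y \<theta> \<inter> (C e \<theta> - A e \<theta>)))) \<le> real (card (K y \<theta>))" for y \<theta>
  proof -
    have "(\<Sum>e<m. card (K y \<theta> \<inter> (C e \<theta> - A e \<theta>))) = card (\<Union>e\<in>{..<m}. K y \<theta> \<inter> (C e \<theta> - A e \<theta>))"
      using disj finK by (intro card_UN_disjoint[symmetric]) (simp, simp, blast)
    also have "\<dots> \<le> card (K y \<theta>)" using finK by (intro card_mono) auto
    finally show ?thesis by (simp flip: of_nat_sum)
  qed
  have total: "(\<Sum>y\<in>carrier F. \<Sum>\<theta>\<in>\<Omega>. real (card (K y \<theta>))) \<le> t * Z"
    using t(2) by (simp add: K_def M_def \<Omega>_def Z_def probes_def)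
  have "(\<Sum>e<m. \<Sum>y\<in>carrier F. \<Sum>\<theta>\<in>\<Omega>. real (card (K y \<theta> \<inter> (C e \<theta> - A e \<theta>))))
      = (\<Sum>y\<in>carrier F. \<Sum>\<theta>\<in>\<Omega>. \<Sum>e<m. real (card (K y \<theta> \<inter> (C e \<theta> - A e \<theta>))))"
    by (subst sum.swap, intro sum.cong refl) (rule sum.swap)
  also have "\<dots> \<le> (\<Sum>y\<in>carrier F. \<Sum>\<theta>\<in>\<Omega>. real (card (K y \<theta>)))"
    by (intro sum_mono sumK)
  finally have sum_e: "(\<Sum>e<m. \<Sum>y\<in>carrier F. \<Sum>\<theta>\<in>\<Omega>. real (card (K y \<theta> \<inter> (C e \<theta> - A e \<theta>)))) \<le> t * Z"
    using total by linarith
  have "\<exists>e<m. (\<Sum>y\<in>carrier F. \<Sum>\<theta>\<in>\<Omega>. real (card (K y \<theta> \<inter> (C e \<theta> - A e \<theta>)))) \<le> t * Z / real m"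
  proof (rule ccontr)
    assume "\<not> ?thesis"
    then have "(\<Sum>e<m. t * Z / real m) < (\<Sum>e<m. \<Sum>y\<in>carrier F. \<Sum>\<theta>\<in>\<Omega>. real (card (K y \<theta> \<inter> (C e \<theta> - A e \<theta>))))"
      using m by (intro sum_strict_mono) (auto simp: not_le)
    with sum_e m show False by simp
  qed
  then obtain e where e: "e < m"
    and epoch: "(\<Sum>y\<in>carrier F. \<Sum>\<theta>\<in>\<Omega>. real (card (K y \<theta> \<inter> (C e \<theta> - A e \<theta>)))) \<le> t * Z / real m"
    by blast
  let ?G = "\<lambda>y \<theta>. card (K y \<theta>) \<le> k \<and> card (K y \<theta> \<inter> (C e \<theta> - A e \<theta>)) \<le> k0"
  \<comment> \<open>Markov's inequality twice, in linear form: each of the two failures has a share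
    of at most 1/4, so half of all pairs are good.\<close>
  have pt: "1 - real (card (K y \<theta>)) / (4 * t) - real (card (K y \<theta> \<inter> (C e \<theta> - A e \<theta>))) / (4 * t / real m)
      \<le> of_bool (?G y \<theta>)" for y \<theta>
  proof -
    have ge: "real (card (K y \<theta>)) / (4 * t) \<ge> 1" if "\<not> card (K y \<theta>) \<le> k"
    proof -
      have "real (card (K y \<theta>)) \<ge> real k + 1" using that by linarith
      then show ?thesis using k_t t(1) by (simp add: field_simps)
    qed
    have ge': "real (card (K y \<theta> \<inter> (C e \<theta> - A e \<theta>))) / (4 * t / real m) \<ge> 1"
      if "\<not> card (K y \<theta> \<inter> (C e \<theta> - A e \<theta>)) \<le> k0"
    proof -
      have "real (card (K y \<theta> \<inter> (C e \<theta> - A e \<theta>))) \<ge> 4 * t / real m" using that k_t by linarith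
      moreover have "4 * t / real m > 0" using t m by simp
      ultimately show ?thesis by (subst le_divide_eq_1_pos)
    qed
    have nn: "0 \<le> real (card (K y \<theta>)) / (4 * t)"
      "0 \<le> real (card (K y \<theta> \<inter> (C e \<theta> - A e \<theta>))) / (4 * t / real m)" using t by auto
    show ?thesis
    proof (cases "?G y \<theta>")
      case True
      then have "of_bool (?G y \<theta>) = (1::real)" by simp
      with nn show ?thesis by linarith
    next
      case False
      then have "of_bool (?G y \<theta>) = (0::real)" by simp
      with nn ge ge' False show ?thesis by linarith
    qed
  qed
  have "Z / 2 \<le> Z - t * Z / (4 * t) - (t * Z / real m) / (4 * t / real m)"
    using t m by simp
  also have "\<dots> \<le> Z - (\<Sum>y\<in>carrier F. \<Sum>\<theta>\<in>\<Omega>. real (card (K y \<theta>))) / (4 * t)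
      - (\<Sum>y\<in>carrier F. \<Sum>\<theta>\<in>\<Omega>. real (card (K y \<theta> \<inter> (C e \<theta> - A e \<theta>)))) / (4 * t / real m)"
    using t m by (intro diff_mono order_refl divide_right_mono total epoch) auto
  also have "\<dots> = (\<Sum>y\<in>carrier F. \<Sum>\<theta>\<in>\<Omega>. 1 - real (card (K y \<theta>)) / (4 * t)
      - real (card (K y \<theta> \<inter> (C e \<theta> - A e \<theta>))) / (4 * t / real m))"
    by (simp only: sum_subtractf sum_divide_distrib) (simp add: Z_def)
  also have "\<dots> \<le> (\<Sum>y\<in>carrier F. \<Sum>\<theta>\<in>\<Omega>. of_bool (?G y \<theta>))"
    by (intro sum_mono pt)
  also have "\<dots> = (\<Sum>y\<in>carrier F. real (card {\<theta> \<in> \<Omega>. ?G y \<theta>}))"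
    by (simp only: card_filter_eq_sum[OF fin\<Omega>] of_nat_sum of_nat_of_bool)
  finally have good: "Z / 2 \<le> (\<Sum>y\<in>carrier F. real (card {\<theta> \<in> \<Omega>. ?G y \<theta>}))" .
  define key where "key \<theta> = \<theta>(e := undefined)" for \<theta> :: "nat \<Rightarrow> nat \<Rightarrow> 'a"
  have pre_key: "pre e (key \<theta>) = pre e \<theta>" for \<theta>
    using blocks_cong[of "Suc e" m "key \<theta>" \<theta> sz] by (simp add: pre_def key_def)
  interpret E: epoch_simulation \<Omega> M "A e" "C e" key "pre e" w "carrier F" "query_prog D"
  proof
    show "finite \<Omega>" "finite (carrier F)" by (fact fin\<Omega> F(2))+
    show "valid_prog w (query_prog D y)" if "y \<in> carrier F" for y
      using D(1) that by (simp add: has_cell_size_def)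
  next
    fix \<theta> assume \<theta>: "\<theta> \<in> \<Omega>"
    have bp: "bounded_memory w (pre e \<theta>)"
      unfolding pre_def by (rule run_bounded_initial[OF D(1) lists[OF \<theta>]]) simp
    then show "bounded_memory w (pre e (key \<theta>))" by (simp add: pre_key)
    show "bounded_memory w (M \<theta>)"
      unfolding M_def by (rule run_bounded_initial[OF D(1) lists[OF \<theta>]]) simp
    note rb = run_bounded[OF D(1) blk[OF \<theta> e] bp]
    show "C e \<theta> \<subseteq> {..<2 ^ w}" using rb by (simp add: C_def)
    show "A e \<theta> \<subseteq> {..<2 ^ w}"
      unfolding A_def using run_bounded[OF D(1) lists[OF \<theta>]] rb e by simp
    fix a assume "a \<notin> A e \<theta> \<union> C e \<theta>"
    then have "a \<notin> touched D (pre e \<theta>) (block (sz e) (\<theta> e) @ blocks sz 0 e \<theta>)"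
      by (simp add: A_def C_def touched_append)
    then show "M \<theta> a = pre e (key \<theta>) a"
      unfolding M_eq[OF e] pre_key by (rule run_outside_touched)
  qed
  have geo: "(\<Sum>e'\<in>{0..<e}. sz e') \<le> 2 * (B * \<beta> ^ e)"
  proof -
    have "(\<Sum>e'\<in>{0..<i}. \<beta> ^ Suc e') \<le> 2 * \<beta> ^ i" for i
    proof (induction i)
      case (Suc i)
      have "2 * \<beta> ^ i \<le> \<beta> * \<beta> ^ i" using q by (intro mult_le_mono1) (simp add: \<beta>_def)
      with Suc show ?case
        by (simp only: sum.atLeast0_lessThan_Suc power_Suc)
    qed simp
    then have "B * (\<Sum>e'\<in>{0..<e}. \<beta> ^ Suc e') \<le> B * (2 * \<beta> ^ e)" by (rule mult_le_mono2)
    then show ?thesis by (simp add: sz_def \<beta>_def sum_distrib_left)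
  qed
  \<comment> \<open>Origin of the ratio \<open>16 * q\<close>: all later epochs have at most
    \<open>2 * b\<close> updates and touch at most \<open>s = 2 * t\<^sub>u * b\<close> cells.
    Messages about twice that many cells need \<open>j = 4 * w * s = 8 * q * b\<close>, and moments
    of order \<open>2 * j\<close> need \<open>16 * q * b\<close> independent answers, exactly
    \<open>sz e\<close>.\<close>
  define b where "b = B * \<beta> ^ e"
  have sze: "sz e = 16 * q * b" by (simp add: sz_def b_def \<beta>_def)
  have "b > 0" using B q by (simp add: b_def \<beta>_def)
  have ans: "E.answer y \<theta> = sign (least_bit enc (poly_eval F n (coeffs_after F (blocks sz 0 m \<theta>)) y))"
    if "\<theta> \<in> \<Omega>" "y \<in> carrier F" for y \<theta>
    using D(2) lists[OF that(1), of m 0] that(2)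
    by (simp add: E.answer_def M_def solves_least_bit_poly_eval_def)
  have main: "p ^ r * (p ^ k0) ^ 2 / 32 / 2 ^ (45 * (2 ^ I * \<kappa>))
    \<le> 2 * sqrt (48 * real (8 * q * b) / real (card (carrier F))) + (1 + p) ^ (2 * (t\<^sub>u * sz e)) / 2 ^ (2 * (t\<^sub>u * b))"
  proof (rule E.simulation_bound[OF p \<kappa> k r])
    show "real (card (carrier F)) * real (card \<Omega>) / 2 \<le> (\<Sum>y\<in>carrier F. real (card {\<theta> \<in> \<Omega>.
      card (probed_cells (query_prog D y) (M \<theta>)) \<le> k \<and>
      card (probed_cells (query_prog D y) (M \<theta>) \<inter> (C e \<theta> - A e \<theta>)) \<le> k0}))"
      using good by (simp add: Z_def K_def)
    show "carrier F \<noteq> {}" "\<Omega> \<noteq> {}" by (fact neF ne\<Omega>)+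
    show "0 < 8 * q * b" using q \<open>b > 0\<close> by simp
    show "4 * w * (2 * (t\<^sub>u * b)) \<le> 8 * q * b" by (simp add: q)
    show "w > 0" using q by (cases w) auto
    show "(\<Sum>\<theta>\<in>{\<theta> \<in> \<Omega>. key \<theta> = kk}. \<Prod>y\<in>T. E.answer y \<theta>) = 0"
      if T: "T \<subseteq> carrier F" "T \<noteq> {}" "card T \<le> 2 * (8 * q * b)" for kk T
    proof -
      have "(\<Sum>\<theta>\<in>{\<theta> \<in> \<Omega>. key \<theta> = kk}. \<Prod>y\<in>T. E.answer y \<theta>)
          = (\<Sum>\<theta>\<in>{\<theta> \<in> block_space F m sz. \<theta>(e := undefined) = kk}.
              \<Prod>y\<in>T. sign (least_bit enc (poly_eval F n (coeffs_after F (blocks sz 0 m \<theta>)) y)))"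
        using T(1) ans by (intro sum.cong prod.cong) (auto simp: \<Omega>_def key_def)
      also have "\<dots> = 0"
        by (rule block_signs_independent[OF F enc e sz T(1,2)]) (use T(3) sze in auto)
      finally show ?thesis .
    qed
    show "card (A e \<theta>) \<le> 2 * (t\<^sub>u * b)" if \<theta>: "\<theta> \<in> \<Omega>" for \<theta>
    proof -
      have "card (A e \<theta>) \<le> t\<^sub>u * length (blocks sz 0 e \<theta>)"
        unfolding A_def post[symmetric]
        by (rule card_touched[OF D(3)]) (use lists[OF \<theta>] blk[OF \<theta> e] e in auto)
      also have "\<dots> \<le> t\<^sub>u * (2 * b)" using geo by (simp add: length_blocks b_def)
      finally show ?thesis by simp
    qed
    show "card (C e \<theta>) \<le> t\<^sub>u * sz e" if \<theta>: "\<theta> \<in> \<Omega>" for \<theta>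
      unfolding C_def pre_def using card_touched[OF D(3) lists[OF \<theta>] blk[OF \<theta> e], of m "Suc e"] by simp
  qed
  have "48 * real (8 * q * b) = 24 * real (sz e)" by (simp add: sze)
  from main[unfolded this, unfolded b_def \<beta>_def] e show ?thesis by blast
qed

section \<open>Choice of parameters\<close>

text \<open>If \<open>n\<close> is about \<open>(16 * q) ^ l\<close>, half of the exponent
  \<open>l\<close> is spent on the number of epochs and the other half on the size of the smallest
  one, which makes \<open>B\<close> about the square root of \<open>n\<close>.\<close>

lemma epoch_parameters:
  fixes n q :: nat
  assumes q: "q \<ge> 2" and n: "n \<ge> 16 * q"
  obtains m B :: nat where "m > 0" "B > 0" "B * (16 * q) ^ m \<le> n"
    "real m \<ge> log 2 (real n) / (20 * log 2 (real q))" "real B \<ge> sqrt (real n) / real (16 * q)"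
proof -
  define \<beta> where "\<beta> = 16 * q"
  have \<beta>: "\<beta> \<ge> 2" using q by (simp add: \<beta>_def)
  obtain l where l: "\<beta> ^ l \<le> n" "n < \<beta> ^ (l + 1)"
    using ex_power_ivl1[of \<beta> n] \<beta> n q by auto
  have l0: "l > 0" using l n by (cases l) (auto simp: \<beta>_def)
  define h where "h = l div 2"
  define m where "m = l - h"
  have hm: "h + m = l" "2 * m \<ge> l" "2 * h + 1 \<ge> l" "m > 0" using l0 by (auto simp: h_def m_def)
  show ?thesis
  proof (rule that[of m "\<beta> ^ h"])
    show "m > 0" "\<beta> ^ h > 0" using hm \<beta> by auto
    show "\<beta> ^ h * (16 * q) ^ m \<le> n" using l(1) hm by (simp only: \<beta>_def[symmetric] power_add[symmetric])
    have L: "log 2 (real q) \<ge> 1" using q by (subst le_log_iff) auto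
    have "real n \<le> real \<beta> ^ (l + 1)" using l(2) by (metis less_imp_le of_nat_le_iff of_nat_power)
    then have "log 2 (real n) \<le> log 2 (real \<beta> ^ (l + 1))" using n q by (subst log_le_cancel_iff) auto
    also have "\<dots> = real (l + 1) * log 2 (real \<beta>)" using \<beta> by (subst log_nat_power) auto
    also have "log 2 (real \<beta>) = 4 + log 2 (real q)"
    proof -
      have "log 2 (16 :: real) = 4" using log_pow_cancel[of 2 4] by simp
      then show ?thesis using q by (simp add: \<beta>_def log_mult)
    qed
    also have "real (l + 1) * (4 + log 2 (real q)) \<le> (4 * real m) * (5 * log 2 (real q))"
    proof (intro mult_mono)
      have "l + 1 \<le> 4 * m" using hm l0 by linarith
      then show "real (l + 1) \<le> 4 * real m" by linarith
    qed (use L in auto)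
    finally show "log 2 (real n) / (20 * log 2 (real q)) \<le> real m"
      using L by (simp add: divide_le_eq)
    have "n \<le> \<beta> ^ (2 * (h + 1))"
    proof -
      have "\<beta> ^ (l + 1) \<le> \<beta> ^ (2 * (h + 1))" using hm \<beta> by (intro power_increasing) auto
      with l(2) show ?thesis by linarith
    qed
    then have "real n \<le> (real \<beta> ^ (h + 1))\<^sup>2"
      by (metis of_nat_le_iff of_nat_power power_mult mult.commute)
    then have "sqrt (real n) \<le> real \<beta> ^ (h + 1)" by (intro real_le_lsqrt) auto
    then show "sqrt (real n) / real (16 * q) \<le> real (\<beta> ^ h)"
      unfolding \<beta>_def[symmetric] using \<beta> by (simp add: divide_le_eq mult.commute)
  qed
qed

text \<open>For the least admissible \<open>I > 0\<close>, \<open>4 ^ I * \<kappa>\<close> is within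
  a factor 4 of \<open>k\<close>, so \<open>2 ^ I * \<kappa>\<close> is about
  \<open>sqrt (k * \<kappa>)\<close>. For \<open>I = 0\<close> the degree may exceed this, but then
  \<open>k \<le> \<kappa>\<close>, and no set of cells on the path has more than \<open>k\<close>
  elements; hence the minimum.\<close>

lemma scale_exists:
  fixes k \<kappa> :: nat
  assumes "\<kappa> > 0"
  obtains I where "k \<le> 4 ^ I * \<kappa>"
    "real (min k (11 * (2 ^ I * \<kappa>))) \<le> 22 * sqrt (real k * real \<kappa>)"
    "real (2 ^ I * \<kappa>) \<le> real \<kappa> + 2 * sqrt (real k * real \<kappa>)"
proof -
  define I where "I = (LEAST I. k \<le> 4 ^ I * \<kappa>)"
  have "k < 4 ^ k" by (rule less_le_trans[OF less_exp power_mono]) auto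
  also have "(4::nat) ^ k * 1 \<le> 4 ^ k * \<kappa>" using assms by (intro mult_le_mono2) auto
  finally have "k \<le> 4 ^ k * \<kappa>" by simp
  then have I: "k \<le> 4 ^ I * \<kappa>" unfolding I_def by (rule LeastI)
  have s0: "0 \<le> sqrt (real k * real \<kappa>)" by simp
  show ?thesis
  proof (cases I)
    case 0
    then have "k \<le> \<kappa>" using I by simp
    then have "real k * real k \<le> real k * real \<kappa>" by (intro mult_left_mono) auto
    then have "real k \<le> sqrt (real k * real \<kappa>)" by (intro real_le_rsqrt) (simp add: power2_eq_square)
    then have "real (min k (11 * (2 ^ I * \<kappa>))) \<le> 22 * sqrt (real k * real \<kappa>)"
      using s0 by linarith
    then show ?thesis using that[of I] I s0 0 by simp
  next
    case (Suc J)
    then have "\<not> k \<le> 4 ^ J * \<kappa>" using not_less_Least[of J "\<lambda>I. k \<le> 4 ^ I * \<kappa>"] by (simp add: I_def)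
    then have J: "4 ^ J * \<kappa> \<le> k" by simp
    have "(2 ^ I * \<kappa>)\<^sup>2 = 4 * (4 ^ J * \<kappa>) * \<kappa>"
      by (simp add: Suc power2_eq_square) (simp flip: power_mult_distrib)
    also have "\<dots> \<le> 4 * k * \<kappa>" using J by (intro mult_le_mono1 mult_le_mono2)
    finally have "real ((2 ^ I * \<kappa>)\<^sup>2) \<le> real (4 * k * \<kappa>)" by (simp only: of_nat_le_iff)
    then have "(real (2 ^ I * \<kappa>))\<^sup>2 \<le> (2 * sqrt (real k * real \<kappa>))\<^sup>2"
      by (simp add: power_mult_distrib)
    then have X: "real (2 ^ I * \<kappa>) \<le> 2 * sqrt (real k * real \<kappa>)"
      by (rule power2_le_imp_le) simp
    have "real (min k (11 * (2 ^ I * \<kappa>))) \<le> 11 * real (2 ^ I * \<kappa>)"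
      using of_nat_mono[OF min.cobounded2[of k "11 * (2 ^ I * \<kappa>)"], where 'a = real]
      by (simp only: of_nat_mult of_nat_numeral)
    then show ?thesis using that[of I] I X by linarith
  qed
qed

text \<open>Apart from lower terms everything is of the order
  \<open>L * sqrt (k * \<kappa>)\<close>. With \<open>Y = t * L\<^sup>2\<close>, \<open>k\<close> of
  order \<open>t\<close> and \<open>\<kappa>\<close> of order \<open>1 + Y / G\<close>, its square
  is of order \<open>Y + Y ^ 2 / G\<close>.\<close>

lemma exponent_bound:
  fixes t L G a :: real and m k k0 \<kappa> r X :: nat
  assumes t: "t \<ge> 1" and L: "L \<ge> 1" and G: "G \<ge> 1" and m: "m > 0" "real m \<ge> G / (20 * L)"
    and k: "real k \<le> 4 * t" and k0: "real k0 \<le> 4 * t / real m"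
    and a: "6 \<le> a" "a \<le> 8 * L" and \<kappa>: "real \<kappa> = 3 + real k0 * a"
    and r: "real r \<le> 22 * sqrt (real k * real \<kappa>)" and X: "real X \<le> real \<kappa> + 2 * sqrt (real k * real \<kappa>)"
  shows "a * real r + 2 * real \<kappa> + 45 * real X \<le> 50000 * (sqrt (t * L\<^sup>2) + t * L\<^sup>2 / sqrt G + 1)"
proof -
  define Y where "Y = t * L\<^sup>2"
  define s where "s = sqrt (real k * real \<kappa>)"
  have Y: "Y \<ge> 0" using t by (simp add: Y_def)
  have s: "s \<ge> 0" by (simp add: s_def)
  have "4 * t / real m \<le> 4 * t / (G / (20 * L))"
    using t G L m by (intro divide_left_mono mult_pos_pos divide_pos_pos) auto
  then have k0': "real k0 \<le> 80 * t * L / G" using k0 by simp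
  have "real k0 * a \<le> (80 * t * L / G) * (8 * L)"
    using k0' a t L G by (intro mult_mono) auto
  then have \<kappa>': "real \<kappa> \<le> 3 + 640 * (Y / G)" by (simp add: \<kappa> Y_def power2_eq_square)
  have "(L * s)\<^sup>2 = L\<^sup>2 * (real k * real \<kappa>)" by (simp add: s_def power_mult_distrib)
  also have "\<dots> \<le> L\<^sup>2 * ((4 * t) * (3 + 640 * (Y / G)))"
    using k \<kappa>' t by (intro mult_left_mono mult_mono) auto
  also have "\<dots> = 12 * Y + 2560 * (Y\<^sup>2 / G)" by (simp add: Y_def power2_eq_square algebra_simps)
  \<comment> \<open>The numbers only have to satisfy \<open>12 \<le> 4 ^ 2\<close> and
    \<open>2560 \<le> 51 ^ 2\<close>.\<close>
  also have "\<dots> \<le> (4 * sqrt Y + 51 * (Y / sqrt G))\<^sup>2"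
  proof -
    have "(4 * sqrt Y + 51 * (Y / sqrt G))\<^sup>2 = 16 * Y + 2601 * (Y\<^sup>2 / G) + 2 * (4 * sqrt Y) * (51 * (Y / sqrt G))"
      using Y G by (simp add: power2_sum power_mult_distrib power_divide)
    moreover have "0 \<le> 2 * (4 * sqrt Y) * (51 * (Y / sqrt G))" "0 \<le> Y\<^sup>2 / G" using Y G by auto
    ultimately show ?thesis using Y by linarith
  qed
  finally have "(L * s)\<^sup>2 \<le> (4 * sqrt Y + 51 * (Y / sqrt G))\<^sup>2" .
  then have Ls: "L * s \<le> 4 * sqrt Y + 51 * (Y / sqrt G)"
    by (rule power2_le_imp_le) (use Y G in simp)
  have as: "a * s \<le> 8 * (4 * sqrt Y + 51 * (Y / sqrt G))"
  proof -
    have "a * s \<le> 8 * (L * s)" using mult_right_mono[OF a(2) s] by (simp only: mult.assoc)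
    also have "\<dots> \<le> 8 * (4 * sqrt Y + 51 * (Y / sqrt G))" using Ls by (intro mult_left_mono) auto
    finally show ?thesis .
  qed
  have "a * real r \<le> a * (22 * s)" using r a by (intro mult_left_mono) (auto simp: s_def)
  moreover have "6 * s \<le> a * s" using a s by (intro mult_right_mono) auto
  moreover have "Y / G \<le> Y / sqrt G"
  proof -
    have "sqrt G \<le> G" using G by (intro real_le_lsqrt) (auto simp: power2_eq_square)
    then show ?thesis using Y G by (intro divide_left_mono) auto
  qed
  moreover have "real X \<le> real \<kappa> + 2 * s" using X by (simp add: s_def)
  moreover have "0 \<le> sqrt Y" "0 \<le> Y / sqrt G" using Y G by auto
  ultimately have "a * real r + 2 * real \<kappa> + 45 * real X \<le> 50000 * (sqrt Y + Y / sqrt G + 1)"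
    using as \<kappa>' by (simp only: distrib_left)
  then show ?thesis by (simp add: Y_def)
qed

text \<open>One of the two summands on the right of \<open>main\<close> is at least half of the left
  side. If it is the first, \<open>d\<close> is bounded by a multiple of \<open>E\<close>; the term
  with \<open>sqrt G\<close> gives the claim directly, the other two by
  \<open>sqrt G \<le> d\<close>. If it is the second, \<open>B\<close> is: the divisor
  \<open>q\<close> in \<open>B\<close> and \<open>L \<le> q\<close> in \<open>L\<^sup>2\<close> add
  up to the power \<open>q ^ 3\<close>.\<close>

lemma tradeoff:
  fixes t L G :: real and d n q B E :: nat
  assumes t: "t \<ge> 1" and q: "q \<ge> 2" and L: "L = log 2 (real q)" and G: "1 \<le> G" "G \<le> real d"
    and B: "real B \<ge> sqrt (real n) / real (16 * q)"
    and E: "real E \<le> 50000 * (sqrt (t * L\<^sup>2) + t * L\<^sup>2 / sqrt G + 1)"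
    and main: "(1 / 2) ^ E \<le> 16 * 2 powr (- (3 * real d / 8)) + (1 / 2) ^ B"
  shows "t \<ge> 1 / (9 * 200000\<^sup>2) * min (real d * sqrt G / L\<^sup>2) (sqrt (real n) / real q ^ 3)"
proof -
  define C :: real where "C = 200000"
  define Y where "Y = t * L\<^sup>2"
  have L1: "L \<ge> 1" using q unfolding L by (subst le_log_iff) auto
  have Y: "Y \<ge> 1" using mult_mono[of 1 t 1 "L\<^sup>2"] t L1 by (simp add: Y_def)
  have sG: "1 \<le> sqrt G" using G by simp
  have sGd: "sqrt G \<le> real d"
  proof (rule real_le_lsqrt)
    have "real d * 1 \<le> real d * real d" using G by (intro mult_left_mono) auto
    with G show "G \<le> (real d)\<^sup>2" unfolding power2_eq_square by linarith
  qed (use G in auto)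
  have half: "(1 / 2) ^ E = 2 * (1 / 2 :: real) ^ Suc E" by simp
  have "(1 / 2 :: real) ^ Suc E \<le> 16 * 2 powr (- (3 * real d / 8)) \<or> (1 / 2 :: real) ^ Suc E \<le> (1 / 2) ^ B"
    using main unfolding half by linarith
  then consider "real d \<le> C * (sqrt Y + Y / sqrt G + 1)" | "real B \<le> real E + 1"
  proof
    assume "(1 / 2 :: real) ^ Suc E \<le> 16 * 2 powr (- (3 * real d / 8))"
    moreover have "(1 / 2 :: real) ^ Suc E = 2 powr (- real (Suc E))"
      by (simp only: powr_minus powr_realpow[OF zero_less_numeral] power_one_over inverse_eq_divide)
    moreover have "(16 :: real) * 2 powr (- (3 * real d / 8)) = 2 powr (4 - 3 * real d / 8)"
    proof -
      have "(2 :: real) powr 4 = 16" by simp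
      then show ?thesis by (simp only: diff_conv_add_uminus powr_add)
    qed
    ultimately have "2 powr (- real (Suc E)) \<le> 2 powr (4 - 3 * real d / 8)" by (simp only:)
    then have "- real (Suc E) \<le> 4 - 3 * real d / 8" by (subst (asm) powr_le_cancel_iff) auto
    then have d: "3 * real d \<le> 8 * (real E + 5)" by simp
    define u v where "u = sqrt Y" and "v = Y / sqrt G"
    have "real E \<le> 50000 * (u + v + 1)" using E by (simp add: Y_def u_def v_def)
    moreover have "0 \<le> u" "0 \<le> v" using Y sG by (auto simp: u_def v_def)
    ultimately have "real d \<le> C * (u + v + 1)" using d by (simp add: C_def distrib_left)
    then have "real d \<le> C * (sqrt Y + Y / sqrt G + 1)" by (simp only: u_def v_def)
    then show thesis by (rule that(1))
  next
    assume "(1 / 2 :: real) ^ Suc E \<le> (1 / 2) ^ B"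
    then have "B \<le> Suc E" by (subst (asm) power_decreasing_iff) auto
    then show thesis by (intro that(2)) simp
  qed
  then show ?thesis
  proof cases
    case 1
    have "real d * sqrt G \<le> 9 * C\<^sup>2 * Y"
    proof -
      have third: "x \<le> 3 * u \<or> x \<le> 3 * v \<or> x \<le> 3 * z" if "x \<le> u + v + z" for x u v z :: real
        using that by linarith
      have "real d \<le> C * sqrt Y + C * (Y / sqrt G) + C"
        using 1 by (simp only: distrib_left mult_1_right)
      from third[OF this]
      consider "real d \<le> 3 * C * sqrt Y" | "real d \<le> 3 * C * (Y / sqrt G)" | "real d \<le> 3 * C"
        by (metis mult.assoc)
      then show ?thesis
      proof cases
        case 1
        have "real d * sqrt G \<le> real d * real d" using sGd by (intro mult_left_mono) auto
        also have "\<dots> \<le> (3 * C * sqrt Y) * (3 * C * sqrt Y)" using 1 Y by (intro mult_mono) (auto simp: C_def)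
        also have "\<dots> = 9 * C\<^sup>2 * (sqrt Y)\<^sup>2" by (simp add: power2_eq_square)
        finally show ?thesis using Y by simp
      next
        case 2
        then have "real d * sqrt G \<le> 3 * C * Y" using sG by (simp add: field_simps)
        also have "\<dots> \<le> 9 * C\<^sup>2 * Y" using Y by (intro mult_right_mono) (auto simp: C_def)
        finally show ?thesis .
      next
        case 3
        have "real d * sqrt G \<le> real d * real d" using sGd by (intro mult_left_mono) auto
        also have "\<dots> \<le> (3 * C) * (3 * C)" using 3 by (intro mult_mono) (auto simp: C_def)
        also have "\<dots> = 9 * C\<^sup>2 * 1" by (simp add: power2_eq_square)
        also have "\<dots> \<le> 9 * C\<^sup>2 * Y" using Y by (intro mult_left_mono) auto
        finally show ?thesis .
      qed
    qed
    then have "1 / (9 * C\<^sup>2) * (real d * sqrt G / L\<^sup>2) \<le> t"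
      using L1 by (simp add: Y_def C_def field_simps)
    then have "1 / (9 * C\<^sup>2) * min (real d * sqrt G / L\<^sup>2) (sqrt (real n) / real q ^ 3) \<le> t"
      by (intro order_trans[OF mult_left_mono[OF min.cobounded1]]) auto
    then show ?thesis by (simp only: C_def)
  next
    case 2
    have "L \<le> real q"
    proof -
      have "real q \<le> 2 ^ q" using less_exp[of q] by (metis less_imp_le of_nat_le_iff of_nat_numeral of_nat_power)
      then have "log 2 (real q) \<le> log 2 (2 ^ q)" using q by (subst log_le_cancel_iff) auto
      then show ?thesis by (simp add: L log_nat_power)
    qed
    then have "L\<^sup>2 \<le> (real q)\<^sup>2" using L1 by (intro power_mono) auto
    then have Yq: "Y \<le> t * (real q)\<^sup>2" using t by (simp add: Y_def mult_left_mono)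
    have sY: "sqrt Y \<le> Y" using Y by (intro real_le_lsqrt) (auto simp: power2_eq_square)
    have YG: "Y / sqrt G \<le> Y" using Y sG by (simp add: divide_le_eq mult_le_cancel_left1)
    have "real E \<le> 50000 * (sqrt Y + Y / sqrt G + 1)" using E by (simp add: Y_def)
    also have "\<dots> \<le> 50000 * (Y + Y + Y)"
      by (rule mult_left_mono[OF add_mono[OF add_mono[OF sY YG] Y]]) simp
    finally have "real E \<le> 150000 * Y" by simp
    then have "real E + 1 \<le> C * Y" using Y by (simp add: C_def)
    then have "sqrt (real n) / real (16 * q) \<le> C * Y" using 2 B by linarith
    also have "\<dots> \<le> C * (t * (real q)\<^sup>2)" using Yq by (simp add: C_def)
    finally have "sqrt (real n) \<le> 16 * C * t * real q ^ 3"
      using q by (simp add: field_simps power2_eq_square power3_eq_cube)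
    also have "\<dots> \<le> 9 * C\<^sup>2 * t * real q ^ 3"
      using t by (intro mult_right_mono) (auto simp: C_def)
    finally have "1 / (9 * C\<^sup>2) * (sqrt (real n) / real q ^ 3) \<le> t"
      using q by (simp add: C_def field_simps)
    then have "1 / (9 * C\<^sup>2) * min (real d * sqrt G / L\<^sup>2) (sqrt (real n) / real q ^ 3) \<le> t"
      by (intro order_trans[OF mult_left_mono[OF min.cobounded2]]) auto
    then show ?thesis by (simp only: C_def)
  qed
qed

lemma deterministic_tradeoff:
  fixes F :: "('a, 'b) ring_scheme" and D :: "'a data_structure" and t :: real and q m B :: nat
  assumes F: "is_GF2 F d" and enc: "bit_encoding F d enc" "d > 0"
    and n: "real n \<le> 2 powr (real d / 4)" "n \<ge> 2"
    and D: "has_cell_size F n w D" "solves_least_bit_poly_eval F enc n D"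
      "worst_case_update_time F n t\<^sub>u D"
    and q: "q = t\<^sub>u * w" "q \<ge> 2" and m: "m > 0" and B: "B > 0" "B * (16 * q) ^ m \<le> n"
      "real m \<ge> log 2 (real n) / (20 * log 2 (real q))" "real B \<ge> sqrt (real n) / real (16 * q)"
  defines "sz \<equiv> \<lambda>e. B * (16 * q) ^ Suc e"
  assumes t: "t \<ge> 1" "(\<Sum>y\<in>carrier F. \<Sum>\<theta>\<in>block_space F m sz.
      real (probes (query_prog D y) (memory_after D (blocks sz 0 m \<theta>))))
        \<le> t * (real (card (carrier F)) * real (card (block_space F m sz)))"
  shows "t \<ge> 1 / (9 * 200000\<^sup>2) *
    min (real d * sqrt (log 2 (real n)) / (log 2 (real q))\<^sup>2) (sqrt (real n) / real q ^ 3)"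
proof -
  define L where "L = log 2 (real q)"
  define G where "G = log 2 (real n)"
  \<comment> \<open>Chosen such that \<open>2 ^ a\<close> is at least \<open>1 / p\<close>: every
    factor \<open>p\<close> costs at most \<open>a\<close> bits, the 6 standing for
    \<open>64 = 2 ^ 6\<close>.\<close>
  define a where "a = 6 + nat \<lceil>L\<rceil>"
  define k where "k = nat \<lfloor>4 * t\<rfloor>"
  define k0 where "k0 = nat \<lfloor>4 * t / real m\<rfloor>"
  \<comment> \<open>\<open>k0 * a\<close> bits pay for \<open>p ^ k0\<close>, and 3 for the division
    by 8.\<close>
  define \<kappa> where "\<kappa> = 3 + k0 * a"
  \<comment> \<open>With 64 the exponential moment is at most
    \<open>exp (t\<^sub>u * b / 2)\<close>, well below \<open>2 ^ (t\<^sub>u * b)\<close>; against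
    the threshold of \<open>2 * t\<^sub>u * b\<close> cells this leaves a tail of
    \<open>(1 / 2) ^ (t\<^sub>u * b)\<close>.\<close>
  define p where "p = 1 / (64 * real q)"
  have field: "field F" "finite (carrier F)" and cardF: "card (carrier F) = 2 ^ d"
    using F by (auto simp: is_GF2_def)
  have L: "L \<ge> 1" using q(2) unfolding L_def by (subst le_log_iff) auto
  have G1: "G \<ge> 1" using n unfolding G_def by (subst le_log_iff) auto
  have Gd: "G \<le> real d"
  proof -
    have "G \<le> log 2 (2 powr (real d / 4))" using n unfolding G_def by (subst log_le_cancel_iff) auto
    then show ?thesis by simp
  qed
  have p: "0 < p" "p \<le> 1" using q(2) by (auto simp: p_def)
  have a: "6 \<le> real a" "real a \<le> 8 * L"
  proof -
    have "real (nat \<lceil>L\<rceil>) \<le> L + 1" using L by linarith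
    then show "real a \<le> 8 * L" using L unfolding a_def of_nat_add of_nat_numeral by linarith
  qed (simp add: a_def)
  have pa: "(1 / 2) ^ a \<le> p"
  proof -
    have "real q = 2 powr L" using q(2) by (simp add: L_def)
    also have "\<dots> \<le> 2 powr real (nat \<lceil>L\<rceil>)" by (intro powr_mono) linarith+
    also have "\<dots> = 2 ^ nat \<lceil>L\<rceil>" by (simp add: powr_realpow)
    finally have "64 * real q \<le> 2 ^ a" by (simp add: a_def power_add)
    then show ?thesis using q(2) by (simp add: p_def power_divide divide_left_mono)
  qed
  have pk: "(1 / 2) ^ (a * i) \<le> p ^ i" for i
    unfolding power_mult by (intro power_mono pa) auto
  have \<kappa>: "\<kappa> > 0" "(1 / 2) ^ \<kappa> \<le> p ^ k0 / 8"
  proof -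
    have "(1 / 2 :: real) ^ \<kappa> = (1 / 2) ^ (a * k0) / 8"
      by (simp add: \<kappa>_def power_add mult.commute power3_eq_cube)
    then show "(1 / 2) ^ \<kappa> \<le> p ^ k0 / 8" using pk[of k0] by simp
  qed (simp add: \<kappa>_def)
  obtain I where I: "k \<le> 4 ^ I * \<kappa>"
    "real (min k (11 * (2 ^ I * \<kappa>))) \<le> 22 * sqrt (real k * real \<kappa>)"
    "real (2 ^ I * \<kappa>) \<le> real \<kappa> + 2 * sqrt (real k * real \<kappa>)"
    using scale_exists[OF \<kappa>(1), of k] by blast
  define X where "X = 2 ^ I * \<kappa>"
  define r where "r = min k (11 * X)"
  \<comment> \<open>All losses in bits: the \<open>r\<close> tested cells, the square of
    \<open>p ^ k0\<close> with the constants absorbed by \<open>\<kappa>\<close>, and the norm of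
    the polynomial.\<close>
  define E where "E = a * r + 2 * \<kappa> + 45 * X"
  have "\<exists>e < m. p ^ r * (p ^ k0) ^ 2 / 32 / 2 ^ (45 * (2 ^ I * \<kappa>))
    \<le> 2 * sqrt (24 * real (sz e) / real (card (carrier F)))
      + (1 + p) ^ (2 * (t\<^sub>u * sz e)) / 2 ^ (2 * (t\<^sub>u * (B * (16 * q) ^ e)))"
    unfolding sz_def
  proof (rule deterministic_bound[OF field enc D q(1) _ m B(1) _ _ t(2)[unfolded sz_def] p \<kappa> I(1)])
    show "4 * t \<le> real k + 1" unfolding k_def by linarith
    show "4 * t / real m \<le> real k0 + 1" unfolding k0_def by linarith
  qed (use q(2) B t in \<open>auto simp: r_def X_def\<close>)
  then obtain e where e: "e < m" and bound: "p ^ r * (p ^ k0) ^ 2 / 32 / 2 ^ (45 * X)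
    \<le> 2 * sqrt (24 * real (sz e) / real (card (carrier F)))
      + (1 + p) ^ (2 * (t\<^sub>u * sz e)) / 2 ^ (2 * (t\<^sub>u * (B * (16 * q) ^ e)))"
    unfolding X_def by blast
  define b where "b = B * (16 * q) ^ e"
  have sze: "sz e = 16 * q * b" by (simp add: sz_def b_def)
  have szn: "sz e \<le> n"
  proof -
    have "(16 * q) ^ Suc e \<le> (16 * q) ^ m" using e q(2) by (intro power_increasing) auto
    then have "B * (16 * q) ^ Suc e \<le> B * (16 * q) ^ m" by (rule mult_le_mono2)
    also note B(2)
    finally show ?thesis by (simp only: sz_def)
  qed
  have Bb: "B \<le> t\<^sub>u * b"
  proof -
    have "0 < t\<^sub>u" using q by (cases t\<^sub>u) auto
    then have "1 \<le> t\<^sub>u * (16 * q) ^ e" using q(2) by (simp add: Suc_le_eq)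
    then have "B * 1 \<le> B * (t\<^sub>u * (16 * q) ^ e)" by (rule mult_le_mono2)
    then show ?thesis by (simp add: b_def ac_simps)
  qed
  have 1: "2 * sqrt (24 * real (sz e) / real (card (carrier F))) \<le> 16 * 2 powr (- (3 * real d / 8))"
  proof -
    \<comment> \<open>Here \<open>n \<le> 2 powr (d / 4)\<close> enters: the quotient is at most a
      constant times \<open>2 powr (- 3 * d / 4)\<close>, and the root halves the exponent.\<close>
    have "24 * real (sz e) / real (card (carrier F)) \<le> 24 * 2 powr (real d / 4) / 2 powr real d"
      using szn n cardF by (intro frac_le mult_left_mono) (auto simp: powr_realpow)
    also have "\<dots> = 24 * (2 powr (- (3 * real d / 8)))\<^sup>2"
    proof -
      have "real d / 4 - real d = - (3 * real d / 8) + - (3 * real d / 8)" by simp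
      then show ?thesis
        by (simp only: power2_eq_square powr_add[symmetric] times_divide_eq_right[symmetric] powr_diff[symmetric])
    qed
    also have "\<dots> \<le> (8 * 2 powr (- (3 * real d / 8)))\<^sup>2" by (simp add: power_mult_distrib)
    finally have "sqrt (24 * real (sz e) / real (card (carrier F))) \<le> 8 * 2 powr (- (3 * real d / 8))"
      by (intro real_le_lsqrt) auto
    then show ?thesis by simp
  qed
  have 2: "(1 + p) ^ (2 * (t\<^sub>u * sz e)) / 2 ^ (2 * (t\<^sub>u * b)) \<le> (1 / 2) ^ B"
  proof -
    have "(1 + p) ^ (2 * (t\<^sub>u * sz e)) \<le> exp p ^ (2 * (t\<^sub>u * sz e))"
      using p by (intro power_mono exp_ge_add_one_self) auto
    also have "\<dots> = exp (real (t\<^sub>u * b) * (1 / 2))"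
      using q(2) by (simp add: exp_of_nat_mult[symmetric] sze p_def)
    also have "\<dots> = exp (1 / 2) ^ (t\<^sub>u * b)" by (rule exp_of_nat_mult)
    also have "\<dots> \<le> 2 ^ (t\<^sub>u * b)"
    proof (intro power_mono)
      have "(exp (1 / 2 :: real))\<^sup>2 = exp 1" by (simp flip: exp_double)
      also have "\<dots> \<le> 2\<^sup>2" using exp_le by simp
      finally show "exp (1 / 2 :: real) \<le> 2" by (rule power2_le_imp_le) simp
    qed simp
    finally have "(1 + p) ^ (2 * (t\<^sub>u * sz e)) / 2 ^ (2 * (t\<^sub>u * b)) \<le> 2 ^ (t\<^sub>u * b) / 2 ^ (2 * (t\<^sub>u * b))"
      by (intro divide_right_mono) auto
    also have "\<dots> = (1 / 2) ^ (t\<^sub>u * b)" by (simp only: mult_2 power_add) (simp add: power_divide)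
    also have "\<dots> \<le> (1 / 2) ^ B" using Bb by (intro power_decreasing) auto
    finally show ?thesis .
  qed
  have 3: "(1 / 2) ^ E \<le> p ^ r * (p ^ k0) ^ 2 / 32 / 2 ^ (45 * X)"
  proof -
    have "(1 / 2 :: real) ^ E = (1 / 2) ^ (a * r) * ((1 / 2) ^ \<kappa>)\<^sup>2 * (1 / 2) ^ (45 * X)"
      by (simp only: E_def power_add mult_2) (simp only: power2_eq_square)
    also have "\<dots> \<le> p ^ r * (p ^ k0 / 8)\<^sup>2 * (1 / 2) ^ (45 * X)"
      by (intro mult_mono pk power_mono \<kappa>(2) mult_nonneg_nonneg) (use p in auto)
    also have "\<dots> = p ^ r * (p ^ k0) ^ 2 / 64 / 2 ^ (45 * X)"
      by (simp add: power_divide)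
    also have "\<dots> \<le> p ^ r * (p ^ k0) ^ 2 / 32 / 2 ^ (45 * X)"
      using p by (intro divide_right_mono divide_left_mono) auto
    finally show ?thesis .
  qed
  have "real E \<le> 50000 * (sqrt (t * L\<^sup>2) + t * L\<^sup>2 / sqrt G + 1)"
  proof -
    have "real a * real r + 2 * real \<kappa> + 45 * real X \<le> 50000 * (sqrt (t * L\<^sup>2) + t * L\<^sup>2 / sqrt G + 1)"
    proof (rule exponent_bound[OF t(1) L G1 m _ _ _ a])
      show "real m \<ge> G / (20 * L)" using B(3) by (simp add: G_def L_def)
      show "real k \<le> 4 * t" using t by (simp add: k_def)
      show "real k0 \<le> 4 * t / real m" using t by (simp add: k0_def)
      show "real \<kappa> = 3 + real k0 * real a" by (simp add: \<kappa>_def)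
    qed (use I in \<open>simp_all add: r_def X_def\<close>)
    then show ?thesis by (simp add: E_def)
  qed
  from tradeoff[OF t(1) q(2) L_def G1 Gd B(4) this]
  show ?thesis using 1 2 3 bound[folded b_def] unfolding G_def L_def by linarith
qed

section \<open>Randomized data structures\<close>

lemma expectation_average_attained:
  fixes R :: "'d pmf" and f :: "'d \<Rightarrow> real"
  assumes "\<And>D. D \<in> set_pmf R \<Longrightarrow> \<bar>f D\<bar> \<le> b" "measure_pmf.expectation R f \<le> c"
  obtains D where "D \<in> set_pmf R" "f D \<le> c"
proof (rule ccontr)
  assume neg: "\<not> thesis"
  have "integrable (measure_pmf R) f"
    using assms(1) by (intro measure_pmf.integrable_const_bound[where B = b]) (auto simp: AE_measure_pmf_iff)
  moreover have "AE D in measure_pmf R. c < f D"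
    using neg that by (auto simp: AE_measure_pmf_iff not_le[symmetric])
  ultimately have "c < measure_pmf.expectation R f" by (rule measure_pmf.expectation_greater)
  with assms(2) show False by simp
qed

theorem theorem3:
  fixes c\<^sub>0 :: real
  assumes "c\<^sub>0 > 0"
  shows "\<exists>c > 0. \<exists>C::nat. \<forall>(d::nat) (n::nat) (w::nat) (t\<^sub>u::nat) (t\<^sub>q::real)
           (F :: 'a ring) (enc :: 'a \<Rightarrow> bool list) (R :: 'a data_structure pmf).
           d > 0 \<longrightarrow>
           real n \<le> 2 powr (real d / 4) \<longrightarrow>
           real w \<ge> c\<^sub>0 * log 2 (real n) \<longrightarrow>
           is_GF2 F d \<longrightarrow>
           bit_encoding F d enc \<longrightarrow>
           randomized_least_bit_ds F enc n w t\<^sub>u R \<longrightarrow>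
           expected_average_query_time F n t\<^sub>q R \<longrightarrow>
           t\<^sub>q \<ge> c * min (real d * sqrt (log 2 (real n)) / (log 2 (real (t\<^sub>u * w)))\<^sup>2)
                       (sqrt (real n) / real (t\<^sub>u * w) ^ C)"
proof -
  define c :: real where "c = 1 / (9 * 200000\<^sup>2)"
  have "t \<ge> c * min (real d * sqrt (log 2 (real n)) / (log 2 (real (t\<^sub>u * w)))\<^sup>2) (sqrt (real n) / real (t\<^sub>u * w) ^ 3)"
    if d: "d > 0" and n: "real n \<le> 2 powr (real d / 4)" and F: "is_GF2 F d" and enc: "bit_encoding F d enc"
      and R: "randomized_least_bit_ds F enc n w t\<^sub>u R" and tq: "expected_average_query_time F n t R"
    for d n w t\<^sub>u :: nat and t :: real and F :: "'a ring" and enc :: "'a \<Rightarrow> bool list" and R :: "'a data_structure pmf"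
  proof -
    define N where "N = real (card (carrier F))"
    define q where "q = t\<^sub>u * w"
    have field: "field F" and fin: "finite (carrier F)" and N: "N > 0"
      using F by (auto simp: is_GF2_def N_def)
    interpret field F by (rule field)
    have D: "has_cell_size F n w D" "solves_least_bit_poly_eval F enc n D" "worst_case_update_time F n t\<^sub>u D"
      if "D \<in> set_pmf R" for D using R that by (auto simp: randomized_least_bit_ds_def)
    let ?X = "\<lambda>us y D. real (probes (query_prog D y) (memory_after D us))"
    have X_le: "?X us y D \<le> 2 ^ w" if "us \<in> lists (updates F n)" "y \<in> carrier F" "D \<in> set_pmf R" for us y D
      using probes_le(2)[OF D(1)[OF that(3)] that(1,2)] by (metis of_nat_le_iff of_nat_numeral of_nat_power)
    have int: "integrable (measure_pmf R) (?X us y)" if "us \<in> lists (updates F n)" "y \<in> carrier F" for us y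
      using X_le[OF that] by (intro measure_pmf.integrable_const_bound[where B = "2 ^ w"]) (auto simp: AE_measure_pmf_iff)
    have avg: "(\<Sum>y\<in>carrier F. measure_pmf.expectation R (?X us y)) \<le> t * N" if "us \<in> lists (updates F n)" for us
      using tq that N unfolding expected_average_query_time_def N_def[symmetric] by (simp add: divide_le_eq)
    have t1: "t \<ge> 1"
    proof -
      have "1 \<le> measure_pmf.expectation R (?X [] y)" if y: "y \<in> carrier F" for y
      proof -
        have "measure_pmf.expectation R (\<lambda>_. 1) \<le> measure_pmf.expectation R (?X [] y)"
        proof (intro integral_mono_AE)
          show "integrable (measure_pmf R) (?X [] y)" by (rule int) (auto simp: y)
          have "?X [] y D \<ge> 1" if "D \<in> set_pmf R" for D
            using query_probes_pos[OF field fin enc d D(2)[OF that] y, of "[]"] by simp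
          then show "AE D in measure_pmf R. 1 \<le> ?X [] y D" by (simp add: AE_measure_pmf_iff)
        qed simp
        then show ?thesis by simp
      qed
      then have "(\<Sum>y\<in>carrier F. 1) \<le> (\<Sum>y\<in>carrier F. measure_pmf.expectation R (?X [] y))" by (rule sum_mono)
      also have "\<dots> \<le> t * N" by (rule avg) simp
      finally show ?thesis using N by (simp add: N_def)
    qed
    \<comment> \<open>As \<open>4 * c \<le> 1\<close>, the bound \<open>t \<ge> 1\<close> suffices
      here.\<close>
    have trivial: ?thesis if "min (real d * sqrt (log 2 (real n)) / (log 2 (real q))\<^sup>2) (sqrt (real n) / real q ^ 3) \<le> 4"
    proof -
      have "c * min (real d * sqrt (log 2 (real n)) / (log 2 (real q))\<^sup>2) (sqrt (real n) / real q ^ 3) \<le> c * 4"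
        using that by (intro mult_left_mono) (auto simp: c_def)
      also have "\<dots> \<le> 1" by (simp add: c_def)
      finally show ?thesis using t1 by (simp add: q_def)
    qed
    consider "n \<le> 1" | "q \<le> 1" | "n \<ge> 2" "q \<ge> 2" "n < 16 * q" | "n \<ge> 2" "q \<ge> 2" "n \<ge> 16 * q" by linarith
    then show ?thesis
    proof cases
      case 1
      then have "log 2 (real n) = 0" by (cases n) (auto simp: log_def)
      then show ?thesis by (intro trivial) (simp add: min_le_iff_disj)
    next
      case 2
      \<comment> \<open>Division by zero yields zero, so the first term of the minimum is 0.\<close>
      then have "log 2 (real q) = 0" by (cases q) (auto simp: log_def)
      then show ?thesis by (intro trivial) (simp add: min_le_iff_disj)
    next
      case 3
      have "real n \<le> (4 * real q ^ 3)\<^sup>2"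
      proof -
        have "real n \<le> 16 * (real q ^ 1)" using 3 by simp
        also have "\<dots> \<le> 16 * (real q ^ 6)" using 3 by (intro mult_left_mono power_increasing) auto
        also have "\<dots> = (4 * real q ^ 3)\<^sup>2" by (simp add: power_mult_distrib flip: power_mult)
        finally show ?thesis .
      qed
      then have "sqrt (real n) \<le> 4 * real q ^ 3" by (intro real_le_lsqrt) auto
      then have "sqrt (real n) / real q ^ 3 \<le> 4" using 3 by (simp add: divide_le_eq)
      then show ?thesis by (intro trivial) (simp add: min_le_iff_disj)
    next
      case 4
      obtain m B where mB: "m > 0" "B > 0" "B * (16 * q) ^ m \<le> n"
        "real m \<ge> log 2 (real n) / (20 * log 2 (real q))" "real B \<ge> sqrt (real n) / real (16 * q)"
        by (rule epoch_parameters[OF 4(2,3)])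
      define sz where "sz = (\<lambda>e. B * (16 * q) ^ Suc e)"
      define \<Omega> where "\<Omega> = block_space F m sz"
      have sz: "sz e \<le> Suc n" if "e < m" for e
      proof -
        have "(16 * q) ^ Suc e \<le> (16 * q) ^ m" using that 4 by (intro power_increasing) auto
        then have "B * (16 * q) ^ Suc e \<le> B * (16 * q) ^ m" by (rule mult_le_mono2)
        then show ?thesis using mB(3) unfolding sz_def by linarith
      qed
      have fin\<Omega>: "finite \<Omega>" using fin by (auto simp: \<Omega>_def block_space_def intro!: finite_PiE)
      have lists: "blocks sz 0 m \<theta> \<in> lists (updates F n)" if "\<theta> \<in> \<Omega>" for \<theta>
        using blocks_in_updates[OF that[unfolded \<Omega>_def] order_refl sz] by blast
      let ?f = "\<lambda>D. \<Sum>y\<in>carrier F. \<Sum>\<theta>\<in>\<Omega>. ?X (blocks sz 0 m \<theta>) y D"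
      have "measure_pmf.expectation R ?f = (\<Sum>y\<in>carrier F. \<Sum>\<theta>\<in>\<Omega>. measure_pmf.expectation R (?X (blocks sz 0 m \<theta>) y))"
        using int lists by (subst Bochner_Integration.integral_sum) (auto intro!: sum.cong)
      also have "\<dots> = (\<Sum>\<theta>\<in>\<Omega>. \<Sum>y\<in>carrier F. measure_pmf.expectation R (?X (blocks sz 0 m \<theta>) y))"
        by (rule sum.swap)
      also have "\<dots> \<le> (\<Sum>\<theta>\<in>\<Omega>. t * N)" by (intro sum_mono avg lists)
      \<comment> \<open>The bound holds on average over the blocks and the queries, so some
        deterministic member of the support meets it on the hard distribution.\<close>
      finally have E: "measure_pmf.expectation R ?f \<le> t * (N * real (card \<Omega>))" by (simp add: ac_simps)
      have "\<bar>?f D\<bar> \<le> (\<Sum>y\<in>carrier F. \<Sum>\<theta>\<in>\<Omega>. 2 ^ w)" if "D \<in> set_pmf R" for D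
      proof -
        have "?f D \<le> (\<Sum>y\<in>carrier F. \<Sum>\<theta>\<in>\<Omega>. 2 ^ w)" using X_le[OF lists _ that] by (intro sum_mono) auto
        moreover have "0 \<le> ?f D" by (intro sum_nonneg) auto
        ultimately show ?thesis by simp
      qed
      then obtain D0 where D0: "D0 \<in> set_pmf R" "?f D0 \<le> t * (N * real (card \<Omega>))"
        using expectation_average_attained[OF _ E] by blast
      show ?thesis
        unfolding c_def q_def[symmetric]
        by (rule deterministic_tradeoff[OF F enc d n 4(1) D[OF D0(1)] q_def 4(2) mB t1])
          (use D0(2) in \<open>simp only: N_def \<Omega>_def sz_def\<close>)
    qed
  qed
  moreover have "c > 0" by (simp add: c_def)
  ultimately show ?thesis by blast
qed

end
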